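(* Let $\omega\subset\mathbb R^2$ be a bounded domain, let $\mu\in(0,2)$, let $\lambda=\frac{4-\mu}{4}$, let $p\in(\frac2\mu,\infty]$, and let $q$ be given by $\frac1q+\frac1{2p}=\lambda$. Suppose $(\Omega_k)_{k=1}^\infty$ is a sequence of bounded domains in $\mathbb R^2$ with $\omega\subset\Omega_1\subset\Omega_2\subset\cdots$. Suppose that for each $k$, $u_k:\Omega_k\to\mathbb R$ (with $u_k\in L^1_{\mathrm{loc}}(\omega)$) and $V_k:\omega\to[0,\infty)$ are functions for which $$-\Delta u_k=V_k\,I_\mu[e^{\lambda u_k}\chi_{\Omega_k}]\,e^{\lambda u_k}\qquad\text{in }\omega$$ in the sense of distributions, and that there is $c_0>0$ such that $$\|V_k\|_{L^p(\omega)}+\|e^{\lambda u_k}\|_{L^q(\Omega_k)}\le c_0\qquad\text{for all }k.$$ Then there is a subsequence $(u_{k_\ell})_{\ell=1}^\infty$ of $(u_k)_{k=1}^\infty$ for which one of the following alternatives holds: (A1) $(u_{k_\ell})_{\ell=1}^\infty$ is bounded in $L^\infty_{\mathrm{loc}}(\omega)$; (A2) $u_{k_\ell}\to-\infty$ locally uniformly on $\omega$; (A3) there exists a finite nonempty set $S=\{a^1,\dots,a^m\}\subset\omega$ such that for all $i\in\{1,\dots,m\}$ there is a sequence $(x^i_\ell)_{\ell=1}^\infty\subset\omega$ with $x^i_\ell\to a^i$ and $u_{k_\ell}(x^i_\ell)\to\infty$. Moreover, $u_{k_\ell}\to-\infty$ locally uniformly on $\omega\setminus S$, and $$V_{k_\ell}I_\mu[e^{\lambda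 u_{k_\ell}}\chi_{\Omega_{k_\ell}}]e^{\lambda u_{k_\ell}}\rightharpoonup\sum_{i=1}^m\alpha_i\delta_{a^i}$$ weak-$*$ in the sense of measures on $\omega$, with $\alpha_i\ge4\pi\left(1-\frac1{2\lambda p}\right)$ for all $i$.
   Context: For $\mu\in(0,2)$, $I_\mu f(x)=\int_{\mathbb R^2}\frac{f(y)}{|x-y|^\mu}\,dy$. $\chi_A$ is the characteristic function of $A$ (a product $g\chi_A$ is extended by zero outside $A$). For $f\in L^1(\omega)$, a distributional solution of $-\Delta u=f$ in an open set $\omega\subset\mathbb R^2$ is a function $u\in L^1_{\mathrm{loc}}(\omega)$ with $-\int_\omega u\,\Delta\varphi=\int_\omega f\varphi$ for all $\varphi\in C_c^\infty(\omega)$. Under the stated integrability hypotheses the right-hand side of the equation lies in $L^1(\omega)$. Solutions are identified on $\omega$ with their continuous representatives. $\delta_a$ is the Dirac mass at $a$; weak-$*$ convergence of $f_\ell$ to a measure $\eta$ on $\omega$ means $\int_\omega f_\ell\psi\,dx\to\int_\omega\psi\,d\eta$ for all $\psi\in C_c(\omega)$. When $p=\infty$, $\frac1p=0$. *)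

theory Defs
  imports "HOL-Probability.Probability"
begin

definition bounded_domain :: "'a::euclidean_space set \<Rightarrow> bool" where
  "bounded_domain D \<longleftrightarrow> open D \<and> connected D \<and> D \<noteq> {} \<and> bounded D"

subsection \<open>Lebesgue norms and local integrability\<close>

text \<open>
  The norm of L^p for an extended exponent; it is \<^term>\<open>\<infinity> :: ennreal\<close> when the integral
  diverges. It is meant for measurable functions, since for a non-measurable integrand
  \<^const>\<open>nn_integral\<close> is only a lower integral; measurability is therefore always a separate
  assumption.
\<close>
definition Lp_norm :: "ennreal \<Rightarrow> 'a measure \<Rightarrow> ('a \<Rightarrow> real) \<Rightarrow> ennreal" where
  "Lp_norm p M f =
     (if p = \<infinity> then esssup M (\<lambda>x. ennreal \<bar>f x\<bar>)
      else (let I = (\<integral>\<^sup>+x. ennreal (\<bar>f x\<bar> powr enn2real p) \<partial>M)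
            in if I = \<infinity> then \<infinity> else ennreal (enn2real I powr (1 / enn2real p))))"

definition L1_loc :: "'a::euclidean_space set \<Rightarrow> ('a \<Rightarrow> real) \<Rightarrow> bool" where
  "L1_loc D f \<longleftrightarrow> f \<in> borel_measurable (lebesgue_on D) \<and>
     (\<forall>K. compact K \<and> K \<subseteq> D \<longrightarrow> integrable (lebesgue_on K) f)"

definition bounded_in_Linf_loc :: "'a::euclidean_space set \<Rightarrow> (nat \<Rightarrow> 'a \<Rightarrow> real) \<Rightarrow> bool" where
  "bounded_in_Linf_loc D f \<longleftrightarrow>
     (\<forall>K. compact K \<and> K \<subseteq> D \<longrightarrow> (\<exists>C::real. \<forall>l. Lp_norm \<infinity> (lebesgue_on K) (f l) \<le> ennreal C))"

text \<open>Local uniformity on an open set is expressed as uniformity on its compact subsets.\<close>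
definition tendsto_minus_infinity_loc_unif ::
    "'a::euclidean_space set \<Rightarrow> (nat \<Rightarrow> 'a \<Rightarrow> real) \<Rightarrow> bool" where
  "tendsto_minus_infinity_loc_unif D f \<longleftrightarrow>
     (\<forall>K. compact K \<and> K \<subseteq> D \<longrightarrow> (\<forall>M::real. \<forall>\<^sub>F l in sequentially. \<forall>x\<in>K. f l x \<le> M))"

definition continuous_representative ::
    "'a::euclidean_space set \<Rightarrow> ('a \<Rightarrow> real) \<Rightarrow> ('a \<Rightarrow> real) \<Rightarrow> bool" where
  "continuous_representative D u v \<longleftrightarrow> continuous_on D v \<and> (AE x in lebesgue_on D. v x = u x)"

subsection \<open>Test functions and distributional solutions\<close>

definition partial_deriv :: "'n::finite \<Rightarrow> (real^'n \<Rightarrow> real) \<Rightarrow> real^'n \<Rightarrow> real" where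
  "partial_deriv i f x = frechet_derivative f (at x) (axis i 1)"

text \<open>Smoothness: every iterated partial derivative (the list gives the directions) is
  differentiable everywhere, and hence continuous.\<close>
definition smooth :: "(real^'n::finite \<Rightarrow> real) \<Rightarrow> bool" where
  "smooth f \<longleftrightarrow> (\<forall>dirs. (foldr partial_deriv dirs f) differentiable_on UNIV)"

definition laplacian :: "(real^'n::finite \<Rightarrow> real) \<Rightarrow> real^'n \<Rightarrow> real" where
  "laplacian f x = (\<Sum>i\<in>UNIV. partial_deriv i (partial_deriv i f) x)"

definition compactly_supported_in :: "'a::euclidean_space set \<Rightarrow> ('a \<Rightarrow> real) \<Rightarrow> bool" where
  "compactly_supported_in D f \<longleftrightarrow> compact (closure {x. f x \<noteq> 0}) \<and> closure {x. f x \<noteq> 0} \<subseteq> D"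

text \<open>\<open>u\<close> solves \<open>- \<Delta> u = f\<close> in \<open>D\<close> in the sense of distributions. The right-hand side is
  meant to be integrable on \<open>D\<close>.\<close>
definition distributional_solution ::
    "(real^'n::finite) set \<Rightarrow> (real^'n \<Rightarrow> real) \<Rightarrow> (real^'n \<Rightarrow> real) \<Rightarrow> bool" where
  "distributional_solution D u f \<longleftrightarrow> L1_loc D u \<and>
     (\<forall>\<phi>. smooth \<phi> \<and> compactly_supported_in D \<phi> \<longrightarrow>
        - (LINT x|lebesgue_on D. u x * laplacian \<phi> x) = (LINT x|lebesgue_on D. f x * \<phi> x))"

subsection \<open>The nonlocal nonlinearity\<close>

text \<open>The integral is real-valued, with value 0 at points where it diverges; on the diagonal the
  integrand is 0. For the functions considered below both happen only on null sets.\<close>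
definition riesz_potential :: "real \<Rightarrow> (real^2 \<Rightarrow> real) \<Rightarrow> real^2 \<Rightarrow> real" where
  "riesz_potential \<mu> f x = (LINT y|lebesgue. f y / norm (x - y) powr \<mu>)"

definition hartree_rhs ::
    "real \<Rightarrow> real \<Rightarrow> (real^2) set \<Rightarrow> (real^2 \<Rightarrow> real) \<Rightarrow> (real^2 \<Rightarrow> real) \<Rightarrow> real^2 \<Rightarrow> real" where
  "hartree_rhs \<mu> lam D V u x =
     V x * riesz_potential \<mu> (\<lambda>y. indicator D y * exp (lam * u y)) x * exp (lam * u x)"

subsection \<open>Convergence to a combination of Dirac masses\<close>

definition weak_star_converges ::
    "'a::euclidean_space set \<Rightarrow> (nat \<Rightarrow> 'a \<Rightarrow> real) \<Rightarrow> 'a measure \<Rightarrow> bool" where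
  "weak_star_converges D f \<eta> \<longleftrightarrow>
     (\<forall>\<psi>. continuous_on UNIV \<psi> \<and> compactly_supported_in D \<psi> \<longrightarrow>
        (\<lambda>l. LINT x|lebesgue_on D. f l x * \<psi> x) \<longlonglongrightarrow> (LINT x:D|\<eta>. \<psi> x))"

text \<open>The measure \<open>\<Sum>a\<in>S. \<alpha> a \<cdot> \<delta>\<^sub>a\<close> for finite \<open>S\<close> and nonnegative weights;
  \<^term>\<open>return borel a\<close> is the Dirac mass at \<open>a\<close>.\<close>
definition dirac_sum :: "'a::euclidean_space set \<Rightarrow> ('a \<Rightarrow> real) \<Rightarrow> 'a measure" where
  "dirac_sum S \<alpha> =
     measure_of UNIV (sets borel) (\<lambda>A. \<Sum>a\<in>S. ennreal (\<alpha> a) * emeasure (return borel a) A)"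

end

(* Testing the equation with smooth regularisations of the truncated logarithmic kernel writes a
   solution as a local mean plus the logarithmic potential of the right-hand side f. A
   Hardy-Littlewood-Sobolev bound makes the mass of f uniformly bounded. Put
   beta = 1 - 1/(2 lam p), so that the L^q hypothesis bounds the integral of exp (u / beta). Where f
   has mass below 4 pi beta, Jensen's inequality applied to the potential gives a power of
   exp (u / beta) better than 1, and a bootstrap then bounds u from above near that point; hence every
   blow-up point carries mass at least 4 pi beta, and a subsequence whose blow-up set is maximal has
   only finitely many blow-up points.

   Away from the blow-up set S the mean value formula gives a Harnack inequality, so along a
   subsequence u either stays locally bounded there or tends to minus infinity locally uniformly. If S is
   nonempty the bounded case is impossible: the mass at a blow-up point a forces
   u >= 2 beta ln (1 / |x - a|) - C in the limit, so exp (u / beta) would dominate a multiple of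
   |x - a|^(-2), which is not integrable. When u tends to minus infinity off S, f vanishes there in
   the limit and only Dirac masses at S remain. *)

theory Submission
  imports Defs "HOL-Real_Asymp.Real_Asymp"
begin

section \<open>A smooth cutoff profile\<close>

text \<open>No limit function is ever extracted: each estimate is stated for the whole class of
  solutions with common bounds, so its constants do not depend on k, and even the exclusion of the
  bounded case is carried out for a single solution, on an annulus of finite width. The number 4 pi
  beta is where two thresholds meet. The kernel is ln (1/|z|) / (2 pi) near 0. A mass m below 4 pi /
  sigma keeps |z|^(-sigma m / (2 pi)) integrable, and sigma > 1 / beta is possible exactly when m <
  4 pi beta. Conversely a mass m makes exp (u / beta) at least of the order |z|^(-m / (2 pi beta)),
  which reaches the forbidden power -2 at m = 4 pi beta. The bootstrap has to overcome criticality: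
  the exponents a0 + b, b and mu / 2 of the Hardy-Littlewood-Sobolev bound add up to exactly 2, and
  no power is left for the logarithmic kernel. Better exponential integrability lowers b, and the
  gap pays for the kernel. Outside omega only an integral of exp (u / beta) is controlled, hence
  interactions beyond a fixed distance are split off as a constant.\<close>

definition flat_bump :: "real poly \<Rightarrow> real \<Rightarrow> real" where
  "flat_bump P s = (if s < 1 then poly P (1 / (1 - s)) * exp (- 2 / (1 - s)) else 0)"

text \<open>With t = 1 / (1 - s) one has dt/ds = t^2, so differentiating P(t) exp (-2 t) replaces P
  by t^2 (P' - 2 P). The family is closed under differentiation, and smoothness across s = 1 reduces
  to a single limit.\<close>

definition flat_bump_deriv :: "real poly \<Rightarrow> real poly" where
  "flat_bump_deriv P = [:0, 0, 1:] * (pderiv P - smult 2 P)"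

lemma tendsto_poly_times_exp:
  fixes P :: "real poly"
  shows "((\<lambda>t. poly P t * exp (- 2 * t)) \<longlongrightarrow> 0) at_top"
proof -
  have "((\<lambda>t::real. \<Sum>i\<le>degree P. coeff P i * (t ^ i / exp t) * exp (- t)) \<longlongrightarrow> (\<Sum>i\<le>degree P. coeff P i * 0 * 0)) at_top"
    by (intro tendsto_intros tendsto_power_div_exp_0 filterlim_compose[OF exp_at_bot] filterlim_uminus_at_bot_at_top)
  moreover have "(\<Sum>i\<le>degree P. coeff P i * (t ^ i / exp t) * exp (- t)) = poly P t * exp (- 2 * t)" for t
  proof -
    have "exp (- 2 * t) = exp (-t) * exp (-t)" by (simp flip: exp_add)
    then show ?thesis
      by (auto simp: poly_altdef sum_distrib_right divide_inverse simp flip: exp_minus intro!: sum.cong)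
  qed
  ultimately show ?thesis by simp
qed

lemma flat_bump_has_deriv:
  "(flat_bump P has_real_derivative flat_bump (flat_bump_deriv P) s) (at s)"
proof -
  consider "s < 1" | "s > 1" | "s = 1" by linarith
  then show ?thesis
  proof cases
    case 1
    define t where "t = 1 / (1 - s)"
    have inner: "((\<lambda>s. 1 / (1 - s)) has_real_derivative t * t) (at s)"
      using 1 by (auto intro!: derivative_eq_intros simp: t_def)
    have "((\<lambda>s. poly P (1 / (1 - s)) * exp (- 2 * (1 / (1 - s)))) has_real_derivative
        poly (pderiv P) t * (t * t) * exp (- 2 * t) + exp (- 2 * t) * (- 2 * (t * t)) * poly P t) (at s)"
      unfolding t_def by (intro DERIV_mult DERIV_chain2[OF poly_DERIV] DERIV_chain2[OF DERIV_exp] DERIV_cmult inner [unfolded t_def])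
    moreover have "poly (pderiv P) t * (t * t) * exp (- 2 * t) + exp (- 2 * t) * (- 2 * (t * t)) * poly P t
        = flat_bump (flat_bump_deriv P) s"
      using 1 by (simp add: flat_bump_def flat_bump_deriv_def t_def [symmetric] algebra_simps) (simp add: t_def)
    ultimately have "((\<lambda>s. poly P (1 / (1 - s)) * exp (- 2 / (1 - s))) has_real_derivative flat_bump (flat_bump_deriv P) s) (at s)"
      by simp
    then show ?thesis
      by (rule has_field_derivative_transform_within_open[where S="{..<1}"]) (use 1 in \<open>auto simp: flat_bump_def\<close>)
  next
    case 2
    have "((\<lambda>s. 0) has_real_derivative flat_bump (flat_bump_deriv P) s) (at s)"
      using 2 by (simp add: flat_bump_def)
    then show ?thesis
      by (rule has_field_derivative_transform_within_open[where S="{1<..}"]) (use 2 in \<open>auto simp: flat_bump_def\<close>)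
  next
    case 3
    have inv: "filterlim (\<lambda>y::real. 1 / (1 - y)) at_top (at_left 1)"
    proof -
      have "filterlim (\<lambda>y::real. inverse (1 - y)) at_top (at_left 1)"
        by (rule filterlim_inverse_at_top) (auto intro!: tendsto_eq_intros simp: eventually_at_filter)
      then show ?thesis by (simp add: inverse_eq_divide)
    qed
    \<comment> \<open>Since 1 / (y - 1) = -t, the left difference quotient at 1 is again a
      polynomial in t times exp (-2 t).\<close>
    have "((\<lambda>y. poly ([:0, -1:] * P) (1 / (1 - y)) * exp (- 2 * (1 / (1 - y)))) \<longlongrightarrow> 0) (at_left 1)"
      by (rule filterlim_compose[OF tendsto_poly_times_exp inv])
    then have "((\<lambda>y. (flat_bump P y - flat_bump P 1) / (y - 1)) \<longlongrightarrow> 0) (at_left 1)"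
      by (rule Lim_transform_eventually)
        (auto simp: eventually_at_filter flat_bump_def divide_simps algebra_simps)
    moreover have "((\<lambda>y. (flat_bump P y - flat_bump P 1) / (y - 1)) \<longlongrightarrow> 0) (at_right 1)"
      by (rule tendsto_eventually) (auto simp: eventually_at_filter flat_bump_def)
    ultimately have "((\<lambda>y. (flat_bump P y - flat_bump P 1) / (y - 1)) \<longlongrightarrow> 0) (at 1)"
      by (simp add: filterlim_split_at)
    then show ?thesis
      using 3 by (simp add: has_field_derivative_iff flat_bump_def)
  qed
qed

lemma flat_bump_scaled_has_deriv:
  "((\<lambda>s. flat_bump P (s / c)) has_real_derivative flat_bump (flat_bump_deriv P) (s / c) * (1 / c)) (at s)"
  using DERIV_chain2[where f="flat_bump P" and g="\<lambda>s. s / c", OF flat_bump_has_deriv DERIV_cdivide[OF DERIV_ident]] .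

lemma continuous_on_flat_bump [continuous_intros]: "continuous_on A f \<Longrightarrow> continuous_on A (\<lambda>x. flat_bump P (f x))"
  by (rule continuous_on_compose2[of UNIV "flat_bump P"])
    (rule DERIV_continuous_on, rule has_field_derivative_at_within, rule flat_bump_has_deriv, auto)

section \<open>Signs and monotonicity of the bump and of its first two derivatives\<close>

abbreviation "bump0 \<equiv> flat_bump 1"
abbreviation "bump1 \<equiv> flat_bump (flat_bump_deriv 1)"
abbreviation "bump2 \<equiv> flat_bump (flat_bump_deriv (flat_bump_deriv 1))"

lemma bump0_eq: "s < 1 \<Longrightarrow> bump0 s = exp (- 2 / (1 - s))"
  and flat_bump_eq_0: "1 \<le> s \<Longrightarrow> flat_bump P s = 0"
  by (auto simp: flat_bump_def)

lemma bump0_nonneg: "0 \<le> bump0 s"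
  by (simp add: flat_bump_def)

lemma bump0_pos: "s < 1 \<Longrightarrow> 0 < bump0 s"
  by (simp add: flat_bump_def)

lemma bump1_eq: "s < 1 \<Longrightarrow> bump1 s = - 2 * (1 / (1 - s))\<^sup>2 * exp (- 2 / (1 - s))"
  by (simp add: flat_bump_def flat_bump_deriv_def power2_eq_square)

lemma bump1_nonpos: "bump1 s \<le> 0"
  by (cases "s < 1") (auto simp: bump1_eq flat_bump_eq_0)

text \<open>From exp (2 t) >= 1 + 2 t + 2 t^2. It makes s + \<open>bump0 s\<close> strictly
  increasing, so that adding the bump to s destroys neither monotonicity nor positivity.\<close>

lemma bump1_gt: "- 1 < bump1 s"
proof (cases "s < 1")
  case True
  define t where "t = 1 / (1 - s)"
  have t: "0 < t" using True by (simp add: t_def)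
  have "2 * t\<^sup>2 < exp (2 * t)"
    using exp_lower_Taylor_quadratic[of "2*t"] t by (simp add: power2_eq_square)
  then have "2 * t\<^sup>2 * exp (- (2 * t)) < 1"
    by (simp add: exp_minus field_simps)
  then show ?thesis using True by (simp add: bump1_eq t_def)
qed (simp add: flat_bump_eq_0)

text \<open>Here the constant 2 in exp (-2 / (1 - s)) matters: with c in its place the second
  derivative carries the factor c t - 2, which is nonnegative for all t >= 1 only if c >= 2. The
  sign is needed for the mollifier to be nonnegative.\<close>

lemma bump2_nonneg: "0 \<le> s \<Longrightarrow> 0 \<le> bump2 s"
proof (cases "s < 1")
  case True
  assume "0 \<le> s"
  then have t: "1 \<le> 1 / (1 - s)" using True by simp
  define t where "t = 1 / (1 - s)"
  have "bump2 s = 4 * t^3 * (t - 1) * exp (- 2 * t)"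
    using True by (simp add: flat_bump_def flat_bump_deriv_def pderiv_pCons t_def [symmetric] algebra_simps power3_eq_cube
       power2_eq_square one_pCons) (simp add: t_def)
  moreover have "0 \<le> 4 * t^3 * (t - 1) * exp (- 2 * t)"
    using t by (simp add: t_def [symmetric])
  ultimately show ?thesis by simp
qed (simp add: flat_bump_eq_0)

lemma bump0_decreasing: "x \<le> y \<Longrightarrow> bump0 y \<le> bump0 x"
  by (rule DERIV_nonpos_imp_nonincreasing[where f=bump0]) (auto intro: flat_bump_has_deriv bump1_nonpos)

lemma bump0_le_1: "0 \<le> s \<Longrightarrow> bump0 s \<le> 1"
  by (cases "s < 1") (auto simp: bump0_eq flat_bump_eq_0)

lemma id_plus_bump0_increasing:
  assumes "x \<le> y"
  shows "x + bump0 x \<le> y + bump0 y"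
proof (rule DERIV_nonneg_imp_nondecreasing[OF assms, where f="\<lambda>x. x + bump0 x"])
  fix z
  have "((\<lambda>x. x + bump0 x) has_real_derivative 1 + bump1 z) (at z)"
    by (intro DERIV_add DERIV_ident flat_bump_has_deriv)
  moreover have "0 \<le> 1 + bump1 z"
    using bump1_gt[of z] by simp
  ultimately show "\<exists>d. ((\<lambda>x. x + bump0 x) has_real_derivative d) (at z) \<and> 0 \<le> d"
    by blast
qed

lemma id_plus_bump0_ge: "0 \<le> s \<Longrightarrow> exp (- 2) \<le> s + bump0 s"
  using id_plus_bump0_increasing[of 0 s] by (simp add: bump0_eq)

section \<open>Regularised logarithm\<close>

text \<open>A smooth positive substitute for s = |z|^2. It equals s from r^2 on and stays above r^2
  exp (-2), so ln (reg_sq r |z|^2) is ln |z|^2 with the singularity smoothed away inside the disc of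
  radius r.\<close>

definition reg_sq :: "real \<Rightarrow> real \<Rightarrow> real" where
  "reg_sq r s = s + r\<^sup>2 * bump0 (s / r\<^sup>2)"

lemma reg_sq_scale: "r \<noteq> 0 \<Longrightarrow> reg_sq r s = r\<^sup>2 * (s / r\<^sup>2 + bump0 (s / r\<^sup>2))"
  by (simp add: reg_sq_def field_simps)

lemma reg_sq_ge: "0 \<le> s \<Longrightarrow> 0 < r \<Longrightarrow> r\<^sup>2 * exp (- 2) \<le> reg_sq r s"
  unfolding reg_sq_scale[of r, OF less_imp_neq[THEN not_sym]]
  by (intro mult_left_mono id_plus_bump0_ge) auto

lemma reg_sq_pos: "0 \<le> s \<Longrightarrow> 0 < r \<Longrightarrow> 0 < reg_sq r s"
  using reg_sq_ge[of s r] by (smt (verit) exp_gt_zero mult_pos_pos zero_less_power)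

lemma reg_sq_ge_id: "s \<le> reg_sq r s"
  by (simp add: reg_sq_def bump0_nonneg)

lemma reg_sq_eq: "r\<^sup>2 \<le> s \<Longrightarrow> 0 < r \<Longrightarrow> reg_sq r s = s"
  by (simp add: reg_sq_def flat_bump_eq_0)

lemma reg_sq_le: "0 \<le> s \<Longrightarrow> 0 < r \<Longrightarrow> reg_sq r s \<le> s + r\<^sup>2"
  unfolding reg_sq_def using bump0_le_1[of "s / r\<^sup>2"] by (simp add: mult_left_le)

lemma reg_sq_mono:
  assumes "0 < r" "r \<le> r'" "0 \<le> s"
  shows "reg_sq r s \<le> reg_sq r' s"
proof -
  have "r\<^sup>2 \<le> r'\<^sup>2" using assms by (simp add: power_mono)
  moreover from this have "s / r'\<^sup>2 \<le> s / r\<^sup>2"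
    using assms by (intro divide_left_mono) (auto simp: mult_pos_pos)
  ultimately show ?thesis
    unfolding reg_sq_def by (intro add_left_mono mult_mono bump0_decreasing) (auto simp: bump0_nonneg)
qed

lemma reg_sq_has_deriv:
  assumes "r \<noteq> 0"
  shows "(reg_sq r has_real_derivative 1 + bump1 (s / r\<^sup>2)) (at s)"
proof -
  have "((\<lambda>s. s + r\<^sup>2 * bump0 (s / r\<^sup>2)) has_real_derivative 1 + r\<^sup>2 * (bump1 (s / r\<^sup>2) * (1 / r\<^sup>2))) (at s)"
    by (intro DERIV_add DERIV_ident DERIV_cmult flat_bump_scaled_has_deriv)
  moreover have "reg_sq r = (\<lambda>s. s + r\<^sup>2 * bump0 (s / r\<^sup>2))" by (auto simp: reg_sq_def)
  ultimately show ?thesis using assms by simp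
qed

section \<open>Smoothness and Laplacian of radial functions\<close>

lemma has_derivative_radial:
  fixes x c :: "real^'n::finite"
  assumes "(F has_real_derivative F') (at ((norm (x - c))\<^sup>2))"
  shows "((\<lambda>x. F ((norm (x - c))\<^sup>2)) has_derivative (\<lambda>h. \<Sum>i\<in>UNIV. h$i * (2 * (x$i - c$i) * F'))) (at x)"
proof -
  have 1: "((\<lambda>x. (norm (x - c))\<^sup>2) has_derivative (\<lambda>h. 2 * ((x - c) \<bullet> h))) (at x)"
    unfolding power2_norm_eq_inner
    by (auto intro!: derivative_eq_intros simp: inner_commute)
  have 2: "(F has_derivative (*) F') (at ((norm (x - c))\<^sup>2))"
    using assms by (simp add: has_field_derivative_def)
  have "((\<lambda>x. F ((norm (x - c))\<^sup>2)) has_derivative (\<lambda>h. F' * (2 * ((x - c) \<bullet> h)))) (at x)"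
    using has_derivative_compose[OF 1 2] .
  moreover have "F' * (2 * ((x - c) \<bullet> h)) = (\<Sum>i\<in>UNIV. h$i * (2 * (x$i - c$i) * F'))" for h
    by (simp add: inner_vec_def sum_distrib_left algebra_simps)
  ultimately show ?thesis by simp
qed

lemma partial_deriv_eq:
  fixes x :: "real^'n::finite"
  assumes "(f has_derivative (\<lambda>h. \<Sum>i\<in>UNIV. h$i * g i)) (at x)"
  shows "partial_deriv j f x = g j"
proof -
  have "(\<Sum>i\<in>UNIV. (axis j 1 :: real^'n) $ i * g i) = g j"
    by (simp add: axis_def if_distrib[of "\<lambda>x. x * _"] cong: if_cong)
  then show ?thesis
    using frechet_derivative_at[OF assms] unfolding partial_deriv_def by metis
qed

text \<open>In dimension n the chain rule gives 2 n F' + 4 s F''. For n = 2 this is 4 (s F')', an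
  exact derivative in s, which later yields the mass of the mollifier.\<close>

lemma laplacian_radial:
  fixes c :: "real^2"
  assumes F: "\<And>s. 0 \<le> s \<Longrightarrow> (F has_real_derivative F' s) (at s)"
    and F': "\<And>s. 0 \<le> s \<Longrightarrow> (F' has_real_derivative F'' s) (at s)"
  shows "laplacian (\<lambda>x. F ((norm (x - c))\<^sup>2)) x
    = 4 * (F' ((norm (x - c))\<^sup>2) + (norm (x - c))\<^sup>2 * F'' ((norm (x - c))\<^sup>2))"
proof -
  define s where "s = (norm (x - c))\<^sup>2"
  have 1: "partial_deriv i (\<lambda>x. F ((norm (x - c))\<^sup>2)) = (\<lambda>x. 2 * (x$i - c$i) * F' ((norm (x - c))\<^sup>2))" for i
    by (intro ext partial_deriv_eq has_derivative_radial F) simp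
  have 2: "partial_deriv i (\<lambda>x. 2 * (x$i - c$i) * F' ((norm (x - c))\<^sup>2)) x
      = 2 * F' s + 4 * (x$i - c$i)\<^sup>2 * F'' s" for i
  proof -
    have 3: "((\<lambda>x. 2 * (x$i - c$i)) has_derivative (\<lambda>h. 2 * (h$i))) (at x)"
      by (auto intro!: derivative_eq_intros bounded_linear.has_derivative[OF bounded_linear_vec_nth])
    have "((\<lambda>x. 2 * (x$i - c$i) * F' ((norm (x - c))\<^sup>2)) has_derivative
       (\<lambda>h. 2 * (x$i - c$i) * (\<Sum>j\<in>UNIV. h$j * (2 * (x$j - c$j) * F'' s)) + 2 * (h$i) * F' s)) (at x)"
      unfolding s_def by (rule has_derivative_mult 3 has_derivative_radial F')+ simp
    moreover have "2 * (x$i - c$i) * (\<Sum>j\<in>UNIV. h$j * (2 * (x$j - c$j) * F'' s)) + 2 * (h$i) * F' s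
      = (\<Sum>j\<in>UNIV. h$j * (4 * (x$i - c$i) * (x$j - c$j) * F'' s + (if j = i then 2 * F' s else 0)))" for h :: "real^2"
    proof -
      have "h$j * (4 * (x$i - c$i) * (x$j - c$j) * F'' s + (if j = i then 2 * F' s else 0))
         = 2 * (x$i - c$i) * (h$j * (2 * (x$j - c$j) * F'' s)) + (if j = i then 2 * (h$j) * F' s else 0)" for j
        by (auto simp: algebra_simps)
      then show ?thesis by (simp add: sum.distrib sum_distrib_left)
    qed
    ultimately have "((\<lambda>x. 2 * (x$i - c$i) * F' ((norm (x - c))\<^sup>2)) has_derivative
       (\<lambda>h. \<Sum>j\<in>UNIV. h$j * (4 * (x$i - c$i) * (x$j - c$j) * F'' s + (if j = i then 2 * F' s else 0)))) (at x)"
      by simp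
    from partial_deriv_eq[OF this, of i] show ?thesis
      by (simp add: power2_eq_square)
  qed
  have "s = (\<Sum>i\<in>UNIV. (x$i - c$i)\<^sup>2)"
    unfolding s_def power2_norm_eq_inner by (simp add: inner_vec_def power2_eq_square)
  then show ?thesis
    unfolding laplacian_def 1 2 s_def [symmetric]
    by (simp add: sum.distrib sum_distrib_left sum_distrib_right algebra_simps)
qed

text \<open>Smoothness is obtained algebraically: this set is closed under partial derivatives, so
  every iterated partial derivative of a member is a member and hence differentiable. The
  reciprocals and all the bumps are included because differentiating \<open>ln\<close> produces
  them.\<close>

inductive_set radial_algebra :: "real^'n::finite \<Rightarrow> (real^'n \<Rightarrow> real) set" for c where
  const: "(\<lambda>x. k) \<in> radial_algebra c"
| coord: "(\<lambda>x. x $ i) \<in> radial_algebra c"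
| add: "f \<in> radial_algebra c \<Longrightarrow> g \<in> radial_algebra c \<Longrightarrow> (\<lambda>x. f x + g x) \<in> radial_algebra c"
| mult: "f \<in> radial_algebra c \<Longrightarrow> g \<in> radial_algebra c \<Longrightarrow> (\<lambda>x. f x * g x) \<in> radial_algebra c"
| bump: "0 < r \<Longrightarrow> (\<lambda>x. flat_bump P ((norm (x - c))\<^sup>2 / r\<^sup>2)) \<in> radial_algebra c"
| inv: "0 < r \<Longrightarrow> (\<lambda>x. 1 / reg_sq r ((norm (x - c))\<^sup>2)) \<in> radial_algebra c"
| ln: "0 < r \<Longrightarrow> (\<lambda>x. ln (reg_sq r ((norm (x - c))\<^sup>2))) \<in> radial_algebra c"

lemma radial_algebra_radial:
  assumes F: "\<And>s. 0 \<le> s \<Longrightarrow> (F has_real_derivative F' s) (at s)"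
    and "(\<lambda>x. F' ((norm (x - c))\<^sup>2)) \<in> radial_algebra c"
  shows "\<exists>g. (\<forall>i. g i \<in> radial_algebra c) \<and>
    (\<forall>x. ((\<lambda>x. F ((norm (x - c))\<^sup>2)) has_derivative (\<lambda>h. \<Sum>i\<in>UNIV. h$i * g i x)) (at x))"
proof (intro exI conjI allI)
  show "(\<lambda>x. 2 * (x$i + - c$i) * F' ((norm (x - c))\<^sup>2)) \<in> radial_algebra c" for i
    by (intro radial_algebra.mult radial_algebra.add radial_algebra.const radial_algebra.coord assms)
  show "((\<lambda>x. F ((norm (x - c))\<^sup>2)) has_derivative (\<lambda>h. \<Sum>i\<in>UNIV. h$i * (2 * (x$i + - c$i) * F' ((norm (x - c))\<^sup>2)))) (at x)" for x
    using has_derivative_radial[of F "F' ((norm (x - c))\<^sup>2)" x c] F by simp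
qed

lemma radial_algebra_has_derivative:
  assumes "f \<in> radial_algebra c"
  shows "\<exists>g. (\<forall>i. g i \<in> radial_algebra c) \<and> (\<forall>x. (f has_derivative (\<lambda>h. \<Sum>i\<in>UNIV. h$i * g i x)) (at x))"
  using assms
proof induction
  case (const k)
  show ?case by (rule exI[of _ "\<lambda>i x. 0"]) (auto intro: radial_algebra.const)
next
  case (coord i)
  have "((\<lambda>x. x $ i) has_derivative (\<lambda>h. \<Sum>j\<in>UNIV. h$j * (if j = i then 1 else 0))) (at x)" for x :: "real^'a"
  proof -
    have "(\<Sum>j\<in>UNIV. h$j * (if j = i then 1 else 0)) = h $ i" for h :: "real^'a"
      by (simp add: if_distrib[of "\<lambda>x. _ * x"] cong: if_cong)
    then show ?thesis
      by (simp add: bounded_linear_imp_has_derivative bounded_linear_vec_nth)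
  qed
  then show ?case
    by (intro exI[of _ "\<lambda>j x. if j = i then 1 else 0"] conjI allI radial_algebra.const)
next
  case (add f g)
  then obtain f' g' where *: "\<forall>i. f' i \<in> radial_algebra c" "\<forall>i. g' i \<in> radial_algebra c"
    "\<And>x. (f has_derivative (\<lambda>h. \<Sum>i\<in>UNIV. h$i * f' i x)) (at x)"
    "\<And>x. (g has_derivative (\<lambda>h. \<Sum>i\<in>UNIV. h$i * g' i x)) (at x)" by blast
  have "((\<lambda>x. f x + g x) has_derivative (\<lambda>h. \<Sum>i\<in>UNIV. h$i * (f' i x + g' i x))) (at x)" for x
    using has_derivative_add[OF *(3,4)[of x]] by (simp add: sum.distrib algebra_simps)
  with * show ?case
    by (intro exI[of _ "\<lambda>i x. f' i x + g' i x"]) (auto intro: radial_algebra.add)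
next
  case (mult f g)
  then obtain f' g' where *: "\<forall>i. f' i \<in> radial_algebra c" "\<forall>i. g' i \<in> radial_algebra c"
    "\<And>x. (f has_derivative (\<lambda>h. \<Sum>i\<in>UNIV. h$i * f' i x)) (at x)"
    "\<And>x. (g has_derivative (\<lambda>h. \<Sum>i\<in>UNIV. h$i * g' i x)) (at x)" by blast
  have "((\<lambda>x. f x * g x) has_derivative (\<lambda>h. \<Sum>i\<in>UNIV. h$i * (f x * g' i x + f' i x * g x))) (at x)" for x
    using has_derivative_mult[OF *(3,4)[of x]]
    by (simp add: sum.distrib algebra_simps sum_distrib_left)
  moreover have "(\<lambda>x. f x * g' i x + f' i x * g x) \<in> radial_algebra c" for i
    by (intro radial_algebra.add radial_algebra.mult) (use * mult.hyps in auto)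
  ultimately show ?case
    by (intro exI[of _ "\<lambda>i x. f x * g' i x + f' i x * g x"]) auto
next
  case (bump r P)
  show ?case
  proof (rule radial_algebra_radial)
    show "((\<lambda>s. flat_bump P (s / r\<^sup>2)) has_real_derivative flat_bump (flat_bump_deriv P) (s / r\<^sup>2) * (1 / r\<^sup>2)) (at s)" for s
      by (rule flat_bump_scaled_has_deriv)
    show "(\<lambda>x. flat_bump (flat_bump_deriv P) ((norm (x - c))\<^sup>2 / r\<^sup>2) * (1 / r\<^sup>2)) \<in> radial_algebra c"
      using bump by (intro radial_algebra.mult radial_algebra.bump radial_algebra.const)
  qed
next
  case (inv r)
  show ?case
  proof (rule radial_algebra_radial)
    show "((\<lambda>s. 1 / reg_sq r s) has_real_derivative
        (1 + bump1 (s / r\<^sup>2)) * ((- 1) * ((1 / reg_sq r s) * (1 / reg_sq r s)))) (at s)" if "0 \<le> s" for s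
      using inv reg_sq_pos[OF that inv]
      by (auto intro!: derivative_eq_intros reg_sq_has_deriv simp: field_simps)
    show "(\<lambda>x. (1 + bump1 ((norm (x - c))\<^sup>2 / r\<^sup>2)) * ((- 1) * ((1 / reg_sq r ((norm (x - c))\<^sup>2)) * (1 / reg_sq r ((norm (x - c))\<^sup>2))))) \<in> radial_algebra c"
      using inv by (intro radial_algebra.mult radial_algebra.add radial_algebra.bump radial_algebra.const radial_algebra.inv)
  qed
next
  case (ln r)
  show ?case
  proof (rule radial_algebra_radial)
    show "((\<lambda>s. ln (reg_sq r s)) has_real_derivative
        (1 + bump1 (s / r\<^sup>2)) * (1 / reg_sq r s)) (at s)" if "0 \<le> s" for s
      using ln reg_sq_pos[OF that ln]
      by (auto intro!: derivative_eq_intros reg_sq_has_deriv simp: field_simps)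
    show "(\<lambda>x. (1 + bump1 ((norm (x - c))\<^sup>2 / r\<^sup>2)) * (1 / reg_sq r ((norm (x - c))\<^sup>2))) \<in> radial_algebra c"
      using ln by (intro radial_algebra.mult radial_algebra.add radial_algebra.bump radial_algebra.const radial_algebra.inv)
  qed
qed

lemma radial_algebra_smooth:
  assumes "f \<in> radial_algebra c"
  shows "smooth f"
proof -
  have pd: "partial_deriv i g \<in> radial_algebra c" if "g \<in> radial_algebra c" for g i
  proof -
    obtain g' where g': "\<forall>i. g' i \<in> radial_algebra c" "\<And>x. (g has_derivative (\<lambda>h. \<Sum>i\<in>UNIV. h$i * g' i x)) (at x)"
      using radial_algebra_has_derivative[OF \<open>g \<in> _\<close>] by blast
    have "partial_deriv i g = g' i" by (intro ext partial_deriv_eq g')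
    with g' show ?thesis by simp
  qed
  have "foldr partial_deriv dirs f \<in> radial_algebra c" for dirs
    by (induction dirs) (auto intro: pd assms)
  then show ?thesis
    unfolding smooth_def differentiable_on_def
    using radial_algebra_has_derivative differentiableI differentiable_at_withinI by blast
qed

section \<open>The mollifier, the test functions and the logarithmic kernel\<close>

text \<open>Up to the factor 4 / r^2 this is the Laplacian of ln (reg_sq r |z|^2), in the variable s
  = |z|^2 / r^2. The numerator is arranged so that for s >= 0 both summands are visibly
  nonnegative.\<close>

definition mollifier_profile :: "real \<Rightarrow> real" where
  "mollifier_profile s =
    ((1 + bump1 s) * (bump0 s - s * bump1 s) + s * bump2 s * (s + bump0 s)) / (s + bump0 s)\<^sup>2"

definition mollifier :: "real \<Rightarrow> real^2 \<Rightarrow> real" where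
  "mollifier r z = mollifier_profile ((norm z)\<^sup>2 / r\<^sup>2) / (pi * r\<^sup>2)"

text \<open>As ln |z|^2 / (4 pi) is the fundamental solution of the Laplacian in the plane, this is
  a difference of two smoothed fundamental solutions. They agree outside the larger disc, so the
  difference has compact support, and its Laplacian is a difference of two averaging
  kernels.\<close>

definition test_fun :: "real \<Rightarrow> real \<Rightarrow> real^2 \<Rightarrow> real" where
  "test_fun e r z = (ln (reg_sq r ((norm z)\<^sup>2)) - ln (reg_sq e ((norm z)\<^sup>2))) / (4 * pi)"

text \<open>The limit of \<open>test_fun e r\<close> as e tends to 0. The value at 0 is a convention
  on a null set; it is the reason why the pointwise identities below ask for z different from
  0.\<close>

definition log_kernel :: "real \<Rightarrow> real^2 \<Rightarrow> real" where
  "log_kernel r z = (if z = 0 then 0 else (ln (reg_sq r ((norm z)\<^sup>2)) - ln ((norm z)\<^sup>2)) / (4 * pi))"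

lemma smooth_test_fun:
  assumes "0 < e" "0 < r"
  shows "smooth (\<lambda>x. test_fun e r (x - c))"
proof -
  have "(\<lambda>x. (1 / (4 * pi)) * (ln (reg_sq r ((norm (x - c))\<^sup>2)) + (- 1) * ln (reg_sq e ((norm (x - c))\<^sup>2)))) \<in> radial_algebra c"
    using assms by (intro radial_algebra.intros)
  then show ?thesis
    using radial_algebra_smooth by (simp add: test_fun_def [abs_def])
qed

lemma laplacian_test_fun:
  assumes "0 < e" "0 < r"
  shows "laplacian (\<lambda>x. test_fun e r (x - c)) x = mollifier r (x - c) - mollifier e (x - c)"
proof -
  define L1 where "L1 r s = (1 + bump1 (s / r\<^sup>2)) / reg_sq r s" for r s
  define L2 where "L2 r s = (bump2 (s / r\<^sup>2) / r\<^sup>2 * reg_sq r s - (1 + bump1 (s / r\<^sup>2))\<^sup>2) / (reg_sq r s)\<^sup>2" for r s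
  have 1: "((\<lambda>s. ln (reg_sq r s)) has_real_derivative L1 r s) (at s)" if "0 \<le> s" "0 < r" for r s
    unfolding L1_def using that reg_sq_pos[OF that]
    by (auto intro!: derivative_eq_intros reg_sq_has_deriv)
  have 2: "(L1 r has_real_derivative L2 r s) (at s)" if "0 \<le> s" "0 < r" for r s
  proof -
    have "((\<lambda>s. 1 + bump1 (s / r\<^sup>2)) has_real_derivative 0 + bump2 (s / r\<^sup>2) * (1 / r\<^sup>2)) (at s)"
      by (intro DERIV_add DERIV_const flat_bump_scaled_has_deriv)
    from DERIV_divide[OF this reg_sq_has_deriv] show ?thesis
      unfolding L1_def [abs_def] L2_def using that reg_sq_pos[OF that]
      by (simp add: power2_eq_square)
  qed
  \<comment> \<open>L1 + s L2 is a quarter of the Laplacian of ln (reg_sq r |z|^2); after rescaling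
    s by r^2 only the profile and one factor r^2 remain.\<close>
  have 3: "L1 r s + s * L2 r s = mollifier_profile (s / r\<^sup>2) / r\<^sup>2" if "0 \<le> s" "0 < r" for r s
  proof -
    define t where "t = s / r\<^sup>2"
    define q where "q = t + bump0 t"
    have q: "reg_sq r s = r\<^sup>2 * q" and s: "s = r\<^sup>2 * t" using that by (auto simp: reg_sq_scale q_def t_def)
    have "q > 0" using reg_sq_pos[OF that] that by (simp add: q zero_less_mult_iff)
    have b: "bump0 t = q - t" by (simp add: q_def)
    have "(1 + bump1 t) / (r\<^sup>2 * q) = ((1 + bump1 t) * q) / (q\<^sup>2 * r\<^sup>2)"
      using \<open>0 < q\<close> by (simp add: power2_eq_square)
    moreover have "r\<^sup>2 * t * (X / (r\<^sup>2 * q)\<^sup>2) = (t * X) / (q\<^sup>2 * r\<^sup>2)" for X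
      using that by (simp add: power2_eq_square)
    moreover have "(1 + bump1 t) * q + t * (bump2 t * q - (1 + bump1 t)\<^sup>2)
        = (1 + bump1 t) * (bump0 t - t * bump1 t) + t * bump2 t * q"
      by (simp add: b algebra_simps power2_eq_square)
    ultimately show ?thesis
      unfolding L1_def L2_def mollifier_profile_def t_def [symmetric] q q_def [symmetric]
      using that by (subst s) (simp add: add_divide_distrib [symmetric])
  qed
  have "laplacian (\<lambda>x. test_fun e r (x - c)) x = 4 * ((L1 r ((norm (x - c))\<^sup>2) - L1 e ((norm (x - c))\<^sup>2)) / (4 * pi)
     + (norm (x - c))\<^sup>2 * ((L2 r ((norm (x - c))\<^sup>2) - L2 e ((norm (x - c))\<^sup>2)) / (4 * pi)))"
    unfolding test_fun_def
    by (rule laplacian_radial[where F="\<lambda>s. (ln (reg_sq r s) - ln (reg_sq e s)) / (4 * pi)"])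
      (auto intro!: DERIV_cdivide DERIV_diff 1 2 assms)
  also have "\<dots> = (L1 r ((norm (x - c))\<^sup>2) + (norm (x - c))\<^sup>2 * L2 r ((norm (x - c))\<^sup>2)
      - (L1 e ((norm (x - c))\<^sup>2) + (norm (x - c))\<^sup>2 * L2 e ((norm (x - c))\<^sup>2))) / pi"
    by (simp add: field_simps)
  also have "\<dots> = mollifier r (x - c) - mollifier e (x - c)"
    using assms by (simp add: 3 mollifier_def diff_divide_distrib mult.commute)
  finally show ?thesis .
qed

lemma test_fun_eq_0:
  assumes "0 < e" "e \<le> r" "r \<le> norm z"
  shows "test_fun e r z = 0"
proof -
  have "r\<^sup>2 \<le> (norm z)\<^sup>2" "e\<^sup>2 \<le> (norm z)\<^sup>2" using assms by (auto intro!: power_mono)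
  then show ?thesis using assms by (simp add: test_fun_def reg_sq_eq)
qed

lemma test_fun_nonneg: "0 < e \<Longrightarrow> e \<le> r \<Longrightarrow> 0 \<le> test_fun e r z"
  by (simp add: test_fun_def reg_sq_mono reg_sq_pos)

lemma compactly_supported_test_fun:
  assumes "0 < e" "e \<le> r" "cball c r \<subseteq> D"
  shows "compactly_supported_in D (\<lambda>x. test_fun e r (x - c))"
proof -
  have "{x. test_fun e r (x - c) \<noteq> 0} \<subseteq> cball c r"
    using test_fun_eq_0[OF assms(1,2)] by (force simp: dist_norm norm_minus_commute)
  then have "closure {x. test_fun e r (x - c) \<noteq> 0} \<subseteq> cball c r"
    by (simp add: closure_minimal)
  then show ?thesis
    using assms unfolding compactly_supported_in_def
    by (meson bounded_cball bounded_subset closed_closure compact_eq_bounded_closed subset_trans)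
qed

section \<open>Sign and size of the logarithmic kernel\<close>

lemma log_kernel_eq_0: "0 < r \<Longrightarrow> r \<le> norm z \<Longrightarrow> log_kernel r z = 0"
  using power_mono[of r "norm z" 2] by (simp add: log_kernel_def reg_sq_eq)

lemma log_kernel_nonneg: "0 < r \<Longrightarrow> 0 \<le> log_kernel r z"
  by (simp add: log_kernel_def reg_sq_pos reg_sq_ge_id)

lemma log_kernel_split:
  "z \<noteq> 0 \<Longrightarrow> log_kernel r z = log_kernel e z + test_fun e r z"
  by (simp add: log_kernel_def test_fun_def diff_divide_distrib)

lemma log_kernel_mono: "0 < e \<Longrightarrow> e \<le> r \<Longrightarrow> log_kernel e z \<le> log_kernel r z"
  using log_kernel_split[of z r e] test_fun_nonneg[of e r z] by (cases "z = 0") (auto simp: log_kernel_def)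

text \<open>The factor e inside the logarithm is the price of the floor \<open>reg_sq\<close> >= r^2
  exp (-2).\<close>

lemma log_kernel_ge:
  assumes "0 < r" "z \<noteq> 0"
  shows "ln (r / (exp 1 * norm z)) / (2 * pi) \<le> log_kernel r z"
proof -
  have "2 * ln (r / (exp 1 * norm z)) = ln ((r / (exp 1 * norm z))\<^sup>2)"
    using assms by (simp add: ln_realpow)
  also have "(r / (exp 1 * norm z))\<^sup>2 = r\<^sup>2 * exp (- 2) / (norm z)\<^sup>2"
  proof -
    have "(exp 1)\<^sup>2 = (exp 2 :: real)" by (simp add: power2_eq_square flip: exp_add)
    then show ?thesis by (simp add: power_divide power_mult_distrib exp_minus divide_simps)
  qed
  also have "ln \<dots> = ln (r\<^sup>2 * exp (-2)) - ln ((norm z)\<^sup>2)"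
    using assms by (simp add: ln_div)
  also have "ln (r\<^sup>2 * exp (-2)) \<le> ln (reg_sq r ((norm z)\<^sup>2))"
    using assms by (intro ln_mono reg_sq_ge) auto
  finally show ?thesis
    using assms by (simp add: log_kernel_def field_simps)
qed

lemma log_kernel_le:
  assumes "0 < r" "norm z \<le> r" "z \<noteq> 0"
  shows "log_kernel r z \<le> ln (2 * r\<^sup>2 / (norm z)\<^sup>2) / (4 * pi)"
proof -
  have "reg_sq r ((norm z)\<^sup>2) \<le> 2 * r\<^sup>2"
  proof -
    have "(norm z)\<^sup>2 \<le> r\<^sup>2" using assms by (intro power_mono) auto
    with reg_sq_le[OF zero_le_power2 assms(1), of "norm z"] show ?thesis by linarith
  qed
  then have "ln (reg_sq r ((norm z)\<^sup>2)) \<le> ln (2 * r\<^sup>2)"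
    using assms by (intro ln_mono reg_sq_pos) auto
  then show ?thesis
    using assms by (simp add: log_kernel_def divide_right_mono ln_div)
qed

lemma mollifier_profile_nonneg: "0 \<le> s \<Longrightarrow> 0 \<le> mollifier_profile s"
  and mollifier_profile_pos: "0 \<le> s \<Longrightarrow> s < 1 \<Longrightarrow> 0 < mollifier_profile s"
proof -
  have *: "0 \<le> s * bump2 s * (s + bump0 s)" "0 < 1 + bump1 s" "bump0 s \<le> bump0 s - s * bump1 s" if "0 \<le> s"
    using that bump1_gt[of s] mult_nonneg_nonpos[OF that bump1_nonpos] bump0_nonneg[of s] bump2_nonneg[of s] by auto
  show "0 \<le> mollifier_profile s" if "0 \<le> s"
  proof -
    have "0 \<le> (1 + bump1 s) * (bump0 s - s * bump1 s)"
      using *[OF that] bump0_nonneg[of s] by (intro mult_nonneg_nonneg) auto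
    with *[OF that] show ?thesis
      unfolding mollifier_profile_def by (intro divide_nonneg_nonneg add_nonneg_nonneg) auto
  qed
  show "0 < mollifier_profile s" if "0 \<le> s" "s < 1"
  proof -
    have "0 < (1 + bump1 s) * (bump0 s - s * bump1 s)"
      using *[OF that(1)] bump0_pos[OF that(2)] by (intro mult_pos_pos) auto
    moreover have "0 < s + bump0 s" using bump0_pos[OF that(2)] that by simp
    ultimately show ?thesis
      unfolding mollifier_profile_def using *[OF that(1)] by (intro divide_pos_pos add_pos_nonneg) auto
  qed
qed

lemma mollifier_profile_eq_0: "1 \<le> s \<Longrightarrow> mollifier_profile s = 0"
  by (simp add: mollifier_profile_def flat_bump_eq_0)

lemma continuous_mollifier_profile: "continuous_on {0..} mollifier_profile"
proof -
  have "s + bump0 s \<noteq> 0" if "0 \<le> s" for s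
    using id_plus_bump0_ge[OF that] by (smt (verit) exp_gt_zero)
  then show ?thesis
    unfolding mollifier_profile_def [abs_def] by (intro continuous_intros) auto
qed

text \<open>The antiderivative is s times the s-derivative of the regularised logarithm, that is, up
  to a constant the flux of its gradient through circles. It runs from 0 at s = 0 to 1 at s = 1,
  whence the mollifier has total mass 1.\<close>

lemma mollifier_profile_deriv:
  assumes "0 \<le> s"
  shows "((\<lambda>s. s * (1 + bump1 s) / (s + bump0 s)) has_real_derivative mollifier_profile s) (at s)"
proof -
  have "s + bump0 s \<noteq> 0"
    using id_plus_bump0_ge[OF assms] by (smt (verit) exp_gt_zero)
  moreover have "((\<lambda>s. s * (1 + bump1 s)) has_real_derivative 1 * (1 + bump1 s) + (0 + bump2 s) * s) (at s)"
    by (intro DERIV_mult DERIV_ident DERIV_add DERIV_const flat_bump_has_deriv)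
  moreover have "((\<lambda>s. s + bump0 s) has_real_derivative 1 + bump1 s) (at s)"
    by (intro DERIV_ident DERIV_add flat_bump_has_deriv)
  ultimately have "((\<lambda>s. s * (1 + bump1 s) / (s + bump0 s)) has_real_derivative
     ((1 * (1 + bump1 s) + (0 + bump2 s) * s) * (s + bump0 s) - (s * (1 + bump1 s)) * (1 + bump1 s)) / ((s + bump0 s) * (s + bump0 s))) (at s)"
    by (intro DERIV_divide)
  moreover have "(1 * (1 + bump1 s) + (0 + bump2 s) * s) * (s + bump0 s) - (s * (1 + bump1 s)) * (1 + bump1 s)
     = (1 + bump1 s) * (bump0 s - s * bump1 s) + s * bump2 s * (s + bump0 s)"
    by (simp add: algebra_simps)
  ultimately show ?thesis
    by (simp add: mollifier_profile_def power2_eq_square)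
qed

section \<open>Radial integrals in the plane\<close>

lemma measurable_flat_bump [measurable]: "flat_bump P \<in> borel_measurable borel"
  using continuous_on_flat_bump[OF continuous_on_id, of UNIV P] by (simp add: borel_measurable_continuous_onI)

text \<open>The disc |z|^2 <= t has area pi t, so squaring the norm pushes Lebesgue measure forward
  to the constant density pi on the half line. This is why radial functions are written in |z|^2
  throughout.\<close>

lemma nn_integral_radial:
  fixes h :: "real \<Rightarrow> ennreal"
  assumes [measurable]: "h \<in> borel_measurable borel"
  shows "(\<integral>\<^sup>+z. h ((norm (z::real^2))\<^sup>2) \<partial>lborel) = ennreal pi * (\<integral>\<^sup>+s. indicator {0..} s * h s \<partial>lborel)"
proof -
  have eq: "distr lborel borel (\<lambda>z::real^2. (norm z)\<^sup>2) = density lborel (\<lambda>s::real. ennreal pi * indicator {0..} s)"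
    (is "?M = ?N")
  proof (rule measure_eqI_generator_eq[where E="range (\<lambda>t::real. {..t})" and \<Omega>=UNIV and A="\<lambda>n. {..real n}"])
    show "Int_stable (range (\<lambda>t::real. {..t}))"
      by (auto simp: Int_stable_def)
    show "sets ?M = sigma_sets UNIV (range (\<lambda>t::real. {..t}))"
      by (simp add: borel_eq_atMost)
    then show "sets ?N = sigma_sets UNIV (range (\<lambda>t::real. {..t}))"
      by simp
    show "(\<Union>i. {..real i}) = UNIV"
      using real_arch_simple by auto
    have M: "emeasure ?M {..t} = ennreal (pi * max 0 t)" for t
    proof -
      have "emeasure ?M {..t} = emeasure lborel {z::real^2. (norm z)\<^sup>2 \<le> t}"
        by (subst emeasure_distr) (auto simp: vimage_def)
      also have "{z::real^2. (norm z)\<^sup>2 \<le> t} = (if 0 \<le> t then cball 0 (sqrt t) else {})"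
        by (auto simp: real_le_rsqrt sqrt_ge_absD intro: real_le_rsqrt)
          (smt (verit) real_sqrt_abs real_sqrt_le_iff zero_le_power2 norm_ge_zero power2_le_imp_le real_sqrt_pow2)+
      also have "emeasure lborel \<dots> = ennreal (pi * max 0 t)"
        by (simp add: emeasure_cball unit_ball_vol_2)
      finally show ?thesis .
    qed
    have N: "emeasure ?N {..t} = ennreal (pi * max 0 t)" for t
    proof -
      have "emeasure ?N {..t} = (\<integral>\<^sup>+s. ennreal pi * indicator {0..t} s \<partial>lborel)"
        by (subst emeasure_density) (auto intro!: nn_integral_cong split: split_indicator)
      also have "\<dots> = ennreal (pi * max 0 t)"
        by (simp add: nn_integral_cmult ennreal_mult' max_def)
      finally show ?thesis .
    qed
    show "emeasure ?M X = emeasure ?N X" if "X \<in> range (\<lambda>t::real. {..t})" for X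
      using that M N by auto
    show "emeasure ?M {..real i} \<noteq> \<infinity>" for i
      by (simp add: M)
  qed auto
  have "(\<integral>\<^sup>+z. h ((norm (z::real^2))\<^sup>2) \<partial>lborel) = (\<integral>\<^sup>+s. h s \<partial>?M)"
    by (simp add: nn_integral_distr)
  also have "\<dots> = (\<integral>\<^sup>+s. ennreal pi * indicator {0..} s * h s \<partial>lborel)"
    unfolding eq by (subst nn_integral_density) auto
  also have "\<dots> = ennreal pi * (\<integral>\<^sup>+s. indicator {0..} s * h s \<partial>lborel)"
    by (simp add: mult.assoc nn_integral_cmult)
  finally show ?thesis .
qed

lemma nn_integral_reflect_translate:
  fixes h :: "'a::euclidean_space \<Rightarrow> ennreal"
  assumes [measurable]: "h \<in> borel_measurable borel"
  shows "(\<integral>\<^sup>+y. h (x - y) \<partial>lborel) = (\<integral>\<^sup>+y. h y \<partial>lborel)"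
proof -
  have "(\<integral>\<^sup>+y. h y \<partial>lborel) = (\<integral>\<^sup>+y. h y \<partial>distr lborel borel (\<lambda>y. x - y))"
    by (subst lborel_affine[of "-1" x]) (simp_all add: density_1)
  then show ?thesis by (simp add: nn_integral_distr)
qed

lemma nn_integral_translate:
  fixes h :: "'a::euclidean_space \<Rightarrow> ennreal"
  assumes [measurable]: "h \<in> borel_measurable borel"
  shows "(\<integral>\<^sup>+y. h (y - x) \<partial>lborel) = (\<integral>\<^sup>+y. h y \<partial>lborel)"
proof -
  have "(\<integral>\<^sup>+y. h y \<partial>lborel) = (\<integral>\<^sup>+y. h y \<partial>distr lborel borel ((+) (- x)))"
    by (simp add: lborel_distr_plus)
  then show ?thesis by (subst (asm) nn_integral_distr) simp_all
qed

lemma nn_integral_inner_power: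
  assumes "k < 1" "0 \<le> t"
  shows "(\<integral>\<^sup>+z. indicator {..t} ((norm (z::real^2))\<^sup>2) * ennreal ((norm z)\<^sup>2 powr (- k)) \<partial>lborel)
     = ennreal (pi * (t powr (1 - k) / (1 - k)))"
proof -
  have "(\<integral>\<^sup>+z. indicator {..t} ((norm (z::real^2))\<^sup>2) * ennreal ((norm z)\<^sup>2 powr (- k)) \<partial>lborel)
      = ennreal pi * (\<integral>\<^sup>+s. indicator {0..} s * (indicator {..t} s * ennreal (s powr (- k))) \<partial>lborel)"
    by (rule nn_integral_radial) simp
  also have "(\<integral>\<^sup>+s. indicator {0..} s * (indicator {..t} s * ennreal (s powr (- k))) \<partial>lborel)
     = (\<integral>\<^sup>+s. ennreal (indicator {0..t} s * s powr (- k)) \<partial>lborel)"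
    by (intro nn_integral_cong) (auto split: split_indicator)
  also have "\<dots> = ennreal (t powr (1 - k) / (1 - k))"
    using nn_integral_has_integral_lebesgue[OF _ has_integral_powr_from_0[of "- k" t]] assms by simp
  finally show ?thesis
    using assms by (simp add: ennreal_mult [symmetric])
qed

lemma nn_integral_outer_power:
  assumes "1 < k" "0 < t"
  shows "(\<integral>\<^sup>+z. indicator {t..} ((norm (z::real^2))\<^sup>2) * ennreal ((norm z)\<^sup>2 powr (- k)) \<partial>lborel)
     = ennreal (pi * (t powr (1 - k) / (k - 1)))"
proof -
  have "(\<integral>\<^sup>+z. indicator {t..} ((norm (z::real^2))\<^sup>2) * ennreal ((norm z)\<^sup>2 powr (- k)) \<partial>lborel)
      = ennreal pi * (\<integral>\<^sup>+s. indicator {0..} s * (indicator {t..} s * ennreal (s powr (- k))) \<partial>lborel)"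
    by (rule nn_integral_radial) simp
  also have "(\<integral>\<^sup>+s. indicator {0..} s * (indicator {t..} s * ennreal (s powr (- k))) \<partial>lborel)
     = (\<integral>\<^sup>+s. ennreal (indicator {t..} s * s powr (- k)) \<partial>lborel)"
    using assms by (intro nn_integral_cong) (auto split: split_indicator)
  also have "\<dots> = ennreal (- (t powr (- k + 1)) / (- k + 1))"
    using nn_integral_has_integral_lebesgue[OF _ has_integral_powr_to_inf[of "- k" t]] assms by simp
  also have "- (t powr (- k + 1)) / (- k + 1) = t powr (1 - k) / (k - 1)"
    using assms by (simp add: field_simps)
  finally show ?thesis
    using assms by (simp add: ennreal_mult [symmetric])
qed

section \<open>Mass and bounds of the mollifier; powers and exponentials of the logarithmic
  kernel\<close>

lemma measurable_mollifier_profile [measurable]: "mollifier_profile \<in> borel_measurable borel"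
  unfolding mollifier_profile_def [abs_def] by measurable

lemma measurable_mollifier [measurable]: "mollifier r \<in> borel_measurable borel"
  unfolding mollifier_def [abs_def] by measurable

lemma measurable_reg_sq [measurable]: "reg_sq r \<in> borel_measurable borel"
  unfolding reg_sq_def [abs_def] by measurable

lemma measurable_test_fun [measurable]: "test_fun e r \<in> borel_measurable borel"
  unfolding test_fun_def [abs_def] by measurable

lemma measurable_log_kernel [measurable]: "log_kernel r \<in> borel_measurable borel"
  unfolding log_kernel_def [abs_def] by measurable

lemma mollifier_nonneg: "0 \<le> mollifier r z"
  by (simp add: mollifier_def mollifier_profile_nonneg)

lemma mollifier_eq_0: "0 < r \<Longrightarrow> r \<le> norm z \<Longrightarrow> mollifier r z = 0"
  using power_mono[of r "norm z" 2] by (simp add: mollifier_def mollifier_profile_eq_0)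

lemma nn_integral_mollifier:
  assumes "0 < r"
  shows "(\<integral>\<^sup>+z. ennreal (mollifier r z) \<partial>lborel) = 1"
proof -
  have 1: "((\<lambda>s. r\<^sup>2 * (s / r\<^sup>2 * (1 + bump1 (s / r\<^sup>2)) / (s / r\<^sup>2 + bump0 (s / r\<^sup>2)))) has_real_derivative
      r\<^sup>2 * (mollifier_profile (s / r\<^sup>2) * (1 / r\<^sup>2))) (at s)" if "0 \<le> s" for s
    using that by (intro DERIV_cmult
      DERIV_chain2[where f="\<lambda>s. s * (1 + bump1 s) / (s + bump0 s)" and g="\<lambda>s. s / r\<^sup>2", OF mollifier_profile_deriv DERIV_cdivide[OF DERIV_ident]]) simp
  have "(\<integral>\<^sup>+z. ennreal (mollifier r z) \<partial>lborel)
      = ennreal pi * (\<integral>\<^sup>+s. indicator {0..} s * ennreal (mollifier_profile (s / r\<^sup>2) / (pi * r\<^sup>2)) \<partial>lborel)"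
    unfolding mollifier_def by (rule nn_integral_radial) simp
  also have "(\<integral>\<^sup>+s. indicator {0..} s * ennreal (mollifier_profile (s / r\<^sup>2) / (pi * r\<^sup>2)) \<partial>lborel)
     = (\<integral>\<^sup>+s. ennreal (1 / (pi * r\<^sup>2)) * (ennreal (mollifier_profile (s / r\<^sup>2)) * indicator {0..r\<^sup>2} s) \<partial>lborel)"
    using assms by (intro nn_integral_cong)
      (auto split: split_indicator simp: mollifier_profile_eq_0 mollifier_profile_nonneg simp flip: ennreal_mult)
  also have "\<dots> = ennreal (1 / (pi * r\<^sup>2)) * (\<integral>\<^sup>+s. ennreal (mollifier_profile (s / r\<^sup>2)) * indicator {0..r\<^sup>2} s \<partial>lborel)"
    by (rule nn_integral_cmult) simp
  also have "(\<integral>\<^sup>+s. ennreal (mollifier_profile (s / r\<^sup>2)) * indicator {0..r\<^sup>2} s \<partial>lborel) = ennreal (r\<^sup>2)"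
  proof -
    have "(\<integral>\<^sup>+s. ennreal (mollifier_profile (s / r\<^sup>2)) * indicator {0..r\<^sup>2} s \<partial>lborel)
      = r\<^sup>2 * (r\<^sup>2 / r\<^sup>2 * (1 + bump1 (r\<^sup>2 / r\<^sup>2)) / (r\<^sup>2 / r\<^sup>2 + bump0 (r\<^sup>2 / r\<^sup>2)))
       - r\<^sup>2 * (0 / r\<^sup>2 * (1 + bump1 (0 / r\<^sup>2)) / (0 / r\<^sup>2 + bump0 (0 / r\<^sup>2)))"
      using 1 assms by (intro nn_integral_FTC_Icc) (auto simp: mollifier_profile_nonneg)
    then show ?thesis using assms by (simp add: flat_bump_eq_0)
  qed
  finally show ?thesis
    using assms by (simp flip: ennreal_mult)
qed

lemma nn_integral_mollifier_translate:
  assumes "0 < r"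
  shows "(\<integral>\<^sup>+y. ennreal (mollifier r (y - x)) \<partial>lborel) = 1" "(\<integral>\<^sup>+y. ennreal (mollifier r (x - y)) \<partial>lborel) = 1"
  using nn_integral_translate[of "\<lambda>z. ennreal (mollifier r z)" x]
    nn_integral_reflect_translate[of "\<lambda>z. ennreal (mollifier r z)" x] nn_integral_mollifier[OF assms]
  by simp_all

text \<open>The profile is continuous, and positive on the compact interval up to 9/16 = (3/4)^2.
  The lower bound on three quarters of the disc is what allows means over different discs to be
  compared.\<close>

lemma mollifier_bounds:
  obtains B b :: real where "0 < B" "0 < b" "\<And>r z. 0 < r \<Longrightarrow> mollifier r z \<le> B / r\<^sup>2"
    "\<And>r z. 0 < r \<Longrightarrow> norm z \<le> 3 / 4 * r \<Longrightarrow> b / r\<^sup>2 \<le> mollifier r z"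
proof -
  have "continuous_on {0..1} mollifier_profile" "continuous_on {0..9/16} mollifier_profile"
    using continuous_mollifier_profile by (auto intro: continuous_on_subset)
  then have "\<exists>x\<in>{0..1}. \<forall>y\<in>{0..1}. mollifier_profile y \<le> mollifier_profile x"
    "\<exists>x\<in>{0..9/16}. \<forall>y\<in>{0..9/16}. mollifier_profile x \<le> mollifier_profile y"
    by (intro continuous_attains_sup continuous_attains_inf; simp)+
  then obtain s1 s2 where s1: "\<And>s. 0 \<le> s \<Longrightarrow> s \<le> 1 \<Longrightarrow> mollifier_profile s \<le> mollifier_profile s1"
    and s2: "s2 \<in> {0..9/16}" "\<And>s. s \<in> {0..9/16} \<Longrightarrow> mollifier_profile s2 \<le> mollifier_profile s"
    by (metis atLeastAtMost_iff)
  define B where "B = mollifier_profile s1"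
  define b where "b = mollifier_profile s2"
  have B: "mollifier_profile s \<le> B" if "0 \<le> s" for s
    using s1[of s] s1[of 1] that mollifier_profile_eq_0[of 1] mollifier_profile_eq_0[of s] by (cases "s \<le> 1") (auto simp: B_def)
  have "0 < B"
    using B[of 0] mollifier_profile_pos[of 0] by simp
  have "0 < b" using s2 mollifier_profile_pos[of s2] by (simp add: b_def)
  have "b / pi / r\<^sup>2 \<le> mollifier r z" if "0 < r" "norm z \<le> 3 / 4 * r" for r z
  proof -
    have "(norm z)\<^sup>2 \<le> (3 / 4 * r)\<^sup>2" using that by (intro power_mono) auto
    then have "(norm z)\<^sup>2 / r\<^sup>2 \<le> 9 / 16"
      using that by (simp add: divide_simps power2_eq_square)
    then have "b \<le> mollifier_profile ((norm z)\<^sup>2 / r\<^sup>2)"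
      unfolding b_def by (intro s2) auto
    then show ?thesis
      using that by (simp add: mollifier_def divide_right_mono)
  qed
  moreover have "mollifier r z \<le> B / pi / r\<^sup>2" if "0 < r" for r z
    using that B[of "(norm z)\<^sup>2 / r\<^sup>2"] by (simp add: mollifier_def divide_right_mono)
  ultimately show ?thesis
    using that[of "B / pi" "b / pi"] \<open>0 < B\<close> \<open>0 < b\<close> by simp
qed

lemma continuous_on_mollifier: "0 < r \<Longrightarrow> continuous_on UNIV (mollifier r)"
  unfolding mollifier_def
  by (intro continuous_intros continuous_on_compose2[OF continuous_mollifier_profile]) auto

text \<open>The bound ln X <= X^(n/2) / (n/2) with X = 2 r^2 / |z|^2 turns the power 1/n of the
  kernel into a multiple of X^(1/2), which is integrable. The right-hand side tends to 0 with r;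
  that smallness is what the bootstrap uses.\<close>

lemma nn_integral_log_kernel_powr:
  assumes "0 < n" "0 < r"
  shows "(\<integral>\<^sup>+z. ennreal (log_kernel r z powr (1 / n)) \<partial>lborel)
     \<le> ennreal ((2 / n / (4 * pi)) powr (1 / n) * ((2 * r\<^sup>2) powr (1/2) * (pi * (r\<^sup>2 powr (1/2) / (1/2)))))"
proof -
  have "log_kernel r z powr (1 / n) \<le> (2 / n / (4 * pi)) powr (1 / n) * ((2 * r\<^sup>2) powr (1/2) * (indicator {..r\<^sup>2} ((norm z)\<^sup>2) * (norm z)\<^sup>2 powr - (1/2)))" for z :: "real^2"
  proof (cases "z = 0 \<or> r \<le> norm z")
    case True
    then have "log_kernel r z = 0"
    proof
      assume "z = 0" then show ?thesis by (simp add: log_kernel_def)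
    qed (use assms in \<open>simp add: log_kernel_eq_0\<close>)
    then show ?thesis by simp
  next
    case False
    then have z: "0 < norm z" "norm z < r" by auto
    then have le: "(norm z)\<^sup>2 \<le> r\<^sup>2" by (intro power_mono) auto
    define X where "X = 2 * r\<^sup>2 / (norm z)\<^sup>2"
    have "(norm z)\<^sup>2 \<le> 2 * r\<^sup>2" using le zero_le_power2[of r] by linarith
    then have X: "1 \<le> X" using z by (simp add: X_def)
    have "log_kernel r z \<le> ln X / (4 * pi)"
      unfolding X_def using log_kernel_le[of r z] assms z by simp
    also have "ln X \<le> X powr (n / 2) / (n / 2)"
      using ln_powr_bound[OF X, of "n/2"] assms by simp
    finally have "log_kernel r z \<le> (2 / n / (4 * pi)) * X powr (n / 2)"
      by (simp add: divide_simps mult.commute)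
    then have "log_kernel r z powr (1 / n) \<le> ((2 / n / (4 * pi)) * X powr (n / 2)) powr (1 / n)"
      using assms by (intro powr_mono2 log_kernel_nonneg) auto
    also have "\<dots> = (2 / n / (4 * pi)) powr (1 / n) * X powr (1/2)"
      using assms by (subst powr_mult) (simp_all add: powr_powr)
    also have "X powr (1/2) = (2 * r\<^sup>2) powr (1/2) * (norm z)\<^sup>2 powr - (1/2)"
      unfolding X_def by (subst powr_divide) (simp_all add: powr_minus_divide)
    finally show ?thesis using le by simp
  qed
  then have "(\<integral>\<^sup>+z. ennreal (log_kernel r z powr (1 / n)) \<partial>lborel)
     \<le> (\<integral>\<^sup>+z. ennreal ((2 / n / (4 * pi)) powr (1 / n) * (2 * r\<^sup>2) powr (1/2)) * (indicator {..r\<^sup>2} ((norm (z::real^2))\<^sup>2) * ennreal ((norm z)\<^sup>2 powr - (1/2))) \<partial>lborel)"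
    by (intro nn_integral_mono) (simp add: ennreal_indicator [symmetric] mult.assoc flip: ennreal_mult)
  also have "\<dots> = ennreal ((2 / n / (4 * pi)) powr (1 / n) * (2 * r\<^sup>2) powr (1/2)) * ennreal (pi * (r\<^sup>2 powr (1 - 1/2) / (1 - 1/2)))"
    by (subst nn_integral_cmult, simp, subst nn_integral_inner_power) auto
  also have "\<dots> = ennreal ((2 / n / (4 * pi)) powr (1 / n) * ((2 * r\<^sup>2) powr (1/2) * (pi * (r\<^sup>2 powr (1/2) / (1/2)))))"
    by (subst ennreal_mult [symmetric]) (auto simp: mult.assoc)
  finally show ?thesis .
qed

text \<open>The integrand is of the order |z|^(-2 k), and k < 1 is its integrability at 0. The
  constant R + 2 r^2 serves both regions: outside the disc of radius r the kernel vanishes and |z|^2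
  <= R, inside the kernel is at most ln (2 r^2 / |z|^2) / (4 pi).\<close>

lemma nn_integral_exp_log_kernel:
  assumes "0 < k" "k < 1" "0 < r" "0 \<le> R"
  shows "(\<integral>\<^sup>+z. indicator {..R} ((norm z)\<^sup>2) * ennreal (exp (4 * pi * k * log_kernel r z)) \<partial>lborel)
     \<le> ennreal ((R + 2 * r\<^sup>2) powr k * (pi * (R powr (1 - k) / (1 - k))))"
proof -
  have "AE z in lborel. z \<noteq> (0::real^2)"
    using AE_lborel_singleton by blast
  then have "AE z in lborel. indicator {..R} ((norm z)\<^sup>2) * ennreal (exp (4 * pi * k * log_kernel r z))
      \<le> ennreal ((R + 2 * r\<^sup>2) powr k) * (indicator {..R} ((norm (z::real^2))\<^sup>2) * ennreal ((norm z)\<^sup>2 powr - k))"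
  proof eventually_elim
    case (elim z)
    show ?case
    proof (cases "(norm z)\<^sup>2 \<le> R")
      case True
      have "exp (4 * pi * k * log_kernel r z) \<le> (R + 2 * r\<^sup>2) powr k * (norm z)\<^sup>2 powr - k"
      proof (cases "r \<le> norm z")
        case True2: True
        have le: "(norm z)\<^sup>2 \<le> R + 2 * r\<^sup>2"
          using True zero_le_power2[of r] by linarith
        have "exp (4 * pi * k * log_kernel r z) = 1 * (norm z)\<^sup>2 powr k * (norm z)\<^sup>2 powr - k"
          using elim assms True2 by (simp add: log_kernel_eq_0 flip: powr_add)
        also have "\<dots> \<le> (R + 2 * r\<^sup>2) powr k * (norm z)\<^sup>2 powr - k"
          using assms le by (simp add: mult_right_mono powr_mono2)
        finally show ?thesis .
      next
        case False
        have "4 * pi * log_kernel r z \<le> ln (2 * r\<^sup>2 / (norm z)\<^sup>2)"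
          using log_kernel_le[of r z] elim False assms by (simp add: field_simps)
        then have "k * (4 * pi * log_kernel r z) \<le> k * ln (2 * r\<^sup>2 / (norm z)\<^sup>2)"
          using assms by (intro mult_left_mono) auto
        then have "exp (4 * pi * k * log_kernel r z) \<le> exp (k * ln (2 * r\<^sup>2 / (norm z)\<^sup>2))"
          by (simp add: mult_ac)
        also have "\<dots> = (2 * r\<^sup>2 / (norm z)\<^sup>2) powr k"
          using elim assms by (simp add: powr_def)
        also have "\<dots> = (2 * r\<^sup>2) powr k * (norm z)\<^sup>2 powr - k"
          by (simp add: powr_divide powr_minus_divide)
        also have "\<dots> \<le> (R + 2 * r\<^sup>2) powr k * (norm z)\<^sup>2 powr - k"
          using assms by (intro mult_right_mono powr_mono2) auto
        finally show ?thesis .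
      qed
      then show ?thesis using True by (simp flip: ennreal_mult)
    qed simp
  qed
  then have "(\<integral>\<^sup>+z. indicator {..R} ((norm z)\<^sup>2) * ennreal (exp (4 * pi * k * log_kernel r z)) \<partial>lborel)
     \<le> (\<integral>\<^sup>+z. ennreal ((R + 2 * r\<^sup>2) powr k) * (indicator {..R} ((norm (z::real^2))\<^sup>2) * ennreal ((norm z)\<^sup>2 powr - k)) \<partial>lborel)"
    by (rule nn_integral_mono_AE)
  also have "\<dots> = ennreal ((R + 2 * r\<^sup>2) powr k) * ennreal (pi * (R powr (1 - k) / (1 - k)))"
    by (subst nn_integral_cmult, simp, subst nn_integral_inner_power) (use assms in auto)
  also have "\<dots> = ennreal ((R + 2 * r\<^sup>2) powr k * (pi * (R powr (1 - k) / (1 - k))))"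
    using assms by (subst ennreal_mult [symmetric]) auto
  finally show ?thesis .
qed

section \<open>The representation formula\<close>

lemma integrable_product_lborel:
  fixes f :: "'a::euclidean_space \<Rightarrow> real" and g :: "'b::euclidean_space \<Rightarrow> real"
  assumes f: "integrable lborel f" and g: "integrable lborel g"
  shows "integrable (lborel \<Otimes>\<^sub>M lborel) (\<lambda>(x, y). f x * g y)"
proof (rule integrableI_bounded)
  note [measurable] = borel_measurable_integrable[OF f] borel_measurable_integrable[OF g]
  show "(\<lambda>(x, y). f x * g y) \<in> borel_measurable (lborel \<Otimes>\<^sub>M lborel)" by measurable
  have "(\<integral>\<^sup>+p. ennreal (norm (case p of (x, y) \<Rightarrow> f x * g y)) \<partial>(lborel \<Otimes>\<^sub>M lborel))
    = (\<integral>\<^sup>+x. \<integral>\<^sup>+y. ennreal (norm (f x)) * ennreal (norm (g y)) \<partial>lborel \<partial>lborel)"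
    by (subst lborel.nn_integral_fst[symmetric]) (simp_all add: abs_mult ennreal_mult)
  also have "\<dots> = (\<integral>\<^sup>+x. ennreal (norm (f x)) \<partial>lborel) * (\<integral>\<^sup>+y. ennreal (norm (g y)) \<partial>lborel)"
    by (simp add: nn_integral_cmult nn_integral_multc)
  also have "\<dots> < \<infinity>"
    using f g by (simp add: integrable_iff_bounded ennreal_mult_less_top)
  finally show "(\<integral>\<^sup>+p. ennreal (norm (case p of (x, y) \<Rightarrow> f x * g y)) \<partial>(lborel \<Otimes>\<^sub>M lborel)) < \<infinity>" .
qed

text \<open>Boxes are stable under intersection and generate the Borel sets, so the integral of w
  vanishes over every Borel set. Almost everywhere identities are thereby reduced to box integrals,
  which avoids differentiation theorems.\<close>

lemma AE_zero_if_box_integrals_zero: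
  fixes w :: "'a::euclidean_space \<Rightarrow> real"
  assumes w: "integrable lborel w"
    and box: "\<And>c d. (LINT x:box c d|lborel. w x) = 0"
  shows "AE x in lborel. w x = 0"
proof (rule sigma_finite_measure.density_zero[OF sigma_finite_lborel w])
  let ?E = "range (\<lambda>(a, b). box a b::'a set)"
  have int: "set_integrable lborel A w" if "A \<in> sets borel" for A
    unfolding set_integrable_def using integrable_mult_indicator[OF _ w, of A] that by simp
  let ?A = "\<lambda>n::nat. box (- (real n *\<^sub>R One)) (real n *\<^sub>R One) :: 'a set"
  have "(\<lambda>n. LINT x:?A n|lborel. w x) \<longlonglongrightarrow> (LINT x|lborel. w x)"
    unfolding set_lebesgue_integral_def
  proof (rule integral_dominated_convergence[where w="\<lambda>x. \<bar>w x\<bar>"])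
    show "AE x in lborel. (\<lambda>n. indicat_real (?A n) x *\<^sub>R w x) \<longlonglongrightarrow> w x"
    proof (rule AE_I2)
      fix x :: 'a
      obtain n0 where n0: "x \<in> ?A n0" using UN_box_eq_UNIV by blast
      have "eventually (\<lambda>n. indicat_real (?A n) x *\<^sub>R w x = w x) sequentially"
        using eventually_ge_at_top[of n0]
      proof eventually_elim
        case (elim n)
        then have "x \<in> ?A n" using n0 by (auto simp: box_def inner_diff_left intro: less_le_trans le_less_trans)
        then show ?case by simp
      qed
      then show "(\<lambda>n. indicat_real (?A n) x *\<^sub>R w x) \<longlonglongrightarrow> w x"
        by (rule tendsto_eventually)
    qed
  qed (use w in \<open>auto split: split_indicator\<close>)
  then have UNIV: "(LINT x|lborel. w x) = 0"
    by (simp add: box LIMSEQ_const_iff)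
  fix A :: "'a set" assume "A \<in> sets lborel"
  then have "A \<in> sigma_sets UNIV ?E" by (simp add: borel_eq_box)
  have "Int_stable ?E" "?E \<subseteq> Pow UNIV" by (auto simp: Int_stable_def box_Int_box)
  from this \<open>A \<in> sigma_sets UNIV ?E\<close> show "(LINT x:A|lborel. w x) = 0"
  proof (induction rule: sigma_sets_induct_disjoint)
    case (basic A)
    then show ?case using box by auto
  next
    case (compl A)
    then have "A \<in> sets borel" by (simp add: borel_eq_box)
    have "(LINT x:(UNIV - A)|lborel. w x) = (LINT x|lborel. w x - indicator A x *\<^sub>R w x)"
      unfolding set_lebesgue_integral_def
      by (intro Bochner_Integration.integral_cong refl) (auto split: split_indicator)
    also have "\<dots> = (LINT x|lborel. w x) - (LINT x:A|lborel. w x)"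
      unfolding set_lebesgue_integral_def using int[OF \<open>A \<in> sets borel\<close>] w
      by (intro Bochner_Integration.integral_diff) (auto simp: set_integrable_def)
    finally show ?case using compl UNIV by simp
  next
    case (union F)
    have F: "F i \<in> sets borel" for i
    proof -
      have "F i \<in> sigma_sets UNIV ?E" using union.hyps(2) by blast
      then show ?thesis by (simp add: borel_eq_box)
    qed
    have "(LINT x:(\<Union>i. F i)|lborel. w x) = (\<Sum>i. LINT x:F i|lborel. w x)"
      using union F by (intro lebesgue_integral_countable_add int) (auto simp: disjoint_family_on_def)
    then show ?case using union by simp
  qed (simp add: set_lebesgue_integral_def)
qed

lemma AE_not_in_frontier_box:
  fixes c d :: "'a::euclidean_space"
  shows "AE x in lborel. x \<notin> cbox c d - box c d"
proof -
  have "cbox c d - box c d \<in> null_sets lborel"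
    using negligible_frontier_interval[of c d]
    by (simp add: negligible_iff_null_sets null_sets_completion_iff)
  then show ?thesis by (rule AE_not_in)
qed

text \<open>All data are Borel functions on the whole plane and all integrals use
  \<open>lborel\<close>. The right-hand side f is globally integrable, so that its logarithmic
  potential can be formed at every point, whereas u is evaluated only on omega.\<close>

locale weak_solution =
  fixes \<omega> :: "(real^2) set" and u f :: "real^2 \<Rightarrow> real"
  assumes open_\<omega>: "open \<omega>"
    and u_meas [measurable]: "u \<in> borel_measurable borel"
    and f_meas [measurable]: "f \<in> borel_measurable borel"
    and f_nonneg: "\<And>x. 0 \<le> f x"
    and f_finite: "(\<integral>\<^sup>+x. ennreal (f x) \<partial>lborel) < \<infinity>"
    and u_int: "\<And>K. compact K \<Longrightarrow> K \<subseteq> \<omega> \<Longrightarrow> integrable lborel (\<lambda>x. indicator K x * u x)"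
    and weak: "\<And>\<phi>. smooth \<phi> \<Longrightarrow> compactly_supported_in \<omega> \<phi> \<Longrightarrow>
      - (LINT x|lborel. indicator \<omega> x * (u x * laplacian \<phi> x)) = (LINT x|lborel. f x * \<phi> x)"
begin

section \<open>Means and logarithmic potentials of a weak solution\<close>

definition avg :: "real \<Rightarrow> real^2 \<Rightarrow> real" where
  "avg r x = (LINT y|lborel. u y * mollifier r (y - x))"

definition pot :: "real \<Rightarrow> real^2 \<Rightarrow> ennreal" where
  "pot r x = (\<integral>\<^sup>+y. ennreal (f y * log_kernel r (y - x)) \<partial>lborel)"

lemma measurable_pot [measurable]: "pot r \<in> borel_measurable borel"
  unfolding pot_def by measurable

lemma integrable_f: "integrable lborel f"
  using f_finite f_nonneg by (intro integrableI_nonneg) auto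

lemma integrable_u_mollifier:
  assumes "0 < r" "cball x r \<subseteq> \<omega>"
  shows "integrable lborel (\<lambda>y. u y * mollifier r (y - x))"
proof -
  obtain B where B: "0 < B" "\<And>r z. 0 < r \<Longrightarrow> mollifier r z \<le> B / r\<^sup>2" using mollifier_bounds by metis
  have "integrable lborel (\<lambda>y. B / r\<^sup>2 * (indicator (cball x r) y * u y))"
    using assms by (intro integrable_mult_right u_int) auto
  then show ?thesis
  proof (rule Bochner_Integration.integrable_bound)
    show "AE y in lborel. norm (u y * mollifier r (y - x)) \<le> norm (B / r\<^sup>2 * (indicator (cball x r) y * u y))"
    proof (rule AE_I2)
      fix y
      have "\<bar>u y\<bar> * mollifier r (y - x) \<le> \<bar>u y\<bar> * \<bar>B / r\<^sup>2\<bar>"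
        using B(1) B(2)[OF assms(1), of "y - x"] by (intro mult_left_mono) auto
      then show "norm (u y * mollifier r (y - x)) \<le> norm (B / r\<^sup>2 * (indicator (cball x r) y * u y))"
        using mollifier_eq_0[OF assms(1), of "y - x"] mollifier_nonneg[of r "y - x"]
        by (auto simp: abs_mult dist_norm norm_minus_commute mult.commute split: split_indicator)
    qed
  qed measurable
qed

text \<open>The Laplacian of \<open>test_fun e r\<close> is the difference of the mollifiers at the
  two scales, so the weak equation becomes an exact identity between two means.\<close>

lemma avg_eq_avg_plus:
  assumes "0 < e" "e \<le> r" "cball x r \<subseteq> \<omega>"
  shows "avg e x = avg r x + (LINT y|lborel. f y * test_fun e r (y - x))"
proof -
  have r: "0 < r" and e: "cball x e \<subseteq> \<omega>" using assms by auto
  have "- (LINT y|lborel. indicator \<omega> y * (u y * laplacian (\<lambda>y. test_fun e r (y - x)) y))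
     = (LINT y|lborel. f y * test_fun e r (y - x))"
    using assms r by (intro weak smooth_test_fun compactly_supported_test_fun) auto
  also have "(\<lambda>y. indicator \<omega> y * (u y * laplacian (\<lambda>y. test_fun e r (y - x)) y))
     = (\<lambda>y. u y * mollifier r (y - x) - u y * mollifier e (y - x))"
  proof
    fix y
    have "mollifier r (y - x) = 0 \<and> mollifier e (y - x) = 0" if "y \<notin> \<omega>"
    proof -
      have "r \<le> norm (y - x)" using that assms by (force simp: dist_norm norm_minus_commute)
      then show ?thesis using assms r by (simp add: mollifier_eq_0)
    qed
    then show "indicator \<omega> y * (u y * laplacian (\<lambda>y. test_fun e r (y - x)) y)
       = u y * mollifier r (y - x) - u y * mollifier e (y - x)"
      by (cases "y \<in> \<omega>") (auto simp: laplacian_test_fun[OF assms(1) r] right_diff_distrib)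
  qed
  finally show ?thesis
    unfolding avg_def using assms r e
    by (subst (asm) Bochner_Integration.integral_diff) (auto intro!: integrable_u_mollifier)
qed

lemma log_kernel_finite_integral:
  assumes "0 < r"
  shows "(\<integral>\<^sup>+z. ennreal (log_kernel r z) \<partial>lborel) < \<infinity>"
proof -
  have "(\<integral>\<^sup>+z. ennreal (log_kernel r z) \<partial>lborel) = (\<integral>\<^sup>+z. ennreal (log_kernel r z powr (1 / 1)) \<partial>lborel)"
    using assms by (simp add: log_kernel_nonneg)
  also have "\<dots> \<le> ennreal ((2 / 1 / (4 * pi)) powr (1 / 1) * ((2 * r\<^sup>2) powr (1/2) * (pi * (r\<^sup>2 powr (1/2) / (1/2)))))"
    using assms by (intro nn_integral_log_kernel_powr) auto
  also have "\<dots> < \<infinity>" by simp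
  finally show ?thesis .
qed

lemma nn_integral_pot:
  assumes "0 < r"
  shows "(\<integral>\<^sup>+x. pot r x \<partial>lborel) < \<infinity>"
proof -
  have "(\<integral>\<^sup>+x. pot r x \<partial>lborel) = (\<integral>\<^sup>+y. \<integral>\<^sup>+x. ennreal (f y) * ennreal (log_kernel r (y - x)) \<partial>lborel \<partial>lborel)"
    unfolding pot_def using assms by (subst lborel_pair.Fubini') (auto simp: ennreal_mult f_nonneg log_kernel_nonneg)
  also have "\<dots> = (\<integral>\<^sup>+y. ennreal (f y) \<partial>lborel) * (\<integral>\<^sup>+z. ennreal (log_kernel r z) \<partial>lborel)"
    by (simp add: nn_integral_cmult nn_integral_multc nn_integral_reflect_translate[where h="\<lambda>z. ennreal (log_kernel r z)"])
  also have "\<dots> < \<infinity>"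
    using f_finite log_kernel_finite_integral[OF assms] by (simp add: ennreal_mult_less_top)
  finally show ?thesis .
qed

lemma AE_pot_finite: "0 < r \<Longrightarrow> AE x in lborel. pot r x < \<infinity>"
  using nn_integral_PInf_AE[of "pot r" lborel] nn_integral_pot[of r] by (auto simp: top.not_eq_extremum)

lemma integrable_f_log_kernel:
  assumes "0 < r" "pot r x < \<infinity>"
  shows "integrable lborel (\<lambda>y. f y * log_kernel r (y - x))"
  using assms by (intro integrableI_nonneg) (auto simp: pot_def f_nonneg log_kernel_nonneg)

lemma pot_eq_integral:
  assumes "0 < r"
  shows "enn2real (pot r x) = (LINT y|lborel. f y * log_kernel r (y - x))"
  unfolding pot_def using assms by (subst integral_eq_nn_integral) (auto simp: f_nonneg log_kernel_nonneg)

lemma integrable_pot: "0 < r \<Longrightarrow> integrable lborel (\<lambda>x. enn2real (pot r x))"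
proof (rule integrableI_nonneg)
  assume "0 < r"
  have "(\<integral>\<^sup>+x. ennreal (enn2real (pot r x)) \<partial>lborel) \<le> (\<integral>\<^sup>+x. pot r x \<partial>lborel)"
    by (intro nn_integral_mono) (simp add: ennreal_enn2real_if)
  then show "(\<integral>\<^sup>+x. ennreal (enn2real (pot r x)) \<partial>lborel) < \<infinity>"
    using nn_integral_pot[OF \<open>0 < r\<close>] by (rule le_less_trans)
qed auto

text \<open>By Fubini, integrating the means over a box moves the mollification from u to the
  indicator of the box. The mollified indicator converges off the frontier of the box, a null set,
  and is bounded by 1, so dominated convergence applies.\<close>

lemma avg_tendsto_set_integral:
  assumes r: "0 < r" and sub: "cbox a b \<subseteq> {x. cball x r \<subseteq> \<omega>}" and box: "cbox c d \<subseteq> cbox a b"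
  shows "set_integrable lborel (box c d) (avg r)" (is ?A)
    and "set_integrable lborel (box c d) u" (is ?B)
    and "(\<lambda>n. LINT x:box c d|lborel. avg (r / real (Suc n)) x) \<longlonglongrightarrow> (LINT x:box c d|lborel. u x)" (is ?C)
proof -
  \<comment> \<open>The closed r-neighbourhood of the box, a Minkowski sum of two compact sets.
    Cutting u off to K changes none of the means over centres in the box and makes u globally
    integrable.\<close>
  define K where "K = (\<Union>x\<in>cbox a b. cball x r)"
  have "K = {x + y | x y. x \<in> cbox a b \<and> y \<in> cball 0 r}"
  proof safe
    fix z assume "z \<in> K"
    then obtain x where "x \<in> cbox a b" "z \<in> cball x r" by (auto simp: K_def)
    then show "\<exists>x y. z = x + y \<and> x \<in> cbox a b \<and> y \<in> cball 0 r"
      by (intro exI[of _ x] exI[of _ "z - x"]) (auto simp: dist_norm norm_minus_commute)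
  next
    fix x y :: "real^2" assume "x \<in> cbox a b" "y \<in> cball 0 r"
    then show "x + y \<in> K" unfolding K_def by (intro UN_I[of x]) (auto simp: dist_norm)
  qed
  then have K: "compact K"
    by (simp only:) (intro compact_sums compact_cbox compact_cball)
  have K\<omega>: "K \<subseteq> \<omega>" using sub by (auto simp: K_def)
  define uK where "uK y = indicator K y * u y" for y
  have [measurable]: "K \<in> sets borel" using K by (simp add: borel_compact)
  have uK: "integrable lborel uK" using u_int[OF K K\<omega>] by (simp add: uK_def [abs_def])
  have [measurable]: "uK \<in> borel_measurable borel" using uK by auto
  let ?e = "\<lambda>n. r / real (Suc n)"
  have e: "0 < ?e n" "?e n \<le> r" for n using r by (auto simp: field_simps)
  obtain B where B: "0 < B" "\<And>r z. 0 < r \<Longrightarrow> mollifier r z \<le> B / r\<^sup>2" using mollifier_bounds by metis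
  have avg: "indicator (box c d) x * avg (?e n) x = (LINT y|lborel. indicator (box c d) x * uK y * mollifier (?e n) (y - x))" for n x
  proof (cases "x \<in> box c d")
    case True
    then have x: "x \<in> cbox a b" using box box_subset_cbox by blast
    have "u y * mollifier (?e n) (y - x) = uK y * mollifier (?e n) (y - x)" for y
    proof (cases "?e n \<le> norm (y - x)")
      case False
      then have "y \<in> cball x r" using e(2)[of n] by (auto simp: dist_norm norm_minus_commute)
      then have "y \<in> K" using x unfolding K_def by blast
      then show ?thesis by (simp add: uK_def)
    qed (use e(1)[of n] in \<open>simp add: mollifier_eq_0\<close>)
    then have "(\<lambda>y. u y * mollifier (?e n) (y - x)) = (\<lambda>y. uK y * mollifier (?e n) (y - x))" ..
    with True show ?thesis by (simp only: avg_def indicator_simps mult_1_left)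
  qed simp
  have int2: "integrable (lborel \<Otimes>\<^sub>M lborel) (\<lambda>(x, y). indicator (box c d) x * uK y * mollifier (?e n) (y - x))" for n
  proof (rule Bochner_Integration.integrable_bound)
    show "integrable (lborel \<Otimes>\<^sub>M lborel) (\<lambda>(x, y). (B / (?e n)\<^sup>2 * indicator (box c d) x) * uK y)"
      by (intro integrable_product_lborel uK integrable_mult_right integrable_real_indicator
          emeasure_bounded_finite bounded_box) simp
    show "AE p in lborel \<Otimes>\<^sub>M lborel. norm (case p of (x, y) \<Rightarrow> indicator (box c d) x * uK y * mollifier (?e n) (y - x))
       \<le> norm (case p of (x, y) \<Rightarrow> (B / (?e n)\<^sup>2 * indicator (box c d) x) * uK y)"
    proof (rule AE_I2, clarify)
      fix x y :: "real^2"
      have "indicator (box c d) x * \<bar>uK y\<bar> * mollifier (?e n) (y - x) \<le> indicator (box c d) x * \<bar>uK y\<bar> * (B / (?e n)\<^sup>2)"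
        by (rule mult_left_mono[OF B(2)[OF e(1)]]) simp
      then show "norm (indicator (box c d) x * uK y * mollifier (?e n) (y - x)) \<le> norm (B / (?e n)\<^sup>2 * indicator (box c d) x * uK y)"
        using B(1) mollifier_nonneg[of "?e n" "y - x"] by (simp add: abs_mult mult_ac)
    qed
  qed measurable
  have "integrable lborel (\<lambda>x. LINT y|lborel. indicator (box c d) x * uK y * mollifier (?e 0) (y - x))"
    using lborel_pair.integrable_fst[OF int2[of 0]] by simp
  then show ?A unfolding set_integrable_def using avg[of _ 0] by simp
  have "integrable lborel (\<lambda>x. indicator (box c d) x * uK x)"
    using integrable_mult_indicator[OF _ uK, of "box c d"] by simp
  moreover have uK_eq: "indicator (box c d) x * uK x = indicator (box c d) x * u x" for x
  proof (cases "x \<in> box c d")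
    case True
    then have "x \<in> K" using box box_subset_cbox r by (force simp: K_def)
    then show ?thesis by (simp add: uK_def)
  qed simp
  ultimately show ?B by (simp add: set_integrable_def)
  define m where "m n y = (LINT x|lborel. indicator (box c d) x * mollifier (?e n) (y - x))" for n y
  have int_moll: "integrable lborel (\<lambda>x. mollifier (?e n) (y - x))" "(LINT x|lborel. mollifier (?e n) (y - x)) = 1" for n y
    using nn_integral_mollifier_translate(2)[OF e(1)[of n], of y]
    by (auto intro!: integrableI_nonneg simp: mollifier_nonneg integral_eq_nn_integral)
  have int_m: "integrable lborel (\<lambda>x. indicator (box c d) x * mollifier (?e n) (y - x))" for n y
    using integrable_mult_indicator[OF _ int_moll(1), of "box c d"] by simp
  have m: "0 \<le> m n y" "m n y \<le> 1" for n y
  proof -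
    show "0 \<le> m n y" unfolding m_def by (simp add: mollifier_nonneg)
    have "m n y \<le> (LINT x|lborel. mollifier (?e n) (y - x))"
      unfolding m_def by (intro integral_mono int_m int_moll) (auto split: split_indicator simp: mollifier_nonneg)
    then show "m n y \<le> 1" using int_moll(2)[of n y] by linarith
  qed
  have [measurable]: "m n \<in> borel_measurable borel" for n
    unfolding m_def by measurable
  have swap: "(LINT x:box c d|lborel. avg (?e n) x) = (LINT y|lborel. uK y * m n y)" for n
  proof -
    have "(LINT x:box c d|lborel. avg (?e n) x) = (LINT x|lborel. LINT y|lborel. indicator (box c d) x * uK y * mollifier (?e n) (y - x))"
      unfolding set_lebesgue_integral_def using avg[of _ n] by simp
    also have "\<dots> = (LINT y|lborel. LINT x|lborel. indicator (box c d) x * uK y * mollifier (?e n) (y - x))"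
      using lborel_pair.Fubini_integral[OF int2[of n]] by simp
    also have "\<dots> = (LINT y|lborel. uK y * m n y)"
      unfolding m_def by (intro Bochner_Integration.integral_cong refl, subst integral_mult_right_zero [symmetric]) (simp add: mult_ac)
    finally show ?thesis .
  qed
  have lim: "(\<lambda>n. m n y) \<longlonglongrightarrow> indicator (box c d) y" if "y \<notin> cbox c d - box c d" for y
  proof -
    have e0: "?e \<longlonglongrightarrow> 0" by real_asymp
    have "y \<in> box c d \<or> y \<notin> cbox c d" using that by blast
    then consider "y \<in> box c d" | "y \<notin> cbox c d" by blast
    then show ?thesis
    proof cases
      case 1
      then obtain s where s: "0 < s" "ball y s \<subseteq> box c d"
        using open_box open_contains_ball by blast
      have "eventually (\<lambda>n. ?e n < s) sequentially"
        using order_tendstoD(2)[OF e0 s(1)] .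
      then have "eventually (\<lambda>n. m n y = indicator (box c d) y) sequentially"
      proof eventually_elim
        case (elim n)
        have "indicator (box c d) x * mollifier (?e n) (y - x) = mollifier (?e n) (y - x)" for x
        proof (cases "x \<in> box c d")
          case False
          then have "x \<notin> ball y s" using s by blast
          then show ?thesis using elim mollifier_eq_0[OF e(1), of n "y - x"] by (simp add: dist_norm)
        qed simp
        then have "m n y = 1"
          unfolding m_def by (subst int_moll(2)[of n y, symmetric]) (simp only:)
        then show ?case using 1 by simp
      qed
      then show ?thesis by (rule tendsto_eventually)
    next
      case 2
      then obtain s where s: "0 < s" "ball y s \<subseteq> - cbox c d"
        using closed_cbox open_contains_ball by (metis Compl_iff open_Compl)
      have "eventually (\<lambda>n. ?e n < s) sequentially"
        using order_tendstoD(2)[OF e0 s(1)] .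
      then have "eventually (\<lambda>n. m n y = indicator (box c d) y) sequentially"
      proof eventually_elim
        case (elim n)
        have "indicator (box c d) x * mollifier (?e n) (y - x) = 0" for x
        proof (cases "x \<in> box c d")
          case True
          then have "x \<notin> ball y s" using s box_subset_cbox by blast
          then show ?thesis using elim mollifier_eq_0[OF e(1), of n "y - x"] by (simp add: dist_norm)
        qed simp
        moreover have "y \<notin> box c d" using 2 box_subset_cbox by blast
        ultimately show ?case
          unfolding m_def by (simp only: integral_zero) simp
      qed
      then show ?thesis by (rule tendsto_eventually)
    qed
  qed
  have "(\<lambda>n. LINT y|lborel. uK y * m n y) \<longlonglongrightarrow> (LINT y|lborel. uK y * indicator (box c d) y)"
  proof (rule integral_dominated_convergence[where w="\<lambda>y. \<bar>uK y\<bar>"])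
    show "AE y in lborel. (\<lambda>n. uK y * m n y) \<longlonglongrightarrow> uK y * indicator (box c d) y"
      using AE_not_in_frontier_box[of c d] by eventually_elim (intro tendsto_mult tendsto_const lim)
    show "AE y in lborel. norm (uK y * m n y) \<le> \<bar>uK y\<bar>" for n
      using m[of n] by (auto simp: abs_mult mult_left_le)
  qed (use uK in auto)
  also have "(LINT y|lborel. uK y * indicator (box c d) y) = (LINT x:box c d|lborel. u x)"
    by (simp only: set_lebesgue_integral_def real_scaleR_def mult.commute[of "uK _"] uK_eq)
  finally show ?C by (simp only: swap)
qed

text \<open>At the scales r / (n + 1) the mean is \<open>avg r\<close> plus the integral
  \<open>T n\<close> of f against the test function. As n grows the means converge to u in the sense
  of box integrals and \<open>T n\<close> converges to the potential almost everywhere, dominated by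
  it; comparing the limits identifies u.\<close>

lemma AE_representation_box:
  assumes r: "0 < r" and sub: "cbox a b \<subseteq> {x. cball x r \<subseteq> \<omega>}"
  shows "AE x in lborel. x \<in> cbox a b \<longrightarrow> u x = avg r x + enn2real (pot r x)"
proof -
  let ?e = "\<lambda>n. r / real (Suc n)"
  have e: "0 < ?e n" "?e n \<le> r" for n using r by (auto simp: field_simps)
  define T where "T n x = (LINT y|lborel. f y * test_fun (?e n) r (y - x))" for n x
  have [measurable]: "T n \<in> borel_measurable borel" for n unfolding T_def by measurable
  have test_le: "AE y in lborel. f y * test_fun (?e n) r (y - x) \<le> f y * log_kernel r (y - x)" for n x
    using AE_lborel_singleton[of x]
  proof eventually_elim
    case (elim y)
    then show ?case
      using log_kernel_split[of "y - x" r "?e n"] log_kernel_nonneg[OF e(1), of n "y - x"] f_nonneg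
      by (intro mult_left_mono) auto
  qed
  have T_bd: "AE x in lborel. \<forall>n. 0 \<le> T n x \<and> T n x \<le> enn2real (pot r x)"
    using AE_pot_finite[OF r]
  proof eventually_elim
    case (elim x)
    show ?case
    proof
      fix n
      note int = integrable_f_log_kernel[OF r elim]
      have "integrable lborel (\<lambda>y. f y * test_fun (?e n) r (y - x))"
        by (rule Bochner_Integration.integrable_bound[OF int])
          (use test_le[of n x] e[of n] r in \<open>auto simp: f_nonneg test_fun_nonneg log_kernel_nonneg abs_mult\<close>)
      then show "0 \<le> T n x \<and> T n x \<le> enn2real (pot r x)"
        unfolding T_def pot_eq_integral[OF r] using e[of n] test_le[of n x] int
        by (auto intro!: integral_nonneg_AE integral_mono_AE simp: f_nonneg test_fun_nonneg)
    qed
  qed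
  have T_lim: "AE x in lborel. (\<lambda>n. T n x) \<longlonglongrightarrow> enn2real (pot r x)"
    using AE_pot_finite[OF r]
  proof eventually_elim
    case (elim x)
    show ?case unfolding T_def pot_eq_integral[OF r]
    proof (rule integral_dominated_convergence[where w="\<lambda>y. f y * log_kernel r (y - x)"])
      show "AE y in lborel. (\<lambda>n. f y * test_fun (?e n) r (y - x)) \<longlonglongrightarrow> f y * log_kernel r (y - x)"
        using AE_lborel_singleton[of x]
      proof eventually_elim
        case (elim y)
        have "?e \<longlonglongrightarrow> 0" by real_asymp
        then have "eventually (\<lambda>n. ?e n < norm (y - x)) sequentially"
          using elim by (intro order_tendstoD) auto
        then have "eventually (\<lambda>n. test_fun (?e n) r (y - x) = log_kernel r (y - x)) sequentially"
        proof eventually_elim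
          case (elim n)
          then show ?case
            using log_kernel_split[of "y - x" r "?e n"] log_kernel_eq_0[OF e(1), of n "y - x"] \<open>y \<noteq> x\<close> by auto
        qed
        then show ?case by (intro tendsto_mult tendsto_const tendsto_eventually)
      qed
      show "AE y in lborel. norm (f y * test_fun (?e n) r (y - x)) \<le> f y * log_kernel r (y - x)" for n
        using test_le[of n x] e[of n] by (auto simp: abs_mult f_nonneg test_fun_nonneg)
    qed (use integrable_f_log_kernel[OF r elim] in auto)
  qed
  define w where "w x = indicator (box a b) x * (u x - (avg r x + enn2real (pot r x)))" for x
  have "AE x in lborel. w x = 0"
  proof (rule AE_zero_if_box_integrals_zero)
    note tend = avg_tendsto_set_integral[OF r sub]
    have "set_integrable lborel (box a b) (\<lambda>x. u x - (avg r x + enn2real (pot r x)))"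
      by (intro set_integral_diff(1) set_integral_add(1) tend(1,2)[OF order_refl])
       (unfold set_integrable_def, rule integrable_mult_indicator[OF _ integrable_pot[OF r]], simp)
    then show "integrable lborel w" by (simp add: set_integrable_def w_def [abs_def])
    fix c d :: "real^2"
    show "(LINT x:box c d|lborel. w x) = 0"
    proof (cases "box c d \<inter> box a b = {}")
      case True
      then have "(\<lambda>x. indicator (box c d) x *\<^sub>R w x) = (\<lambda>x. 0)"
        by (auto simp: fun_eq_iff w_def indicator_def)
      then show ?thesis unfolding set_lebesgue_integral_def by (simp only: integral_zero)
    next
      case False
      \<comment> \<open>The intersection of two boxes is a box, so an arbitrary box reduces to one
        inside \<open>cbox a b\<close>, where convergence of the means is known.\<close>
      obtain c' d' where cd1: "box c d \<inter> box a b = box c' d'" using box_Int_box[of c d a b] by blast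
      then have ne: "box c' d' \<noteq> {}" using False by simp
      have "closure (box c' d') \<subseteq> closure (box a b)" using cd1 by (intro closure_mono) auto
      moreover have "box a b \<noteq> {}" using False by auto
      ultimately have "cbox c' d' \<subseteq> cbox a b" using ne by (simp add: closure_box)
      note cd = cd1 this
    note tend = avg_tendsto_set_integral[OF r sub cd(2)]
    have intpot: "set_integrable lborel (box c' d') (\<lambda>x. enn2real (pot r x))"
      unfolding set_integrable_def by (rule integrable_mult_indicator[OF _ integrable_pot[OF r]]) simp
    have T_int: "set_integrable lborel (box c' d') (T n)" for n
      unfolding set_integrable_def
      by (rule Bochner_Integration.integrable_bound[OF integrable_pot[OF r]])
        (use T_bd in \<open>auto split: split_indicator elim!: eventually_mono\<close>)
    have eq: "(LINT x:box c' d'|lborel. avg (?e n) x) = (LINT x:box c' d'|lborel. avg r x) + (LINT x:box c' d'|lborel. T n x)" for n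
    proof -
      have "(LINT x:box c' d'|lborel. avg (?e n) x) = (LINT x:box c' d'|lborel. avg r x + T n x)"
      proof (rule set_lebesgue_integral_cong)
        show "\<forall>x. x \<in> box c' d' \<longrightarrow> avg (?e n) x = avg r x + T n x"
        proof (intro allI impI)
          fix x assume "x \<in> box c' d'"
          then have "cball x r \<subseteq> \<omega>" using sub cd(2) box_subset_cbox[of c' d'] by blast
          then show "avg (?e n) x = avg r x + T n x"
            unfolding T_def using e by (intro avg_eq_avg_plus)
        qed
      qed simp
      also have "\<dots> = (LINT x:box c' d'|lborel. avg r x) + (LINT x:box c' d'|lborel. T n x)"
        by (intro set_integral_add tend T_int)
      finally show ?thesis .
    qed
    have "(\<lambda>n. LINT x:box c' d'|lborel. T n x) \<longlonglongrightarrow> (LINT x:box c' d'|lborel. enn2real (pot r x))"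
      unfolding set_lebesgue_integral_def
    proof (rule integral_dominated_convergence[where w="\<lambda>x. enn2real (pot r x)"])
      show "AE x in lborel. (\<lambda>n. indicator (box c' d') x *\<^sub>R T n x) \<longlonglongrightarrow> indicator (box c' d') x *\<^sub>R enn2real (pot r x)"
        using T_lim by eventually_elim (intro tendsto_intros)
      show "AE x in lborel. norm (indicat_real (box c' d') x *\<^sub>R T n x) \<le> enn2real (pot r x)" for n
        using T_bd by eventually_elim (auto split: split_indicator)
    qed (use integrable_pot[OF r] in auto)
    then have "(\<lambda>n. LINT x:box c' d'|lborel. avg (?e n) x) \<longlonglongrightarrow>
        (LINT x:box c' d'|lborel. avg r x) + (LINT x:box c' d'|lborel. enn2real (pot r x))"
      unfolding eq by (intro tendsto_intros)
    from LIMSEQ_unique[OF this tend(3)]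
    have "(LINT x:box c' d'|lborel. u x) - ((LINT x:box c' d'|lborel. avg r x) + (LINT x:box c' d'|lborel. enn2real (pot r x))) = 0"
      by simp
    then have "(LINT x:box c' d'|lborel. u x - (avg r x + enn2real (pot r x))) = 0"
      using tend intpot by (simp add: set_integral_diff set_integral_add)
    moreover have "(LINT x:box c d|lborel. w x) = (LINT x:box c' d'|lborel. u x - (avg r x + enn2real (pot r x)))"
      unfolding set_lebesgue_integral_def w_def cd(1) [symmetric]
      by (intro Bochner_Integration.integral_cong refl) (auto split: split_indicator)
    ultimately show ?thesis by simp
  qed
  qed
  then show ?thesis
    using AE_not_in_frontier_box[of a b]
    by eventually_elim (auto simp: w_def split: split_indicator_asm)
qed

lemma AE_representation:
  assumes r: "0 < r"
  shows "AE x in lborel. cball x r \<subseteq> \<omega> \<longrightarrow> pot r x < \<infinity> \<and> u x = avg r x + enn2real (pot r x)"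
proof -
  \<comment> \<open>The complement is the sum of the closed set - \<omega> and a compact disc, hence
    closed. The open set is then exhausted by countably many closed boxes, whose exceptional null
    sets can be united.\<close>
  have "open {x. cball x r \<subseteq> \<omega>}" (is "open ?D")
  proof -
    have "?D = - (\<Union>x\<in>- \<omega>. cball x r)"
      by (auto simp: dist_commute subset_iff) 
    also have "(\<Union>x\<in>- \<omega>. cball x r) = (\<Union>x\<in>- \<omega>. \<Union>y\<in>cball 0 r. {x + y})"
    proof (intro equalityI subsetI; clarify)
      fix x z assume "x \<notin> \<omega>" "z \<in> cball x r"
      then show "z \<in> (\<Union>x\<in>- \<omega>. \<Union>y\<in>cball 0 r. {x + y})"
        by (intro UN_I[of x] UN_I[of "z - x"]) (auto simp: dist_norm norm_minus_commute)
    next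
      fix x y :: "real^2" assume "y \<in> cball 0 r" "x \<notin> \<omega>"
      then show "x + y \<in> (\<Union>x\<in>- \<omega>. cball x r)" by (intro UN_I[of x]) (auto simp: dist_norm)
    qed
    finally have eq: "?D = - (\<Union>x\<in>- \<omega>. \<Union>y\<in>cball 0 r. {x + y})" .
    show ?thesis
      unfolding eq using open_\<omega> by (intro open_Compl closed_compact_sums) (auto simp: closed_Compl)
  qed
  then obtain \<D> where \<D>: "countable \<D>" "\<D> \<subseteq> Pow ?D" "\<And>X. X \<in> \<D> \<Longrightarrow> \<exists>a b. X = cbox a b" "\<Union>\<D> = ?D"
    using open_countable_Union_open_cbox[of ?D] by metis
  have "AE x in lborel. \<forall>X\<in>\<D>. x \<in> X \<longrightarrow> u x = avg r x + enn2real (pot r x)"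
  proof (rule AE_ball_countable'[OF _ \<D>(1)])
    fix X assume "X \<in> \<D>"
    then obtain a b where "X = cbox a b" "cbox a b \<subseteq> ?D" using \<D> by blast
    then show "AE x in lborel. x \<in> X \<longrightarrow> u x = avg r x + enn2real (pot r x)"
      using AE_representation_box[OF r, of a b] by simp
  qed
  then show ?thesis
    using AE_pot_finite[OF r]
  proof eventually_elim
    case (elim x)
    show ?case
    proof
      assume "cball x r \<subseteq> \<omega>"
      then obtain X where "X \<in> \<D>" "x \<in> X" using \<D>(4) by blast
      then show "pot r x < \<infinity> \<and> u x = avg r x + enn2real (pot r x)"
        using elim by blast
    qed
  qed
qed

end

section \<open>Nonhomogeneous Young inequalities and the Hardy--Littlewood--Sobolev bound\<close>

lemma powr_mult_le_sum_powr:
  fixes x y :: real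
  assumes "0 \<le> x" "0 \<le> y" "0 \<le> a" "0 \<le> b"
  shows "x powr a * y powr b \<le> (x + y) powr (a + b)"
  using assms by (auto simp: powr_add intro!: mult_mono powr_mono2)

lemma powr_mult_le_sum:
  fixes x y :: real
  assumes "0 \<le> x" "0 \<le> y" "0 \<le> b" "b \<le> 1"
  shows "x powr b * y powr (1 - b) \<le> x + y"
  using powr_mult_le_sum_powr[of x y b "1 - b"] assms by simp

lemma powr_le_one_plus:
  fixes x :: real
  assumes "0 \<le> x" "0 \<le> a" "a \<le> 1"
  shows "x powr a \<le> 1 + x"
  using powr_mult_le_sum[of x 1 a] assms by simp

text \<open>The pointwise form of Young's convolution inequality: integrating the right-hand side over
  a product space only requires integrability of each factor.\<close>

lemma powr_mult3_le:
  fixes x y z :: real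
  assumes "0 \<le> x" "0 \<le> y" "0 \<le> z" "a \<le> 1" "b \<le> 1" "c \<le> 1" "a + b + c = 2"
  shows "x powr a * y powr b * z powr c \<le> x * y + x * z + y * z"
proof (cases "x = 0 \<or> y = 0 \<or> z = 0")
  case True
  then show ?thesis using assms by auto
next
  case False
  define s where "s = x * y + x * z + y * z"
  have pos: "0 < x" "0 < y" "0 < z" using False assms by auto
  then have s: "0 < s" by (auto simp: s_def intro!: add_pos_pos)
  have "x powr a * y powr b * z powr c = (x * y) powr (1 - c) * (x * z) powr (1 - b) * (y * z) powr (1 - a)"
  proof -
    have "a = (1 - c) + (1 - b)" "b = (1 - c) + (1 - a)" "c = (1 - b) + (1 - a)" using assms by auto
    then have "x powr a = x powr (1 - c) * x powr (1 - b)" "y powr b = y powr (1 - c) * y powr (1 - a)"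
      "z powr c = z powr (1 - b) * z powr (1 - a)" by (metis powr_add)+
    then show ?thesis using pos by (simp add: powr_mult mult_ac)
  qed
  also have "\<dots> \<le> s powr (1 - c) * s powr (1 - b) * s powr (1 - a)"
    using pos assms by (intro mult_mono powr_mono2) (auto simp: s_def)
  also have "\<dots> = s powr 1"
    using assms by (simp add: algebra_simps flip: powr_add)
  finally show ?thesis using s by (simp add: s_def)
qed

text \<open>For fixed \<open>x\<close> the integration in \<open>y\<close> is split at the scale
  \<open>\<bar>x - y\<bar>\<^sup>2 = 1 / F x\<close>.\<close>

lemma hls_half:
  fixes F G :: "real^2 \<Rightarrow> real"
  assumes [measurable]: "F \<in> borel_measurable borel" "G \<in> borel_measurable borel"
    and nonneg: "\<And>x. 0 \<le> F x" "\<And>x. 0 \<le> G x"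
    and abc: "0 < a" "a < 1" "0 < b" "b < 1" "0 < c" "c < 1" "a + b + c = 2"
    and A: "0 \<le> A" "(\<integral>\<^sup>+x. ennreal (F x) \<partial>lborel) \<le> ennreal A"
    and B: "0 \<le> B" "(\<integral>\<^sup>+x. ennreal (G x) \<partial>lborel) \<le> ennreal B"
  shows "(\<integral>\<^sup>+x. \<integral>\<^sup>+y. ennreal (if G y \<le> F x then F x powr a * G y powr b * (norm (x - y))\<^sup>2 powr (- c) else 0) \<partial>lborel \<partial>lborel)
    \<le> ennreal (A * (pi / (1 - c) + B + pi / (c / (1 - b) - 1)))"
proof -
  \<comment> \<open>k exceeds 1 because b + c = 2 - a > 1, so |x - y|^(-2 k) is integrable at
    infinity, and the kernel |x - y|^(-2 c) is its power 1 - b.\<close>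
  define k where "k = c / (1 - b)"
  have k: "1 < k" using abc by (simp add: k_def)
  let ?D = "\<lambda>x y. (norm (x - y :: real^2))\<^sup>2"
  have inner: "(\<integral>\<^sup>+y. ennreal (if G y \<le> F x then F x powr a * G y powr b * ?D x y powr (- c) else 0) \<partial>lborel)
     \<le> ennreal (F x) * ennreal (pi / (1 - c) + B + pi / (k - 1))" for x
  proof (cases "F x = 0")
    case True
    then have "(\<integral>\<^sup>+y. ennreal (if G y \<le> F x then F x powr a * G y powr b * ?D x y powr (- c) else 0) \<partial>lborel)
      = (\<integral>\<^sup>+(y::real^2). 0 \<partial>lborel)"
      by (intro nn_integral_cong) auto
    then show ?thesis by simp
  next
    case False
    define t where "t = F x"
    have t: "0 < t" using False nonneg[of x] by (simp add: t_def)
    \<comment> \<open>Near the diagonal G is replaced by its bound t. Far away G^b Z^(1-b) <= G + Z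
      is used with Z = |x - y|^(-2 k) t^(1-k). The powers of t are such that each of the three terms
      integrates in y to a constant times t.\<close>
    have pt: "(if G y \<le> t then t powr a * G y powr b * ?D x y powr (- c) else 0)
      \<le> t powr (a + b) * (indicator {..1/t} (?D x y) * ?D x y powr (- c)) + t * G y
        + t powr (2 - k) * (indicator {1/t..} (?D x y) * ?D x y powr (- k))" (is "?l \<le> ?r1 + ?r2 + ?r3") for y
    proof -
      have r: "0 \<le> ?r1" "0 \<le> ?r2" "0 \<le> ?r3" using t nonneg by auto
      show ?thesis
      proof (cases "G y \<le> t")
        case le: True
        show ?thesis
        proof (cases "?D x y \<le> 1 / t")
          case True
          have "t powr a * G y powr b * ?D x y powr (- c) \<le> t powr a * t powr b * ?D x y powr (- c)"
            using le nonneg abc by (intro mult_right_mono mult_left_mono powr_mono2) auto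
          also have "\<dots> = ?r1" using True by (simp add: powr_add)
          also have "?r1 \<le> ?r1 + ?r2 + ?r3" using r(2,3) by linarith
          finally show ?thesis using le by (simp only: if_True)
        next
          case far: False
          define d where "d = ?D x y"
          have d: "0 < d" "1 / t \<le> d" using far t by (auto simp: d_def intro: less_trans[of 0 "1/t"])
          have "G y powr b * (d powr (- k) * t powr (- (k - 1))) powr (1 - b) \<le> G y + d powr (- k) * t powr (- (k - 1))"
            using abc nonneg by (intro powr_mult_le_sum) auto
          also have "(d powr (- k) * t powr (- (k - 1))) powr (1 - b) = d powr (- c) * t powr (- (b + c - 1))"
          proof -
            have "k * (1 - b) = c" using abc by (simp add: k_def)
            then have "- k * (1 - b) = - c" "- (k - 1) * (1 - b) = - (b + c - 1)" by (simp_all add: algebra_simps)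
            then show ?thesis using d t by (simp add: powr_mult powr_powr)
          qed
          finally have e0: "t * (G y powr b * (d powr (- c) * t powr (- (b + c - 1)))) \<le> t * (G y + d powr (- k) * t powr (- (k - 1)))"
            using t by (intro mult_left_mono) auto
          have e1: "t * t powr (- (b + c - 1)) = t powr a"
          proof -
            have "t * t powr (- (b + c - 1)) = t powr (1 + (- (b + c - 1)))"
              using t by (subst powr_add) auto
            also have "1 + (- (b + c - 1)) = a" using abc by simp
            finally show ?thesis .
          qed
          have e2: "t * t powr (- (k - 1)) = t powr (2 - k)"
          proof -
            have "t * t powr (- (k - 1)) = t powr (1 + (- (k - 1)))"
              using t by (subst powr_add) auto
            also have "1 + (- (k - 1)) = 2 - k" by simp
            finally show ?thesis .
          qed
          have "t powr a * G y powr b * d powr (- c) = t * (G y powr b * (d powr (- c) * t powr (- (b + c - 1))))"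
            unfolding e1[symmetric] by (simp only: mult_ac)
          also note e0
          also have "t * (G y + d powr (- k) * t powr (- (k - 1))) = t * G y + t powr (2 - k) * d powr (- k)"
            unfolding e2[symmetric] by (simp only: distrib_left mult_ac)
          finally have "t powr a * G y powr b * d powr (- c) \<le> t * G y + t powr (2 - k) * d powr (- k)" .
          then have "t powr a * G y powr b * ?D x y powr (- c) \<le> ?r2 + ?r3"
            using d by (simp add: d_def)
          also have "\<dots> \<le> ?r1 + ?r2 + ?r3" using r(1) by linarith
          finally show ?thesis using le by (simp only: if_True)
        qed
      qed (use r in simp)
    qed
    have "(\<integral>\<^sup>+y. ennreal (if G y \<le> t then t powr a * G y powr b * ?D x y powr (- c) else 0) \<partial>lborel)
      \<le> (\<integral>\<^sup>+y. ennreal (t powr (a + b)) * (indicator {..1/t} (?D x y) * ennreal (?D x y powr (- c))) + ennreal t * ennreal (G y)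
        + ennreal (t powr (2 - k)) * (indicator {1/t..} (?D x y) * ennreal (?D x y powr (- k))) \<partial>lborel)"
    proof (rule nn_integral_mono)
      fix y
      have "ennreal (t powr (a + b)) * (indicator {..1/t} (?D x y) * ennreal (?D x y powr (- c))) + ennreal t * ennreal (G y)
        + ennreal (t powr (2 - k)) * (indicator {1/t..} (?D x y) * ennreal (?D x y powr (- k)))
        = ennreal (t powr (a + b) * (indicator {..1/t} (?D x y) * ?D x y powr (- c)) + t * G y
        + t powr (2 - k) * (indicator {1/t..} (?D x y) * ?D x y powr (- k)))"
        using t nonneg by (simp add: ennreal_mult ennreal_indicator ennreal_plus)
      then show "ennreal (if G y \<le> t then t powr a * G y powr b * ?D x y powr (- c) else 0)
        \<le> ennreal (t powr (a + b)) * (indicator {..1/t} (?D x y) * ennreal (?D x y powr (- c))) + ennreal t * ennreal (G y)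
        + ennreal (t powr (2 - k)) * (indicator {1/t..} (?D x y) * ennreal (?D x y powr (- k)))"
        using ennreal_leI[OF pt[of y]] by (simp only:)
    qed
    also have "\<dots> = ennreal (t powr (a + b)) * (\<integral>\<^sup>+y. indicator {..1/t} (?D x y) * ennreal (?D x y powr (- c)) \<partial>lborel)
        + ennreal t * (\<integral>\<^sup>+y. ennreal (G y) \<partial>lborel)
        + ennreal (t powr (2 - k)) * (\<integral>\<^sup>+y. indicator {1/t..} (?D x y) * ennreal (?D x y powr (- k)) \<partial>lborel)"
      by (simp add: nn_integral_add nn_integral_cmult)
    also have "(\<integral>\<^sup>+y. indicator {..1/t} (?D x y) * ennreal (?D x y powr (- c)) \<partial>lborel) = ennreal (pi * ((1/t) powr (1 - c) / (1 - c)))"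
      using t abc nn_integral_inner_power[of c "1/t"]
      by (subst nn_integral_reflect_translate[where h="\<lambda>z. indicator {..1/t} ((norm z)\<^sup>2) * ennreal ((norm z)\<^sup>2 powr (- c))"]) auto
    also have "(\<integral>\<^sup>+y. indicator {1/t..} (?D x y) * ennreal (?D x y powr (- k)) \<partial>lborel) = ennreal (pi * ((1/t) powr (1 - k) / (k - 1)))"
      using t k nn_integral_outer_power[of k "1/t"]
      by (subst nn_integral_reflect_translate[where h="\<lambda>z. indicator {1/t..} ((norm z)\<^sup>2) * ennreal ((norm z)\<^sup>2 powr (- k))"]) auto
    also have "ennreal (t powr (a + b)) * ennreal (pi * ((1/t) powr (1 - c) / (1 - c))) = ennreal (t * (pi / (1 - c)))"
    proof -
      have "(1/t) powr (1 - c) = t powr (- (1 - c))"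
        using t by (subst powr_minus_divide) (simp add: powr_divide)
      then have "t powr (a + b) * (1/t) powr (1 - c) = t powr (a + b + - (1 - c))"
        by (simp only: powr_add)
      also have "a + b + - (1 - c) = 1" using abc by simp
      finally have eq: "t powr (a + b) * (pi * ((1/t) powr (1 - c) / (1 - c))) = t * (pi / (1 - c))"
        using t by (simp add: field_simps)
      show ?thesis
        using abc by (subst ennreal_mult[symmetric]) (simp, simp, simp only: eq)
    qed
    also have "ennreal (t powr (2 - k)) * ennreal (pi * ((1/t) powr (1 - k) / (k - 1))) = ennreal (t * (pi / (k - 1)))"
    proof -
      have "(1/t) powr (1 - k) = t powr (- (1 - k))"
        using t by (subst powr_minus_divide) (simp add: powr_divide)
      then have "t powr (2 - k) * (1/t) powr (1 - k) = t powr (2 - k + - (1 - k))"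
        by (simp only: powr_add)
      also have "2 - k + - (1 - k) = 1" by simp
      finally have eq: "t powr (2 - k) * (pi * ((1/t) powr (1 - k) / (k - 1))) = t * (pi / (k - 1))"
        using t k by (simp add: field_simps)
      show ?thesis
        using k by (subst ennreal_mult[symmetric]) (simp, simp, simp only: eq)
    qed
    also have "ennreal t * (\<integral>\<^sup>+y. ennreal (G y) \<partial>lborel) \<le> ennreal t * ennreal B"
      using B by (intro mult_left_mono) auto
    finally have "(\<integral>\<^sup>+y. ennreal (if G y \<le> t then t powr a * G y powr b * ?D x y powr (- c) else 0) \<partial>lborel)
      \<le> ennreal (t * (pi / (1 - c))) + ennreal t * ennreal B + ennreal (t * (pi / (k - 1)))"
      by (simp add: add_mono)
    also have "\<dots> = ennreal (t * (pi / (1 - c)) + t * B + t * (pi / (k - 1)))"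
      using t B abc k by (simp add: ennreal_plus ennreal_mult[of t B])
    also have "\<dots> = ennreal (t * (pi / (1 - c) + B + pi / (k - 1)))"
      by (simp only: distrib_left)
    also have "\<dots> = ennreal t * ennreal (pi / (1 - c) + B + pi / (k - 1))"
      using t B abc k by (intro ennreal_mult) auto
    finally show ?thesis by (simp only: t_def)
  qed
  have "(\<integral>\<^sup>+x. \<integral>\<^sup>+y. ennreal (if G y \<le> F x then F x powr a * G y powr b * ?D x y powr (- c) else 0) \<partial>lborel \<partial>lborel)
    \<le> (\<integral>\<^sup>+x. ennreal (F x) * ennreal (pi / (1 - c) + B + pi / (k - 1)) \<partial>lborel)"
    by (intro nn_integral_mono inner)
  also have "\<dots> = (\<integral>\<^sup>+x. ennreal (F x) \<partial>lborel) * ennreal (pi / (1 - c) + B + pi / (k - 1))"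
    by (simp add: nn_integral_multc)
  also have "\<dots> \<le> ennreal A * ennreal (pi / (1 - c) + B + pi / (k - 1))"
    using A by (intro mult_right_mono) auto
  also have "\<dots> = ennreal (A * (pi / (1 - c) + B + pi / (k - 1)))"
    using A B abc k by (intro ennreal_mult[symmetric]) (auto intro!: add_nonneg_nonneg)
  finally show ?thesis by (simp add: k_def)
qed

text \<open>A Hardy-Littlewood-Sobolev inequality for F^a, G^b and the kernel |x - y|^(-2 c), with a
  bound that is not homogeneous in A and B. The pairs (x, y) are split according to which of F x and
  G y is larger; Fubini exchanges the roles in the second half.\<close>

lemma hls:
  fixes F G :: "real^2 \<Rightarrow> real"
  assumes [measurable]: "F \<in> borel_measurable borel" "G \<in> borel_measurable borel"
    and nonneg: "\<And>x. 0 \<le> F x" "\<And>x. 0 \<le> G x"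
    and abc: "0 < a" "a < 1" "0 < b" "b < 1" "0 < c" "c < 1" "a + b + c = 2"
    and A: "0 \<le> A" "(\<integral>\<^sup>+x. ennreal (F x) \<partial>lborel) \<le> ennreal A"
    and B: "0 \<le> B" "(\<integral>\<^sup>+x. ennreal (G x) \<partial>lborel) \<le> ennreal B"
  shows "(\<integral>\<^sup>+x. \<integral>\<^sup>+y. ennreal (F x powr a * G y powr b * (norm (x - y))\<^sup>2 powr (- c)) \<partial>lborel \<partial>lborel)
    \<le> ennreal (A * (pi / (1 - c) + B + pi / (c / (1 - b) - 1)) + B * (pi / (1 - c) + A + pi / (c / (1 - a) - 1)))"
proof -
  let ?h1 = "\<lambda>x y. if G y \<le> F x then F x powr a * G y powr b * (norm (x - y))\<^sup>2 powr (- c) else 0"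
  let ?h2 = "\<lambda>y x. if F x \<le> G y then G y powr b * F x powr a * (norm (y - x))\<^sup>2 powr (- c) else 0"
  have "(\<integral>\<^sup>+x. \<integral>\<^sup>+y. ennreal (F x powr a * G y powr b * (norm (x - y))\<^sup>2 powr (- c)) \<partial>lborel \<partial>lborel)
     \<le> (\<integral>\<^sup>+x. \<integral>\<^sup>+y. ennreal (?h1 x y) + ennreal (?h2 y x) \<partial>lborel \<partial>lborel)"
    by (intro nn_integral_mono) (auto simp: norm_minus_commute mult.commute)
  also have "\<dots> = (\<integral>\<^sup>+x. \<integral>\<^sup>+y. ennreal (?h1 x y) \<partial>lborel \<partial>lborel) + (\<integral>\<^sup>+x. \<integral>\<^sup>+y. ennreal (?h2 y x) \<partial>lborel \<partial>lborel)"
    by (simp add: nn_integral_add)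
  also have "(\<integral>\<^sup>+x. \<integral>\<^sup>+y. ennreal (?h2 y x) \<partial>lborel \<partial>lborel) = (\<integral>\<^sup>+y. \<integral>\<^sup>+x. ennreal (?h2 y x) \<partial>lborel \<partial>lborel)"
    by (rule lborel_pair.Fubini') measurable
  also have "(\<integral>\<^sup>+x. \<integral>\<^sup>+y. ennreal (?h1 x y) \<partial>lborel \<partial>lborel) + (\<integral>\<^sup>+y. \<integral>\<^sup>+x. ennreal (?h2 y x) \<partial>lborel \<partial>lborel)
    \<le> ennreal (A * (pi / (1 - c) + B + pi / (c / (1 - b) - 1))) + ennreal (B * (pi / (1 - c) + A + pi / (c / (1 - a) - 1)))"
    using assms by (intro add_mono hls_half) auto
  also have "\<dots> = ennreal (A * (pi / (1 - c) + B + pi / (c / (1 - b) - 1)) + B * (pi / (1 - c) + A + pi / (c / (1 - a) - 1)))"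
    using A B abc by (intro ennreal_plus[symmetric] mult_nonneg_nonneg add_nonneg_nonneg) auto
  finally show ?thesis .
qed

section \<open>Uniform estimates for the Hartree equation\<close>

text \<open>Outside the locale the mean depends on u alone and the potential on f alone, so both can
  be used in statements that quantify over all solutions.\<close>

abbreviation mean :: "(real^2 \<Rightarrow> real) \<Rightarrow> real \<Rightarrow> real^2 \<Rightarrow> real" where
  "mean \<equiv> weak_solution.avg"

abbreviation log_pot :: "(real^2 \<Rightarrow> real) \<Rightarrow> real \<Rightarrow> real^2 \<Rightarrow> ennreal" where
  "log_pot \<equiv> weak_solution.pot"

text \<open>The exponents correspond to those of the theorem by \<open>a0 = 1 / p\<close> and \<open>b = 1 / q\<close>;
  \<open>X\<close> stands for \<open>V\<^sup>p\<close> (or for \<open>1\<close> if \<open>p = \<infinity>\<close>) and \<open>G\<close> for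
  \<open>exp (lam q u)\<close>, so that \<open>V \<le> c0 X\<^sup>a\<^sup>0\<close> and \<open>exp (lam u) = G\<^sup>b\<close>.\<close>

locale hartree =
  fixes \<omega> :: "(real^2) set" and \<mu> a0 c0 CX CG :: real
  assumes open_omega: "open \<omega>"
    and mu: "0 < \<mu>" "\<mu> < 2" and a0: "0 \<le> a0" "a0 < \<mu> / 2"
    and c0: "0 \<le> c0" and CX: "0 \<le> CX" and CG: "0 \<le> CG"
begin

definition "lam = 1 - \<mu> / 4"
definition "b = lam - a0 / 2"
definition "beta = b / lam"

abbreviation rk :: "real^2 \<Rightarrow> real" where
  "rk z \<equiv> (norm z)\<^sup>2 powr (- (\<mu> / 2))"

text \<open>The identity with sum 2 is the exact balance required by the Hardy-Littlewood-Sobolev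
  bound. Both a0 + b < 1 and 1 - mu / 2 < b are forms of a0 < mu / 2, that is, of p > 2 /
  mu.\<close>

lemma exponents: "1 / 2 < lam" "0 < b" "b < 1" "1 - \<mu> / 2 < b" "0 < a0 + b" "a0 + b < 1"
  "(a0 + b) + b + \<mu> / 2 = 2" "0 < beta" "b = lam * beta"
  using mu a0 by (auto simp: lam_def b_def beta_def)

text \<open>The class over which all constants are uniform: they may depend on the locale parameters
  and on the disc at hand, but not on u, f, X or G. The equation for f is relaxed to an upper bound,
  which is all that the estimates use besides the weak formulation.\<close>

definition sol :: "(real^2 \<Rightarrow> real) \<Rightarrow> (real^2 \<Rightarrow> real) \<Rightarrow> (real^2 \<Rightarrow> real) \<Rightarrow> (real^2 \<Rightarrow> real) \<Rightarrow> bool" where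
  "sol u f X G \<longleftrightarrow> weak_solution \<omega> u f \<and> X \<in> borel_measurable borel \<and> G \<in> borel_measurable borel \<and>
     (\<forall>x. 0 \<le> X x) \<and> (\<forall>x. 0 \<le> G x) \<and>
     (\<integral>\<^sup>+x. ennreal (X x) \<partial>lborel) \<le> ennreal CX \<and> (\<integral>\<^sup>+x. ennreal (G x) \<partial>lborel) \<le> ennreal CG \<and>
     (AE x in lborel. x \<in> \<omega> \<longrightarrow> G x = exp (u x / beta)) \<and> (\<forall>x. x \<notin> \<omega> \<longrightarrow> f x = 0) \<and>
     (AE x in lborel. x \<in> \<omega> \<longrightarrow> ennreal (f x)
        \<le> ennreal (c0 * X x powr a0 * G x powr b) * (\<integral>\<^sup>+y. ennreal (G y powr b * rk (x - y)) \<partial>lborel))"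

lemma solD:
  assumes "sol u f X G"
  shows "weak_solution \<omega> u f" "X \<in> borel_measurable borel" "G \<in> borel_measurable borel"
    "u \<in> borel_measurable borel" "f \<in> borel_measurable borel"
    "0 \<le> X x" "0 \<le> G x" "0 \<le> f x"
    "(\<integral>\<^sup>+x. ennreal (X x) \<partial>lborel) \<le> ennreal CX" "(\<integral>\<^sup>+x. ennreal (G x) \<partial>lborel) \<le> ennreal CG"
    "AE x in lborel. x \<in> \<omega> \<longrightarrow> G x = exp (u x / beta)" "x \<notin> \<omega> \<Longrightarrow> f x = 0"
    "AE x in lborel. x \<in> \<omega> \<longrightarrow> ennreal (f x)
        \<le> ennreal (c0 * X x powr a0 * G x powr b) * (\<integral>\<^sup>+y. ennreal (G y powr b * rk (x - y)) \<partial>lborel)"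
  using assms by (auto simp: sol_def weak_solution_def)

text \<open>The product X^a0 G^b is absorbed into (X + G)^(a0 + b); what remains is the double
  integral of two powers and the kernel. The statement does not presuppose \<open>sol\<close>, since
  it also serves to establish that f is integrable.\<close>

lemma mass_bound_ae:
  assumes [measurable]: "X \<in> borel_measurable borel" "G \<in> borel_measurable borel" "f \<in> borel_measurable borel"
    and nonneg: "\<And>x. 0 \<le> X x" "\<And>x. 0 \<le> G x"
    and X: "(\<integral>\<^sup>+x. ennreal (X x) \<partial>lborel) \<le> ennreal CX" and G: "(\<integral>\<^sup>+x. ennreal (G x) \<partial>lborel) \<le> ennreal CG"
    and f0: "\<And>x. x \<notin> \<omega> \<Longrightarrow> f x = 0"
    and f: "AE x in lborel. x \<in> \<omega> \<longrightarrow> ennreal (f x)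
        \<le> ennreal (c0 * X x powr a0 * G x powr b) * (\<integral>\<^sup>+y. ennreal (G y powr b * rk (x - y)) \<partial>lborel)"
  shows "(\<integral>\<^sup>+x. ennreal (f x) \<partial>lborel) \<le> ennreal (c0 * ((CX + CG) * (pi / (1 - \<mu> / 2) + CG + pi / (\<mu> / 2 / (1 - b) - 1)) + CG * (pi / (1 - \<mu> / 2) + (CX + CG) + pi / (\<mu> / 2 / (1 - (a0 + b)) - 1))))"
    (is "_ \<le> ennreal (c0 * ?C)")
proof -
  have "(\<integral>\<^sup>+x. ennreal (f x) \<partial>lborel) \<le>
    (\<integral>\<^sup>+x. ennreal c0 * (\<integral>\<^sup>+y. ennreal ((X x + G x) powr (a0 + b) * G y powr b * (norm (x - y))\<^sup>2 powr (- (\<mu> / 2))) \<partial>lborel) \<partial>lborel)"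
  proof (rule nn_integral_mono_AE, use f in eventually_elim)
    case (elim x)
    show ?case
    proof (cases "x \<in> \<omega>")
      case True
      have "X x powr a0 * G x powr b \<le> (X x + G x) powr (a0 + b)"
        using nonneg a0 exponents by (intro powr_mult_le_sum_powr) auto
      then have "ennreal (c0 * X x powr a0 * G x powr b) \<le> ennreal (c0 * (X x + G x) powr (a0 + b))"
        using c0 by (intro ennreal_leI) (simp add: mult_left_mono mult.assoc)
      then have "ennreal (f x) \<le> ennreal (c0 * (X x + G x) powr (a0 + b)) * (\<integral>\<^sup>+y. ennreal (G y powr b * rk (x - y)) \<partial>lborel)"
        using elim True by (meson order_trans mult_right_mono zero_le)
      also have "\<dots> = ennreal c0 * (\<integral>\<^sup>+y. ennreal ((X x + G x) powr (a0 + b)) * ennreal (G y powr b * rk (x - y)) \<partial>lborel)"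
        using c0 by (simp add: nn_integral_cmult ennreal_mult mult.assoc)
      finally show ?thesis by (simp add: mult.assoc flip: ennreal_mult)
    qed (simp add: f0)
  qed
  also have "\<dots> = ennreal c0 * (\<integral>\<^sup>+x. \<integral>\<^sup>+y. ennreal ((X x + G x) powr (a0 + b) * G y powr b * (norm (x - y))\<^sup>2 powr (- (\<mu> / 2))) \<partial>lborel \<partial>lborel)"
    by (simp add: nn_integral_cmult)
  also have "\<dots> \<le> ennreal c0 * ennreal ?C"
  proof (intro mult_left_mono hls)
    show "(\<integral>\<^sup>+x. ennreal (X x + G x) \<partial>lborel) \<le> ennreal (CX + CG)"
      using X G CX CG nonneg by (simp add: ennreal_plus nn_integral_add add_mono)
  qed (use nonneg exponents mu CX CG G in auto)
  also have "\<dots> = ennreal (c0 * ?C)"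
  proof (rule ennreal_mult[symmetric])
    have "1 < \<mu> / 2 / (1 - b)" "1 < \<mu> / 2 / (1 - (a0 + b))"
      using exponents mu a0 by (auto simp: field_simps)
    then show "0 \<le> ?C" using CX CG mu by (intro add_nonneg_nonneg mult_nonneg_nonneg) auto
  qed (rule c0)
  finally show ?thesis .
qed

text \<open>With k = (mu / 2) / (1 - b) > 1 one has G^b |x - y|^(-mu) <= G + |x - y|^(-2 k), and
  both terms are integrable beyond distance T. Values of G far from x, also those outside omega,
  thus cost only a constant.\<close>

lemma far_bound:
  assumes "0 < T"
  obtains C where "0 \<le> C" "\<And>G x. G \<in> borel_measurable borel \<Longrightarrow> (\<And>y. 0 \<le> G y) \<Longrightarrow>
     (\<integral>\<^sup>+y. ennreal (G y) \<partial>lborel) \<le> ennreal CG \<Longrightarrow>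
     (\<integral>\<^sup>+y. ennreal (G y powr b * rk (x - y)) \<partial>lborel) \<le>
       (\<integral>\<^sup>+y. indicator {..T\<^sup>2} ((norm (x - y))\<^sup>2) * ennreal (G y powr b * rk (x - y)) \<partial>lborel) + ennreal C"
proof -
  define k where "k = \<mu> / 2 / (1 - b)"
  have k: "1 < k" using exponents by (simp add: k_def)
  have kb: "- k * (1 - b) = - (\<mu> / 2)" using exponents(3) unfolding k_def by (simp add: divide_simps algebra_simps)
  define C where "C = CG + pi * (T\<^sup>2 powr (1 - k) / (k - 1))"
  show ?thesis
  proof
    show "0 \<le> C" using CG k by (simp add: C_def)
    fix G :: "real^2 \<Rightarrow> real" and x
    assume [measurable]: "G \<in> borel_measurable borel" and G: "\<And>y. 0 \<le> G y" "(\<integral>\<^sup>+y. ennreal (G y) \<partial>lborel) \<le> ennreal CG"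
    have "(\<integral>\<^sup>+y. ennreal (G y powr b * rk (x - y)) \<partial>lborel) \<le>
       (\<integral>\<^sup>+y. indicator {..T\<^sup>2} ((norm (x - y))\<^sup>2) * ennreal (G y powr b * rk (x - y)) +
         (ennreal (G y) + indicator {T\<^sup>2..} ((norm (x - y))\<^sup>2) * ennreal ((norm (x - y))\<^sup>2 powr (- k))) \<partial>lborel)"
    proof (rule nn_integral_mono)
      fix y
      show "ennreal (G y powr b * rk (x - y)) \<le> indicator {..T\<^sup>2} ((norm (x - y))\<^sup>2) * ennreal (G y powr b * rk (x - y)) +
         (ennreal (G y) + indicator {T\<^sup>2..} ((norm (x - y))\<^sup>2) * ennreal ((norm (x - y))\<^sup>2 powr (- k)))"
      proof (cases "(norm (x - y))\<^sup>2 \<le> T\<^sup>2")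
        case False
        have "G y powr b * ((norm (x - y))\<^sup>2 powr (- k)) powr (1 - b) \<le> G y + (norm (x - y))\<^sup>2 powr (- k)"
          using G exponents by (intro powr_mult_le_sum) auto
        then have "ennreal (G y powr b * rk (x - y)) \<le> ennreal (G y + (norm (x - y))\<^sup>2 powr (- k))"
          unfolding powr_powr kb by (rule ennreal_leI)
        then show ?thesis using False G by (simp add: ennreal_plus)
      qed simp
    qed
    also have "\<dots> = (\<integral>\<^sup>+y. indicator {..T\<^sup>2} ((norm (x - y))\<^sup>2) * ennreal (G y powr b * rk (x - y)) \<partial>lborel)
       + ((\<integral>\<^sup>+y. ennreal (G y) \<partial>lborel) + (\<integral>\<^sup>+y. indicator {T\<^sup>2..} ((norm (x - y))\<^sup>2) * ennreal ((norm (x - y))\<^sup>2 powr (- k)) \<partial>lborel))"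
      by (simp add: nn_integral_add)
    also have "(\<integral>\<^sup>+y. indicator {T\<^sup>2..} ((norm (x - y))\<^sup>2) * ennreal ((norm (x - y))\<^sup>2 powr (- k)) \<partial>lborel) = ennreal (pi * (T\<^sup>2 powr (1 - k) / (k - 1)))"
      using k assms nn_integral_outer_power[of k "T\<^sup>2"]
      by (subst nn_integral_reflect_translate[where h="\<lambda>z. indicator {T\<^sup>2..} ((norm z)\<^sup>2) * ennreal ((norm z)\<^sup>2 powr (- k))"]) auto
    also have "(\<integral>\<^sup>+y. ennreal (G y) \<partial>lborel) + ennreal (pi * (T\<^sup>2 powr (1 - k) / (k - 1))) \<le> ennreal C"
      unfolding C_def using G CG k by (subst ennreal_plus) (auto intro!: add_mono)
    finally show "(\<integral>\<^sup>+y. ennreal (G y powr b * rk (x - y)) \<partial>lborel) \<le>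
       (\<integral>\<^sup>+y. indicator {..T\<^sup>2} ((norm (x - y))\<^sup>2) * ennreal (G y powr b * rk (x - y)) \<partial>lborel) + ennreal C"
      by (simp add: add_left_mono)
  qed
qed

text \<open>From t <= exp t follows u <= beta G, so the bound on the integral of G controls every
  mean from above.\<close>

lemma mean_le:
  assumes "0 < r"
  obtains C where "0 \<le> C" "\<And>u f X G x. sol u f X G \<Longrightarrow> cball x r \<subseteq> \<omega> \<Longrightarrow> mean u r x \<le> C"
proof -
  obtain B where B: "0 < B" "\<And>r z. 0 < r \<Longrightarrow> mollifier r z \<le> B / r\<^sup>2" using mollifier_bounds by metis
  show ?thesis
  proof
    show "0 \<le> beta * (B / r\<^sup>2) * CG" using B CG exponents by simp
    fix u f X G x assume sol: "sol u f X G" and x: "cball x r \<subseteq> \<omega>"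
    interpret weak_solution \<omega> u f using solD(1)[OF sol] .
    note [measurable] = solD(2,3)[OF sol]
    have G: "integrable lborel G" "(LINT y|lborel. G y) \<le> CG"
    proof -
      show "integrable lborel G"
        using solD(7,10)[OF sol] by (intro integrableI_nonneg) (auto intro: le_less_trans)
      have "(LINT y|lborel. G y) = enn2real (\<integral>\<^sup>+y. ennreal (G y) \<partial>lborel)"
        using solD(7)[OF sol] by (intro integral_eq_nn_integral) auto
      also have "\<dots> \<le> CG" using solD(10)[OF sol] CG by (simp add: enn2real_leI)
      finally show "(LINT y|lborel. G y) \<le> CG" .
    qed
    have "mean u r x \<le> (LINT y|lborel. beta * (B / r\<^sup>2) * G y)"
      unfolding avg_def
    proof (rule integral_mono_AE)
      show "integrable lborel (\<lambda>y. u y * mollifier r (y - x))" using assms x by (rule integrable_u_mollifier)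
      show "integrable lborel (\<lambda>y. beta * (B / r\<^sup>2) * G y)" using G by simp
      show "AE y in lborel. u y * mollifier r (y - x) \<le> beta * (B / r\<^sup>2) * G y"
        using solD(11)[OF sol]
      proof eventually_elim
        case (elim y)
        show ?case
        proof (cases "y \<in> cball x r")
          case True
          then have Gy: "G y = exp (u y / beta)" using elim x by auto
          have "u y / beta \<le> G y" using exp_ge_add_one_self[of "u y / beta"] Gy by linarith
          then have "u y \<le> beta * G y" using exponents by (simp add: field_simps)
          then have "u y * mollifier r (y - x) \<le> (beta * G y) * mollifier r (y - x)"
            by (intro mult_right_mono mollifier_nonneg)
          also have "\<dots> \<le> (beta * G y) * (B / r\<^sup>2)"
            using exponents Gy by (intro mult_left_mono B assms) auto
          finally show ?thesis by (simp add: mult_ac)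
        next
          case False
          then have "mollifier r (y - x) = 0"
            using assms by (intro mollifier_eq_0) (auto simp: dist_norm norm_minus_commute)
          then show ?thesis using B exponents solD(7)[OF sol] by simp
        qed
      qed
    qed
    also have "\<dots> \<le> beta * (B / r\<^sup>2) * CG"
      using G B exponents by (simp add: mult_left_mono divide_right_mono)
    finally show "mean u r x \<le> beta * (B / r\<^sup>2) * CG" .
  qed
qed

text \<open>Jensen's inequality for the subprobability density \<open>f / m\<close>.\<close>

lemma exp_integral_le:
  fixes f K :: "real^2 \<Rightarrow> real"
  assumes [measurable]: "f \<in> borel_measurable borel" "K \<in> borel_measurable borel"
    and nonneg: "\<And>y. 0 \<le> f y" and m: "0 < m" "(\<integral>\<^sup>+y. ennreal (f y) \<partial>lborel) \<le> ennreal m"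
    and int: "integrable lborel (\<lambda>y. f y * K y)"
  shows "ennreal (exp (LINT y|lborel. f y * K y)) \<le> 1 + (\<integral>\<^sup>+y. ennreal (f y / m * exp (m * K y)) \<partial>lborel)"
proof (cases "(\<integral>\<^sup>+y. ennreal (f y / m * exp (m * K y)) \<partial>lborel) < \<infinity>")
  case False
  then show ?thesis by (simp add: not_less top.extremum_unique)
next
  case True
  have f: "integrable lborel f"
    using m nonneg by (intro integrableI_nonneg) (auto intro: le_less_trans)
  have fm: "(LINT y|lborel. f y) \<le> m"
    using m nonneg by (simp add: integral_eq_nn_integral enn2real_leI)
  have e: "integrable lborel (\<lambda>y. f y / m * exp (m * K y))"
    using True m nonneg by (intro integrableI_nonneg) auto
  define t where "t = (LINT y|lborel. f y * K y)"
  define s where "s = (LINT y|lborel. f y) / m"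
  have s: "s \<le> 1" using fm m by (simp add: s_def)
  \<comment> \<open>The tangent line of exp at t lies below exp; it is integrated against f /
    m.\<close>
  have "(LINT y|lborel. exp t * ((1 - t) * (f y / m) + f y * K y)) \<le> (LINT y|lborel. f y / m * exp (m * K y))"
  proof (rule integral_mono)
    show "integrable lborel (\<lambda>y. exp t * ((1 - t) * (f y / m) + f y * K y))" using f int by auto
    show "integrable lborel (\<lambda>y. f y / m * exp (m * K y))" by (rule e)
    fix y
    have "exp t * (1 + (m * K y - t)) \<le> exp t * exp (m * K y - t)"
      by (intro mult_left_mono exp_ge_add_one_self) auto
    also have "\<dots> = exp (m * K y)" by (simp flip: exp_add)
    finally have "f y / m * (exp t * (1 + (m * K y - t))) \<le> f y / m * exp (m * K y)"
      using nonneg m by (intro mult_left_mono) auto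
    moreover have "f y / m * (exp t * (1 + (m * K y - t))) = exp t * ((1 - t) * (f y / m) + f y * K y)"
      using m by (simp add: field_simps)
    ultimately show "exp t * ((1 - t) * (f y / m) + f y * K y) \<le> f y / m * exp (m * K y)" by simp
  qed
  moreover have "(LINT y|lborel. exp t * ((1 - t) * (f y / m) + f y * K y)) = exp t * ((1 - t) * s + t)"
    using f int by (simp add: s_def t_def)
  ultimately have 1: "exp t * ((1 - t) * s + t) \<le> (LINT y|lborel. f y / m * exp (m * K y))" by simp
  \<comment> \<open>f / m may have total mass s < 1. The missing share is estimated by exp t (1 - t)
    <= 1 and is the origin of the summand 1 in the claim.\<close>
  have 2: "(1 - s) * (exp t * (1 - t)) \<le> (1 - s) * 1"
  proof (rule mult_left_mono)
    have "exp t * (1 - t) \<le> exp t * exp (- t)"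
      using exp_ge_add_one_self[of "- t"] by (intro mult_left_mono) auto
    then show "exp t * (1 - t) \<le> 1" by (simp flip: exp_add)
  qed (use s in simp)
  have "0 \<le> s" using nonneg m by (simp add: s_def)
  moreover have "exp t = exp t * ((1 - t) * s + t) + (1 - s) * (exp t * (1 - t))" by (simp add: algebra_simps)
  ultimately have "exp t \<le> 1 + (LINT y|lborel. f y / m * exp (m * K y))"
    using add_mono[OF 1 2] by simp
  then have "ennreal (exp t) \<le> ennreal (1 + (LINT y|lborel. f y / m * exp (m * K y)))" by (rule ennreal_leI)
  also have "\<dots> = 1 + ennreal (LINT y|lborel. f y / m * exp (m * K y))"
    using m nonneg by (subst ennreal_plus) (auto intro!: integral_nonneg_AE)
  also have "ennreal (LINT y|lborel. f y / m * exp (m * K y)) = (\<integral>\<^sup>+y. ennreal (f y / m * exp (m * K y)) \<partial>lborel)"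
    using m nonneg by (intro nn_integral_eq_integral[symmetric] e) auto
  finally show ?thesis by (simp add: t_def)
qed

text \<open>An inequality of Brezis-Merle type. The mass bound leaves room for \<sigma> strictly
  between 1 / beta and 4 pi / M; Jensen's inequality then produces the kernel exp (4 pi k
  log_kernel) with k = \<sigma> M / (4 pi) < 1, which is integrable.\<close>

lemma exp_estimate:
  assumes R: "0 < R" and sub: "cball x0 (2 * R) \<subseteq> \<omega>" and M: "0 < M" "M < 4 * pi * beta"
  obtains \<sigma> C where "1 / beta < \<sigma>" "0 \<le> C"
    "\<And>u f X G. sol u f X G \<Longrightarrow> (\<integral>\<^sup>+y. indicator (ball x0 (2 * R)) y * ennreal (f y) \<partial>lborel) \<le> ennreal M \<Longrightarrow>
      (\<integral>\<^sup>+x. indicator (ball x0 R) x * ennreal (exp (\<sigma> * u x)) \<partial>lborel) \<le> ennreal C"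
proof -
  have "1 / beta < 4 * pi / M" using M exponents by (simp add: field_simps)
  then obtain \<sigma> where \<sigma>: "1 / beta < \<sigma>" "\<sigma> < 4 * pi / M" using dense by blast
  moreover have "0 < 1 / beta" using exponents by simp
  ultimately have "0 < \<sigma>" by linarith
  note \<sigma> = \<sigma> this
  define k where "k = \<sigma> * M / (4 * pi)"
  have k: "0 < k" "k < 1" using \<sigma> M by (auto simp: k_def field_simps)
  have sMk: "\<sigma> * M = 4 * pi * k" by (simp add: k_def)
  obtain C1 where C1: "0 \<le> C1" "\<And>u f X G x. sol u f X G \<Longrightarrow> cball x R \<subseteq> \<omega> \<Longrightarrow> mean u R x \<le> C1"
    using mean_le[OF R] by metis
  \<comment> \<open>9 R^2 = (3 R)^2 bounds |y - x|^2 for y in the disc of radius 2 R and x in the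
    disc of radius R.\<close>
  define C2 where "C2 = (9 * R\<^sup>2 + 2 * R\<^sup>2) powr k * (pi * ((9 * R\<^sup>2) powr (1 - k) / (1 - k)))"
  have C2: "0 \<le> C2" using k by (simp add: C2_def)
  define C where "C = exp (\<sigma> * C1) * (measure lborel (ball x0 R) + C2)"
  have "(\<integral>\<^sup>+x. indicator (ball x0 R) x * ennreal (exp (\<sigma> * u x)) \<partial>lborel) \<le> ennreal C"
    if sol: "sol u f X G" and mass: "(\<integral>\<^sup>+y. indicator (ball x0 (2 * R)) y * ennreal (f y) \<partial>lborel) \<le> ennreal M"
    for u f X G
  proof -
    interpret weak_solution \<omega> u f using solD(1)[OF sol] .
    note [measurable] = u_meas f_meas
    \<comment> \<open>For x in the disc of radius R the kernel of radius R sees f only inside the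
      disc of radius 2 R, so the local mass is the one that enters Jensen's inequality.\<close>
    define g where "g y = indicator (ball x0 (2 * R)) y * f y" for y
    have [measurable]: "ball x0 (2 * R) \<in> sets borel" "ball x0 R \<in> sets borel" by simp_all
    have [measurable]: "g \<in> borel_measurable borel" unfolding g_def [abs_def] by measurable
    have g0: "0 \<le> g y" for y by (simp add: g_def f_nonneg)
    have gM: "(\<integral>\<^sup>+y. ennreal (g y) \<partial>lborel) \<le> ennreal M"
      using mass f_nonneg by (simp add: g_def ennreal_mult ennreal_indicator)
    have ae: "AE x in lborel. indicator (ball x0 R) x * ennreal (exp (\<sigma> * u x))
      \<le> ennreal (exp (\<sigma> * C1)) * (indicator (ball x0 R) x * (1 + (\<integral>\<^sup>+y. ennreal (g y / M * exp (4 * pi * k * log_kernel R (y - x))) \<partial>lborel)))"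
      using AE_representation[OF R]
    proof eventually_elim
      case (elim x)
      show ?case
      proof (cases "x \<in> ball x0 R")
        case True
        have "cball x R \<subseteq> cball x0 (2 * R)"
        proof
          fix y assume "y \<in> cball x R"
          then show "y \<in> cball x0 (2 * R)" using True dist_triangle[of x0 y x] by simp
        qed
        then have sub1: "cball x R \<subseteq> \<omega>" using sub by blast
        have fg: "f y * log_kernel R (y - x) = g y * log_kernel R (y - x)" for y
        proof (cases "y \<in> ball x0 (2 * R)")
          case False
          then have "R \<le> norm (y - x)"
            using True dist_triangle[of x0 y x] by (simp add: dist_norm norm_minus_commute)
          then show ?thesis using R by (simp add: log_kernel_eq_0)
        qed (simp add: g_def)
        have fin: "pot R x < \<infinity>" and ux: "u x = avg R x + enn2real (pot R x)"
          using elim sub1 by auto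
        have int: "integrable lborel (\<lambda>y. g y * log_kernel R (y - x))"
          using integrable_f_log_kernel[OF R fin] by (simp only: fg)
        have "exp (\<sigma> * u x) = exp (\<sigma> * avg R x) * exp (\<sigma> * enn2real (pot R x))"
          unfolding ux by (simp add: distrib_left exp_add)
        also have "\<dots> \<le> exp (\<sigma> * C1) * exp (\<sigma> * enn2real (pot R x))"
          using C1(2)[OF sol sub1] \<sigma> by (intro mult_right_mono) auto
        finally have "ennreal (exp (\<sigma> * u x)) \<le> ennreal (exp (\<sigma> * C1)) * ennreal (exp (\<sigma> * enn2real (pot R x)))"
          by (simp flip: ennreal_mult)
        also have "\<sigma> * enn2real (pot R x) = (LINT y|lborel. g y * (\<sigma> * log_kernel R (y - x)))"
          unfolding pot_eq_integral[OF R] fg by (subst integral_mult_right_zero[symmetric]) (simp add: mult_ac)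
        also have "ennreal (exp \<dots>) \<le> 1 + (\<integral>\<^sup>+y. ennreal (g y / M * exp (M * (\<sigma> * log_kernel R (y - x)))) \<partial>lborel)"
        proof (rule exp_integral_le)
          show "integrable lborel (\<lambda>y. g y * (\<sigma> * log_kernel R (y - x)))"
            using integrable_mult_right[OF int, of \<sigma>] by (simp add: mult_ac)
        qed (use g0 gM M in auto)
        also have "(\<lambda>y. ennreal (g y / M * exp (M * (\<sigma> * log_kernel R (y - x))))) = (\<lambda>y. ennreal (g y / M * exp (4 * pi * k * log_kernel R (y - x))))"
          unfolding sMk[symmetric] by (simp add: mult_ac)
        finally show ?thesis using True by (simp add: mult_left_mono)
      qed simp
    qed
    have "(\<integral>\<^sup>+x. indicator (ball x0 R) x * ennreal (exp (\<sigma> * u x)) \<partial>lborel)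
      \<le> (\<integral>\<^sup>+x. ennreal (exp (\<sigma> * C1)) * (indicator (ball x0 R) x * (1 + (\<integral>\<^sup>+y. ennreal (g y / M * exp (4 * pi * k * log_kernel R (y - x))) \<partial>lborel))) \<partial>lborel)"
      by (rule nn_integral_mono_AE[OF ae])
    also have "\<dots> = ennreal (exp (\<sigma> * C1)) * (emeasure lborel (ball x0 R)
        + (\<integral>\<^sup>+x. \<integral>\<^sup>+y. indicator (ball x0 R) x * ennreal (g y / M * exp (4 * pi * k * log_kernel R (y - x))) \<partial>lborel \<partial>lborel))"
      by (simp add: nn_integral_cmult nn_integral_add distrib_left)
    also have "(\<integral>\<^sup>+x. \<integral>\<^sup>+y. indicator (ball x0 R) x * ennreal (g y / M * exp (4 * pi * k * log_kernel R (y - x))) \<partial>lborel \<partial>lborel)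
       = (\<integral>\<^sup>+y. \<integral>\<^sup>+x. indicator (ball x0 R) x * ennreal (g y / M * exp (4 * pi * k * log_kernel R (y - x))) \<partial>lborel \<partial>lborel)"
      by (rule lborel_pair.Fubini') measurable
    also have "\<dots> \<le> (\<integral>\<^sup>+y. ennreal (g y / M) * ennreal C2 \<partial>lborel)"
    proof (rule nn_integral_mono)
      fix y
      show "(\<integral>\<^sup>+x. indicator (ball x0 R) x * ennreal (g y / M * exp (4 * pi * k * log_kernel R (y - x))) \<partial>lborel) \<le> ennreal (g y / M) * ennreal C2"
      proof (cases "y \<in> ball x0 (2 * R)")
        case True
        have "(\<integral>\<^sup>+x. indicator (ball x0 R) x * ennreal (g y / M * exp (4 * pi * k * log_kernel R (y - x))) \<partial>lborel)
          \<le> (\<integral>\<^sup>+x. ennreal (g y / M) * (indicator {..9 * R\<^sup>2} ((norm (y - x))\<^sup>2) * ennreal (exp (4 * pi * k * log_kernel R (y - x)))) \<partial>lborel)"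
        proof (rule nn_integral_mono)
          fix x
          show "indicator (ball x0 R) x * ennreal (g y / M * exp (4 * pi * k * log_kernel R (y - x)))
            \<le> ennreal (g y / M) * (indicator {..9 * R\<^sup>2} ((norm (y - x))\<^sup>2) * ennreal (exp (4 * pi * k * log_kernel R (y - x))))"
          proof (cases "x \<in> ball x0 R")
            case x: True
            have "norm (y - x) \<le> 3 * R"
              using True x dist_triangle[of y x x0] by (simp add: dist_norm norm_minus_commute)
            then have "(norm (y - x))\<^sup>2 \<le> (3 * R)\<^sup>2" by (intro power_mono) auto
            moreover have "ennreal (g y / M * E) = ennreal (g y / M) * ennreal E" if "0 \<le> E" for E
              using g0[of y] M that by (intro ennreal_mult) auto
            ultimately show ?thesis using x by (simp add: power_mult_distrib del: times_divide_eq_left)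
          qed simp
        qed
        also have "\<dots> = ennreal (g y / M) * (\<integral>\<^sup>+x. indicator {..9 * R\<^sup>2} ((norm (y - x))\<^sup>2) * ennreal (exp (4 * pi * k * log_kernel R (y - x))) \<partial>lborel)"
          by (rule nn_integral_cmult) measurable
        also have "(\<integral>\<^sup>+x. indicator {..9 * R\<^sup>2} ((norm (y - x))\<^sup>2) * ennreal (exp (4 * pi * k * log_kernel R (y - x))) \<partial>lborel) \<le> ennreal C2"
        proof (subst nn_integral_reflect_translate[where h="\<lambda>z. indicator {..9 * R\<^sup>2} ((norm z)\<^sup>2) * ennreal (exp (4 * pi * k * log_kernel R z))"])
          show "(\<integral>\<^sup>+z. indicator {..9 * R\<^sup>2} ((norm z)\<^sup>2) * ennreal (exp (4 * pi * k * log_kernel R z)) \<partial>lborel) \<le> ennreal C2"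
            unfolding C2_def using k R by (intro nn_integral_exp_log_kernel) auto
        qed measurable
        finally show ?thesis by (simp add: mult_left_mono)
      qed (simp add: g_def)
    qed
    also have "(\<integral>\<^sup>+y. ennreal (g y / M) * ennreal C2 \<partial>lborel) = ennreal (1 / M) * (\<integral>\<^sup>+y. ennreal (g y) \<partial>lborel) * ennreal C2"
      using M g0 by (subst nn_integral_cmult[symmetric], simp, subst nn_integral_multc[symmetric], simp)
        (auto intro!: nn_integral_cong simp flip: ennreal_mult)
    also have "\<dots> \<le> ennreal (1 / M) * ennreal M * ennreal C2"
      using gM by (intro mult_right_mono mult_left_mono) auto
    also have "\<dots> = ennreal C2" using M by (simp flip: ennreal_mult)
    also have "emeasure lborel (ball x0 R) = ennreal (measure lborel (ball x0 R))"
      using emeasure_bounded_finite[OF bounded_ball] by (intro emeasure_eq_ennreal_measure) (auto simp: less_top)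
    finally have "(\<integral>\<^sup>+x. indicator (ball x0 R) x * ennreal (exp (\<sigma> * u x)) \<partial>lborel)
      \<le> ennreal (exp (\<sigma> * C1)) * (ennreal (measure lborel (ball x0 R)) + ennreal C2)"
      by (simp add: add_left_mono mult_left_mono)
    also have "\<dots> = ennreal C"
      unfolding C_def using C2 by (simp add: ennreal_mult ennreal_plus)
    finally show ?thesis .
  qed
  then show ?thesis using that[of \<sigma> C] \<sigma> C2 by (simp add: C_def)
qed

end

section \<open>The bootstrap for the potential, and the mass where solutions are very
  negative\<close>

context hartree
begin

lemma G_powr_b:
  assumes "g = exp (t / beta)"
  shows "g powr b = exp (lam * t)"
  using assms exponents by (simp add: powr_def)

text \<open>Since exp (\<sigma> u) is integrable with \<sigma> > 1 / beta, exp (lam u) is a power b'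
  < b of an integrable function G'. The gap n = b - b' is spent twice: in y it accommodates the
  factor K, written as the power n of an integrable function H, and in the convolution it makes the
  local kernel an admissible power of an integrable one.\<close>

lemma pot_estimate:
  assumes R: "0 < R" and sub: "ball x0 R \<subseteq> \<omega>" and \<sigma>: "1 / beta < \<sigma>" and \<delta>: "0 < \<delta>" and Cs: "0 \<le> Cs"
  obtains \<rho> where "0 < \<rho>" "\<rho> \<le> R / 4"
    "\<And>u f X G x. sol u f X G \<Longrightarrow> (\<integral>\<^sup>+x. indicator (ball x0 R) x * ennreal (exp (\<sigma> * u x)) \<partial>lborel) \<le> ennreal Cs \<Longrightarrow>
      x \<in> ball x0 (R / 4) \<Longrightarrow> log_pot f \<rho> x \<le> ennreal \<delta>"
proof -
  \<comment> \<open>The first entry gives \<sigma>' = lam / b' <= \<sigma>, the second keeps b'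
    positive, the third ensures c' = \<mu> / 2 + b - b' <= 1. All three lie below b.\<close>
  define b' where "b' = max (lam / \<sigma>) (max (b / 2) (b + \<mu> / 2 - 1))"
  have \<sigma>0: "0 < \<sigma>" using \<sigma> exponents by (smt (verit) zero_less_divide_1_iff)
  have "lam / \<sigma> < b"
    using \<sigma> \<sigma>0 exponents by (simp add: field_simps)
  then have b': "0 < b'" "b' < b" "b' < 1" "lam / \<sigma> \<le> b'" "b + \<mu> / 2 - 1 \<le> b'"
    using exponents mu by (auto simp: b'_def)
  define \<sigma>' where "\<sigma>' = lam / b'"
  have \<sigma>': "0 < \<sigma>'" "\<sigma>' \<le> \<sigma>" "\<sigma>' * b' = lam"
    using b' \<sigma>0 exponents by (auto simp: \<sigma>'_def field_simps)
  define n where "n = b - b'"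
  have n: "0 < n" using b' by (simp add: n_def)
  define c' where "c' = \<mu> / 2 + n"
  have c': "0 < c'" "c' \<le> 1" using b' n mu by (auto simp: c'_def n_def)
  \<comment> \<open>|v|^(-\<mu>) is the power c' of |v|^(-2 w). Because c' > \<mu> / 2, w < 1 and
    the latter is locally integrable.\<close>
  define w where "w = \<mu> / 2 / c'"
  have w: "w < 1" "w * c' = \<mu> / 2"
    using c'(1) n by (simp_all add: w_def) (simp add: c'_def)
  define T where "T = R / 2"
  have T: "0 < T" using R by (simp add: T_def)
  obtain Cf where Cf: "0 \<le> Cf" "\<And>G x. G \<in> borel_measurable borel \<Longrightarrow> (\<And>y. 0 \<le> G y) \<Longrightarrow>
     (\<integral>\<^sup>+y. ennreal (G y) \<partial>lborel) \<le> ennreal CG \<Longrightarrow>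
     (\<integral>\<^sup>+y. ennreal (G y powr b * rk (x - y)) \<partial>lborel) \<le>
       (\<integral>\<^sup>+y. indicator {..T\<^sup>2} ((norm (x - y))\<^sup>2) * ennreal (G y powr b * rk (x - y)) \<partial>lborel) + ennreal Cf"
    by (rule far_bound[OF T]) (rule that; blast)
  define W where "W v = indicator {..T\<^sup>2} ((norm v)\<^sup>2) * (norm v)\<^sup>2 powr (- w)" for v :: "real^2"
  have [measurable]: "W \<in> borel_measurable borel" unfolding W_def [abs_def] by measurable
  have W0: "0 \<le> W v" for v by (simp add: W_def)
  define CW where "CW = pi * (T\<^sup>2 powr (1 - w) / (1 - w))"
  have CW: "0 \<le> CW" using w by (simp add: CW_def)
  have intW: "(\<integral>\<^sup>+v. ennreal (W v) \<partial>lborel) = ennreal CW"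
    using nn_integral_inner_power[OF w(1), of "T\<^sup>2"] by (simp add: W_def CW_def ennreal_mult ennreal_indicator)
  define mb where "mb = measure lborel (ball x0 R)"
  have mb: "emeasure lborel (ball x0 R) = ennreal mb"
    unfolding mb_def using emeasure_bounded_finite[OF bounded_ball] by (intro emeasure_eq_ennreal_measure) (auto simp: less_top)
  have mb0: "0 \<le> mb" by (simp add: mb_def)
  define C2 where "C2 = mb + Cs"
  define CS where "CS = CX + C2 + 1"
  have C20: "0 \<le> C2" "0 \<le> CS" using mb0 Cs CX by (auto simp: C2_def CS_def)
  define Cst where "Cst = CS * C2 + CS * CW + C2 * CW + Cf * (mb + CS)"
  have Cst: "0 \<le> Cst" unfolding Cst_def using C20 CW Cf mb0 by (intro add_nonneg_nonneg mult_nonneg_nonneg) auto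
  \<comment> \<open>All estimates below end with c0 \<delta>' times the constant \<open>Cst\<close>;
    \<delta>' is chosen so that this is at most \<delta>. The radius \<rho> is then taken so small
    that the power 1 / n of the logarithmic kernel has integral at most \<delta>'^(1/n).\<close>
  define \<delta>' where "\<delta>' = \<delta> / (c0 * Cst + 1)"
  have "0 < c0 * Cst + 1" using c0 Cst by (simp add: add_nonneg_pos)
  then have \<delta>': "0 < \<delta>'" "c0 * \<delta>' * Cst \<le> \<delta>" using \<delta> by (auto simp: \<delta>'_def field_simps)
  define A where "A = (2 / n / (4 * pi)) powr (1 / n)"
  define E where "E = \<delta>' powr (1 / n)"
  have E: "0 < E" using \<delta>' by (simp add: E_def)
  obtain \<rho> where \<rho>: "0 < \<rho>" "\<rho> \<le> R / 4" "A * ((2 * \<rho>\<^sup>2) powr (1/2) * (pi * (\<rho>\<^sup>2 powr (1/2) / (1/2)))) \<le> E"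
  proof -
    have "((\<lambda>\<rho>. A * (sqrt (2 * \<rho>\<^sup>2) * (pi * (sqrt (\<rho>\<^sup>2) / (1/2))))) \<longlongrightarrow> A * (sqrt (2 * 0\<^sup>2) * (pi * (sqrt (0\<^sup>2) / (1/2))))) (at_right 0)"
      by (intro tendsto_intros) auto
    then have "eventually (\<lambda>\<rho>. A * (sqrt (2 * \<rho>\<^sup>2) * (pi * (sqrt (\<rho>\<^sup>2) / (1/2)))) < E) (at_right 0)"
      using E by (intro order_tendstoD) auto
    moreover have "eventually (\<lambda>\<rho>. 0 < \<rho> \<and> \<rho> < R / 4) (at_right 0)"
      using R eventually_at_right_real[of 0 "R / 4"] by simp
    ultimately have "eventually (\<lambda>\<rho>. A * (sqrt (2 * \<rho>\<^sup>2) * (pi * (sqrt (\<rho>\<^sup>2) / (1/2)))) < E \<and> 0 < \<rho> \<and> \<rho> < R / 4) (at_right 0)"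
      by eventually_elim simp
    then obtain \<rho> where "A * (sqrt (2 * \<rho>\<^sup>2) * (pi * (sqrt (\<rho>\<^sup>2) / (1/2)))) < E" "0 < \<rho>" "\<rho> < R / 4"
      using eventually_happens' trivial_limit_at_right_real by blast
    then show ?thesis using that[of \<rho>] by (simp add: powr_half_sqrt)
  qed
  have "log_pot f \<rho> x \<le> ennreal \<delta>"
    if sol: "sol u f X G" and es: "(\<integral>\<^sup>+x. indicator (ball x0 R) x * ennreal (exp (\<sigma> * u x)) \<partial>lborel) \<le> ennreal Cs"
      and x: "x \<in> ball x0 (R / 4)" for u f X G x
  proof -
    interpret weak_solution \<omega> u f using solD(1)[OF sol] .
    note [measurable] = u_meas f_meas solD(2,3)[OF sol]
    have [measurable]: "ball x0 R \<in> sets borel" by simp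
    define G' where "G' z = indicator (ball x0 R) z * exp (\<sigma>' * u z)" for z
    have [measurable]: "G' \<in> borel_measurable borel" unfolding G'_def [abs_def] by measurable
    define K where "K y = log_kernel \<rho> (y - x)" for y
    have [measurable]: "K \<in> borel_measurable borel" unfolding K_def [abs_def] by measurable
    have K0: "0 \<le> K y" for y using \<rho> by (simp add: K_def log_kernel_nonneg)
    define H where "H y = (K y / \<delta>') powr (1 / n)" for y
    have [measurable]: "H \<in> borel_measurable borel" unfolding H_def [abs_def] by measurable
    define S where "S y = X y + G' y + H y" for y
    have [measurable]: "S \<in> borel_measurable borel" unfolding S_def [abs_def] by measurable
    have nn: "0 \<le> X y" "0 \<le> G' y" "0 \<le> H y" "0 \<le> S y" for y
      using solD(6)[OF sol] by (auto simp: G'_def H_def S_def)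
    have intG': "(\<integral>\<^sup>+z. ennreal (G' z) \<partial>lborel) \<le> ennreal C2"
    proof -
      have le: "exp (\<sigma>' * u z) \<le> 1 + exp (\<sigma> * u z)" for z
      proof (cases "0 \<le> u z")
        case True
        then have "exp (\<sigma>' * u z) \<le> exp (\<sigma> * u z)" using \<sigma>' by (simp add: mult_right_mono)
        then show ?thesis by linarith
      next
        case False
        then have "exp (\<sigma>' * u z) \<le> 1" using \<sigma>' by (simp add: mult_nonneg_nonpos)
        then show ?thesis using exp_gt_zero[of "\<sigma> * u z"] by linarith
      qed
      have "ennreal (exp (\<sigma>' * u z)) \<le> 1 + ennreal (exp (\<sigma> * u z))" for z
        using ennreal_leI[OF le[of z]] by (simp add: ennreal_plus)
      then have "ennreal (G' z) \<le> indicator (ball x0 R) z + indicator (ball x0 R) z * ennreal (exp (\<sigma> * u z))" for z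
        by (simp add: G'_def split: split_indicator)
      then have "(\<integral>\<^sup>+z. ennreal (G' z) \<partial>lborel) \<le> (\<integral>\<^sup>+z. indicator (ball x0 R) z + indicator (ball x0 R) z * ennreal (exp (\<sigma> * u z)) \<partial>lborel)"
        by (rule nn_integral_mono)
      also have "\<dots> = ennreal mb + (\<integral>\<^sup>+z. indicator (ball x0 R) z * ennreal (exp (\<sigma> * u z)) \<partial>lborel)"
        by (simp add: nn_integral_add mb)
      also have "\<dots> \<le> ennreal mb + ennreal Cs" using es by (rule add_left_mono)
      also have "\<dots> = ennreal C2" using mb0 Cs by (simp add: C2_def)
      finally show ?thesis .
    qed
    have intH: "(\<integral>\<^sup>+y. ennreal (H y) \<partial>lborel) \<le> 1"
    proof -
      have "H y = 1 / E * log_kernel \<rho> (y - x) powr (1 / n)" for y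
        using \<delta>' K0[of y] by (simp add: H_def E_def powr_divide K_def)
      then have "(\<integral>\<^sup>+y. ennreal (H y) \<partial>lborel) = (\<integral>\<^sup>+y. ennreal (1 / E) * ennreal (log_kernel \<rho> (y - x) powr (1 / n)) \<partial>lborel)"
        using E by (simp flip: ennreal_mult)
      also have "\<dots> = ennreal (1 / E) * (\<integral>\<^sup>+y. ennreal (log_kernel \<rho> (y - x) powr (1 / n)) \<partial>lborel)"
        by (rule nn_integral_cmult) measurable
      also have "(\<integral>\<^sup>+y. ennreal (log_kernel \<rho> (y - x) powr (1 / n)) \<partial>lborel) = (\<integral>\<^sup>+y. ennreal (log_kernel \<rho> y powr (1 / n)) \<partial>lborel)"
        by (rule nn_integral_translate) measurable
      also have "\<dots> \<le> ennreal E"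
        using nn_integral_log_kernel_powr[OF n \<rho>(1)] \<rho>(3) unfolding A_def by (meson ennreal_leI order_trans)
      also have "ennreal (1 / E) * ennreal E = 1" using E by (simp flip: ennreal_mult)
      finally show ?thesis by (simp add: mult_left_mono)
    qed
    have intS: "(\<integral>\<^sup>+y. ennreal (S y) \<partial>lborel) \<le> ennreal CS"
    proof -
      have "(\<integral>\<^sup>+y. ennreal (S y) \<partial>lborel) = (\<integral>\<^sup>+y. ennreal (X y) \<partial>lborel) + (\<integral>\<^sup>+y. ennreal (G' y) \<partial>lborel) + (\<integral>\<^sup>+y. ennreal (H y) \<partial>lborel)"
        using nn by (simp add: S_def ennreal_plus nn_integral_add)
      also have "\<dots> \<le> ennreal CX + ennreal C2 + 1"
        using intG' intH solD(9)[OF sol] by (intro add_mono)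
      also have "\<dots> = ennreal CS" using CX C20 by (simp add: CS_def ennreal_plus)
      finally show ?thesis .
    qed
    \<comment> \<open>For y in the disc of radius R / 2 and |y - z| <= T = R / 2, z stays in the
      disc of radius R, where G z = exp (u z / beta) and G' is not cut off.\<close>
    have near: "indicator {..T\<^sup>2} ((norm (y - z))\<^sup>2) * ennreal (G z powr b * rk (y - z)) \<le> ennreal (G' z powr b' * W (y - z) powr c')"
      if y: "y \<in> ball x0 (R / 2)" and z: "z \<in> \<omega> \<longrightarrow> G z = exp (u z / beta)" for y z
    proof (cases "(norm (y - z))\<^sup>2 \<le> T\<^sup>2")
      case True
      then have "norm (y - z) \<le> R / 2" using T power2_le_imp_le[of "norm (y - z)" T] by (simp add: T_def)
      then have zb: "z \<in> ball x0 R" using y dist_triangle[of x0 z y] by (simp add: dist_norm)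
      then have "G z powr b = exp (lam * u z)" using z sub by (intro G_powr_b) auto
      moreover have "G' z powr b' = exp (lam * u z)"
        using zb \<sigma>'(3) by (simp add: G'_def powr_def flip: mult.assoc) (simp add: mult.commute)
      moreover have "W (y - z) powr c' = rk (y - z)"
      proof -
        have "W (y - z) powr c' = (norm (y - z))\<^sup>2 powr (- w * c')" using True unfolding W_def by (simp add: powr_powr)
        also have "- w * c' = - (\<mu> / 2)" using w by simp
        finally show ?thesis .
      qed
      ultimately show ?thesis using True by simp
    qed simp
    let ?I = "\<lambda>y z. S y * G' z + S y * W (y - z) + G' z * W (y - z)"
    have ae: "AE y in lborel. ennreal (f y * K y) \<le> ennreal (c0 * \<delta>') *
       ((\<integral>\<^sup>+z. ennreal (?I y z) \<partial>lborel) + ennreal Cf * (indicator (ball x0 R) y + ennreal (S y)))"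
      using solD(11)[OF sol] solD(13)[OF sol]
    proof eventually_elim
      case (elim y)
      show ?case
      proof (cases "y \<in> ball x0 (R / 2)")
        case False
        then have "\<rho> \<le> norm (y - x)"
          using x \<rho> dist_triangle[of x0 y x] by (simp add: dist_norm norm_minus_commute)
        then have "K y = 0" using \<rho> by (simp add: K_def log_kernel_eq_0)
        then show ?thesis by simp
      next
        case True
        then have yb: "y \<in> ball x0 R" using R by simp
        then have y\<omega>: "y \<in> \<omega>" using sub by blast
        define N where "N = (\<integral>\<^sup>+z. ennreal (G' z powr b' * W (y - z) powr c') \<partial>lborel)"
        have "G y powr b = exp (lam * u y)" using elim y\<omega> by (intro G_powr_b) auto
        also have "exp (lam * u y) = G' y powr b'"
          using yb \<sigma>'(3) by (simp add: G'_def powr_def flip: mult.assoc) (simp add: mult.commute)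
        finally have Gy: "G y powr b = G' y powr b'" .
        have "ennreal (f y) \<le> ennreal (c0 * X y powr a0 * G' y powr b') * (\<integral>\<^sup>+z. ennreal (G z powr b * rk (y - z)) \<partial>lborel)"
          using elim y\<omega> Gy by simp
        also have "(\<integral>\<^sup>+z. ennreal (G z powr b * rk (y - z)) \<partial>lborel)
            \<le> (\<integral>\<^sup>+z. indicator {..T\<^sup>2} ((norm (y - z))\<^sup>2) * ennreal (G z powr b * rk (y - z)) \<partial>lborel) + ennreal Cf"
          by (rule Cf(2)[OF solD(3)[OF sol] solD(7)[OF sol] solD(10)[OF sol]])
        also have "(\<integral>\<^sup>+z. indicator {..T\<^sup>2} ((norm (y - z))\<^sup>2) * ennreal (G z powr b * rk (y - z)) \<partial>lborel) \<le> N"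
          unfolding N_def using solD(11)[OF sol] near[OF True] by (intro nn_integral_mono_AE) (auto elim: eventually_mono)
        finally have fy: "ennreal (f y) \<le> ennreal (c0 * X y powr a0 * G' y powr b') * (N + ennreal Cf)"
          by (simp add: mult_left_mono add_right_mono)
        have Kd: "K y = \<delta>' * H y powr n"
          using \<delta>' K0[of y] n by (simp add: H_def powr_powr)
        \<comment> \<open>The exponents a0, b' and n add up to a0 + b, so X, G' and H merge into one
          power of their sum S.\<close>
        have XGH: "X y powr a0 * G' y powr b' * H y powr n \<le> S y powr (a0 + b)"
        proof -
          have "X y powr a0 * G' y powr b' * H y powr n \<le> (X y + G' y) powr (a0 + b') * H y powr n"
            using nn a0 b' by (intro mult_right_mono powr_mult_le_sum_powr) auto
          also have "\<dots> \<le> (X y + G' y + H y) powr (a0 + b' + n)"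
            using nn a0 b' n by (intro powr_mult_le_sum_powr add_nonneg_nonneg) auto
          finally show ?thesis by (simp add: S_def n_def)
        qed
        have "ennreal (f y * K y) = ennreal (f y) * ennreal (K y)"
          by (intro ennreal_mult f_nonneg K0)
        also have "\<dots> \<le> ennreal (c0 * X y powr a0 * G' y powr b') * (N + ennreal Cf) * ennreal (K y)"
          using fy by (rule mult_right_mono) simp
        also have "\<dots> = ennreal (c0 * X y powr a0 * G' y powr b' * K y) * (N + ennreal Cf)"
          using c0 by (simp add: ennreal_mult K0 mult_ac)
        also have "c0 * X y powr a0 * G' y powr b' * K y = c0 * \<delta>' * (X y powr a0 * G' y powr b' * H y powr n)"
          unfolding Kd by (simp only: mult_ac)
        also have "ennreal \<dots> \<le> ennreal (c0 * \<delta>' * S y powr (a0 + b))"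
          using XGH c0 \<delta>' by (intro ennreal_leI mult_left_mono) auto
        also have "ennreal (c0 * \<delta>' * S y powr (a0 + b)) = ennreal (c0 * \<delta>') * ennreal (S y powr (a0 + b))"
          using c0 \<delta>' by (intro ennreal_mult) auto
        finally have "ennreal (f y * K y) \<le> ennreal (c0 * \<delta>') * ennreal (S y powr (a0 + b)) * (N + ennreal Cf)"
          by (simp add: mult_right_mono)
        then have "ennreal (f y * K y) \<le> ennreal (c0 * \<delta>') * (ennreal (S y powr (a0 + b)) * N + ennreal (S y powr (a0 + b)) * ennreal Cf)"
          by (simp add: distrib_left mult.assoc)
        also have "ennreal (S y powr (a0 + b)) * N = (\<integral>\<^sup>+z. ennreal (S y powr (a0 + b)) * ennreal (G' z powr b' * W (y - z) powr c') \<partial>lborel)"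
          unfolding N_def by (rule nn_integral_cmult[symmetric]) measurable
        also have "\<dots> \<le> (\<integral>\<^sup>+z. ennreal (?I y z) \<partial>lborel)"
        proof (rule nn_integral_mono)
          fix z
          \<comment> \<open>The exponents a0 + b, b' and c' = \<mu> / 2 + n again have sum 2, as the
            pointwise Young inequality requires; its three products integrate separately.\<close>
          have "S y powr (a0 + b) * G' z powr b' * W (y - z) powr c' \<le> ?I y z"
            using nn W0 exponents b' c' by (intro powr_mult3_le) (auto simp: c'_def n_def)
          then show "ennreal (S y powr (a0 + b)) * ennreal (G' z powr b' * W (y - z) powr c') \<le> ennreal (?I y z)"
            by (simp add: ennreal_leI mult.assoc flip: ennreal_mult)
        qed
        also have "ennreal (S y powr (a0 + b)) * ennreal Cf \<le> ennreal Cf * (indicator (ball x0 R) y + ennreal (S y))"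
        proof -
          have "S y powr (a0 + b) \<le> 1 + S y" using nn exponents by (intro powr_le_one_plus) auto
          then have "ennreal (S y powr (a0 + b)) \<le> 1 + ennreal (S y)"
            using nn by (simp add: ennreal_leI flip: ennreal_1 ennreal_plus)
          then show ?thesis using yb by (simp add: mult.commute mult_left_mono)
        qed
        finally show ?thesis by (simp add: mult_left_mono add_mono)
      qed
    qed
    have "pot \<rho> x = (\<integral>\<^sup>+y. ennreal (f y * K y) \<partial>lborel)" by (simp add: pot_def K_def)
    also have "\<dots> \<le> (\<integral>\<^sup>+y. ennreal (c0 * \<delta>') *
       ((\<integral>\<^sup>+z. ennreal (?I y z) \<partial>lborel) + ennreal Cf * (indicator (ball x0 R) y + ennreal (S y))) \<partial>lborel)"
      by (rule nn_integral_mono_AE[OF ae])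
    also have "\<dots> = ennreal (c0 * \<delta>') * ((\<integral>\<^sup>+y. \<integral>\<^sup>+z. ennreal (?I y z) \<partial>lborel \<partial>lborel)
         + ennreal Cf * (ennreal mb + (\<integral>\<^sup>+y. ennreal (S y) \<partial>lborel)))"
      by (simp add: nn_integral_cmult nn_integral_add mb)
    also have "(\<integral>\<^sup>+y. \<integral>\<^sup>+z. ennreal (?I y z) \<partial>lborel \<partial>lborel) =
       (\<integral>\<^sup>+y. ennreal (S y) \<partial>lborel) * (\<integral>\<^sup>+z. ennreal (G' z) \<partial>lborel) + (\<integral>\<^sup>+y. ennreal (S y) \<partial>lborel) * ennreal CW
       + (\<integral>\<^sup>+z. ennreal (G' z) \<partial>lborel) * ennreal CW"
    proof -
      have eq: "ennreal (?I y z) = ennreal (S y) * ennreal (G' z) + ennreal (S y) * ennreal (W (y - z)) + ennreal (G' z) * ennreal (W (y - z))" for y z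
        using nn W0 by (simp add: ennreal_plus ennreal_mult)
      have 1: "(\<integral>\<^sup>+y. \<integral>\<^sup>+z. ennreal (S y) * ennreal (G' z) \<partial>lborel \<partial>lborel) = (\<integral>\<^sup>+y. ennreal (S y) \<partial>lborel) * (\<integral>\<^sup>+z. ennreal (G' z) \<partial>lborel)"
        by (simp add: nn_integral_cmult nn_integral_multc)
      have 2: "(\<integral>\<^sup>+y. \<integral>\<^sup>+z. ennreal (S y) * ennreal (W (y - z)) \<partial>lborel \<partial>lborel) = (\<integral>\<^sup>+y. ennreal (S y) \<partial>lborel) * ennreal CW"
        using intW by (simp add: nn_integral_cmult nn_integral_multc nn_integral_reflect_translate[where h="\<lambda>v. ennreal (W v)"])
      have 3: "(\<integral>\<^sup>+y. \<integral>\<^sup>+z. ennreal (G' z) * ennreal (W (y - z)) \<partial>lborel \<partial>lborel) = (\<integral>\<^sup>+z. ennreal (G' z) \<partial>lborel) * ennreal CW"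
      proof -
        have "(\<integral>\<^sup>+y. \<integral>\<^sup>+z. ennreal (G' z) * ennreal (W (y - z)) \<partial>lborel \<partial>lborel) = (\<integral>\<^sup>+z. \<integral>\<^sup>+y. ennreal (G' z) * ennreal (W (y - z)) \<partial>lborel \<partial>lborel)"
          by (rule lborel_pair.Fubini') measurable
        then show ?thesis
          using intW by (simp add: nn_integral_cmult nn_integral_multc nn_integral_translate[where h="\<lambda>v. ennreal (W v)"])
      qed
      show ?thesis unfolding eq by (simp add: nn_integral_add 1 2 3)
    qed
    also have "ennreal (c0 * \<delta>') * ((\<integral>\<^sup>+y. ennreal (S y) \<partial>lborel) * (\<integral>\<^sup>+z. ennreal (G' z) \<partial>lborel) + (\<integral>\<^sup>+y. ennreal (S y) \<partial>lborel) * ennreal CW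
       + (\<integral>\<^sup>+z. ennreal (G' z) \<partial>lborel) * ennreal CW + ennreal Cf * (ennreal mb + (\<integral>\<^sup>+y. ennreal (S y) \<partial>lborel)))
      \<le> ennreal (c0 * \<delta>') * (ennreal CS * ennreal C2 + ennreal CS * ennreal CW + ennreal C2 * ennreal CW + ennreal Cf * (ennreal mb + ennreal CS))"
      by (intro mult_left_mono add_mono mult_mono intS intG' order_refl zero_le)
    also have "\<dots> = ennreal (c0 * \<delta>' * Cst)"
      using C20 CW Cf mb0 c0 \<delta>' by (simp add: Cst_def ennreal_mult ennreal_plus distrib_left)
    also have "\<dots> \<le> ennreal \<delta>" using \<delta>' by (intro ennreal_leI) simp
    finally show ?thesis .
  qed
  then show ?thesis using that[of \<rho>] \<rho> by blast
qed

text \<open>The factor exp (- lam M) comes from G^b at the point itself. The Riesz potential is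
  merely bounded, by G^b <= 1 nearby and by a constant from far away, so no second factor is
  gained.\<close>

lemma small_mass:
  assumes R: "0 < R" and sub: "ball x0 R \<subseteq> \<omega>"
  obtains C where "0 \<le> C" "\<And>u f X G M. sol u f X G \<Longrightarrow> 0 \<le> M \<Longrightarrow> (\<And>x. x \<in> ball x0 R \<Longrightarrow> u x \<le> - M) \<Longrightarrow>
     (\<integral>\<^sup>+y. indicator (ball x0 (R / 2)) y * ennreal (f y) \<partial>lborel) \<le> ennreal (C * exp (- lam * M))"
proof -
  define T where "T = R / 2"
  have T: "0 < T" using R by (simp add: T_def)
  obtain Cf where Cf: "0 \<le> Cf" "\<And>G x. G \<in> borel_measurable borel \<Longrightarrow> (\<And>y. 0 \<le> G y) \<Longrightarrow>
     (\<integral>\<^sup>+y. ennreal (G y) \<partial>lborel) \<le> ennreal CG \<Longrightarrow>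
     (\<integral>\<^sup>+y. ennreal (G y powr b * rk (x - y)) \<partial>lborel) \<le>
       (\<integral>\<^sup>+y. indicator {..T\<^sup>2} ((norm (x - y))\<^sup>2) * ennreal (G y powr b * rk (x - y)) \<partial>lborel) + ennreal Cf"
    by (rule far_bound[OF T]) (rule that; blast)
  define CW where "CW = pi * (T\<^sup>2 powr (1 - \<mu> / 2) / (1 - \<mu> / 2))"
  have CW: "0 \<le> CW" using mu by (simp add: CW_def)
  define mb where "mb = measure lborel (ball x0 R)"
  have mb: "emeasure lborel (ball x0 R) = ennreal mb"
    unfolding mb_def using emeasure_bounded_finite[OF bounded_ball] by (intro emeasure_eq_ennreal_measure) (auto simp: less_top)
  have mb0: "0 \<le> mb" by (simp add: mb_def)
  define C where "C = c0 * (CW + Cf) * (mb + CX)"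
  show ?thesis
  proof
    show "0 \<le> C" using c0 CW Cf mb0 CX by (simp add: C_def)
    fix u f X G M
    assume sol: "sol u f X G" and M: "0 \<le> M" and uM: "\<And>x. x \<in> ball x0 R \<Longrightarrow> u x \<le> - M"
    note [measurable] = solD(2,3,4,5)[OF sol]
    have [measurable]: "ball x0 R \<in> sets borel" by simp
    have Gb: "G z powr b \<le> exp (- lam * M)" if "z \<in> ball x0 R" "z \<in> \<omega> \<longrightarrow> G z = exp (u z / beta)" for z
    proof -
      have "G z powr b = exp (lam * u z)" using that sub by (intro G_powr_b) auto
      also have "lam * u z \<le> lam * - M" using uM[OF that(1)] exponents(1) by (intro mult_left_mono) auto
      then have "exp (lam * u z) \<le> exp (- lam * M)" by simp
      finally show ?thesis .
    qed
    have e1: "exp (- lam * M) \<le> 1" using M exponents by (simp add: mult_nonneg_nonneg)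
    have ae: "AE y in lborel. indicator (ball x0 (R / 2)) y * ennreal (f y)
       \<le> ennreal (c0 * exp (- lam * M) * (CW + Cf)) * (indicator (ball x0 R) y + ennreal (X y))"
      using solD(11)[OF sol] solD(13)[OF sol]
    proof eventually_elim
      case (elim y)
      show ?case
      proof (cases "y \<in> ball x0 (R / 2)")
        case True
        then have yb: "y \<in> ball x0 R" using R by simp
        then have y\<omega>: "y \<in> \<omega>" using sub by blast
        have "ennreal (f y) \<le> ennreal (c0 * X y powr a0 * G y powr b) * (\<integral>\<^sup>+z. ennreal (G z powr b * rk (y - z)) \<partial>lborel)"
          using elim y\<omega> by simp
        also have "(\<integral>\<^sup>+z. ennreal (G z powr b * rk (y - z)) \<partial>lborel)
            \<le> (\<integral>\<^sup>+z. indicator {..T\<^sup>2} ((norm (y - z))\<^sup>2) * ennreal (G z powr b * rk (y - z)) \<partial>lborel) + ennreal Cf"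
          by (rule Cf(2)[OF solD(3)[OF sol] solD(7)[OF sol] solD(10)[OF sol]])
        also have "(\<integral>\<^sup>+z. indicator {..T\<^sup>2} ((norm (y - z))\<^sup>2) * ennreal (G z powr b * rk (y - z)) \<partial>lborel)
          \<le> (\<integral>\<^sup>+z. indicator {..T\<^sup>2} ((norm (y - z))\<^sup>2) * ennreal (rk (y - z)) \<partial>lborel)"
        proof (rule nn_integral_mono_AE, use solD(11)[OF sol] in eventually_elim)
          case (elim z)
          show ?case
          proof (cases "(norm (y - z))\<^sup>2 \<le> T\<^sup>2")
            case True2: True
            then have "norm (y - z) \<le> R / 2" using T power2_le_imp_le[of "norm (y - z)" T] by (simp add: T_def)
            then have "z \<in> ball x0 R" using True dist_triangle[of x0 z y] by (simp add: dist_norm)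
            then have "G z powr b \<le> 1" using Gb[OF _ elim] e1 by linarith
            then have "G z powr b * rk (y - z) \<le> 1 * rk (y - z)" by (intro mult_right_mono) auto
            then show ?thesis using True2 by (simp add: ennreal_leI)
          qed simp
        qed
        also have "\<dots> = ennreal CW"
          using mu nn_integral_inner_power[of "\<mu> / 2" "T\<^sup>2"] unfolding CW_def
          by (subst nn_integral_reflect_translate[where h="\<lambda>z. indicator {..T\<^sup>2} ((norm z)\<^sup>2) * ennreal (rk z)"]) auto
        finally have "ennreal (f y) \<le> ennreal (c0 * X y powr a0 * G y powr b) * (ennreal CW + ennreal Cf)"
          by (simp add: mult_left_mono add_right_mono)
        also have "\<dots> \<le> ennreal (c0 * exp (- lam * M) * (1 + X y)) * (ennreal CW + ennreal Cf)"
        proof (intro mult_right_mono ennreal_leI)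
          have "X y powr a0 * G y powr b \<le> (1 + X y) * exp (- lam * M)"
            using solD(6)[OF sol] a0 mu Gb[OF yb elim(1)] by (intro mult_mono powr_le_one_plus) (auto intro: add_nonneg_nonneg)
          then have "c0 * (X y powr a0 * G y powr b) \<le> c0 * ((1 + X y) * exp (- lam * M))"
            using c0 by (rule mult_left_mono)
          then show "c0 * X y powr a0 * G y powr b \<le> c0 * exp (- lam * M) * (1 + X y)"
            by (simp only: mult_ac)
        qed simp
        also have "\<dots> = ennreal (c0 * exp (- lam * M) * (CW + Cf)) * (1 + ennreal (X y))"
          using c0 CW Cf solD(6)[OF sol, of y] by (simp add: ennreal_mult ennreal_plus mult_ac)
        finally show ?thesis using True yb by simp
      qed simp
    qed
    have "(\<integral>\<^sup>+y. indicator (ball x0 (R / 2)) y * ennreal (f y) \<partial>lborel)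
      \<le> (\<integral>\<^sup>+y. ennreal (c0 * exp (- lam * M) * (CW + Cf)) * (indicator (ball x0 R) y + ennreal (X y)) \<partial>lborel)"
      by (rule nn_integral_mono_AE[OF ae])
    also have "\<dots> = ennreal (c0 * exp (- lam * M) * (CW + Cf)) * (ennreal mb + (\<integral>\<^sup>+y. ennreal (X y) \<partial>lborel))"
      by (simp add: nn_integral_cmult nn_integral_add mb)
    also have "\<dots> \<le> ennreal (c0 * exp (- lam * M) * (CW + Cf)) * (ennreal mb + ennreal CX)"
      using solD(9)[OF sol] by (intro mult_left_mono add_left_mono) auto
    also have "\<dots> = ennreal (c0 * exp (- lam * M) * (CW + Cf)) * ennreal (mb + CX)"
      using mb0 CX by simp
    also have "\<dots> = ennreal (c0 * exp (- lam * M) * (CW + Cf) * (mb + CX))"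
      using mb0 CX c0 CW Cf by (intro ennreal_mult[symmetric]) auto
    also have "c0 * exp (- lam * M) * (CW + Cf) * (mb + CX) = C * exp (- lam * M)"
      by (simp add: C_def)
    finally show "(\<integral>\<^sup>+y. indicator (ball x0 (R / 2)) y * ennreal (f y) \<partial>lborel) \<le> ennreal (C * exp (- lam * M))" .
  qed
qed

end

section \<open>The continuous representative\<close>

lemma test_fun_bounded:
  assumes "0 < e" "e \<le> r"
  obtains C where "0 \<le> C" "\<And>z. test_fun e r z \<le> C"
proof -
  define C where "C = \<bar>(ln (2 * r\<^sup>2) - ln (e\<^sup>2 * exp (- 2))) / (4 * pi)\<bar>"
  have "test_fun e r z \<le> C" for z
  proof (cases "r \<le> norm z")
    case True
    then show ?thesis using assms by (simp add: test_fun_eq_0 C_def)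
  next
    case False
    have "(norm z)\<^sup>2 \<le> r\<^sup>2" using False by (intro power_mono) auto
    then have "reg_sq r ((norm z)\<^sup>2) \<le> 2 * r\<^sup>2"
      using reg_sq_le[OF zero_le_power2, of r "norm z"] assms by linarith
    then have "ln (reg_sq r ((norm z)\<^sup>2)) \<le> ln (2 * r\<^sup>2)"
      using assms by (intro ln_mono reg_sq_pos) auto
    moreover have "ln (e\<^sup>2 * exp (- 2)) \<le> ln (reg_sq e ((norm z)\<^sup>2))"
      using assms reg_sq_ge[of "(norm z)\<^sup>2" e] by (intro ln_mono) auto
    ultimately have "test_fun e r z \<le> (ln (2 * r\<^sup>2) - ln (e\<^sup>2 * exp (- 2))) / (4 * pi)"
      unfolding test_fun_def by (intro divide_right_mono diff_mono) auto
    then show ?thesis unfolding C_def by linarith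
  qed
  then show ?thesis using that[of C] by (simp add: C_def)
qed

context weak_solution
begin

lemma integrable_f_test_fun:
  assumes "0 < e" "e \<le> r"
  shows "integrable lborel (\<lambda>y. f y * test_fun e r (y - x))"
proof -
  obtain C where C: "0 \<le> C" "\<And>z. test_fun e r z \<le> C" using test_fun_bounded[OF assms] by metis
  show ?thesis
  proof (rule Bochner_Integration.integrable_bound)
    show "integrable lborel (\<lambda>y. C * f y)" using integrable_f by simp
    show "AE y in lborel. norm (f y * test_fun e r (y - x)) \<le> norm (C * f y)"
      using C f_nonneg assms by (auto simp: abs_mult test_fun_nonneg mult.commute[of C] intro!: mult_left_mono)
  qed measurable
qed

text \<open>The kernels at the scales e and r differ by a bounded test function, so finiteness of
  the potential passes from the small scale to the large one, and the sum of mean and potential does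
  not change.\<close>

lemma representation_scale:
  assumes e: "0 < e" "e \<le> r" and x: "cball x r \<subseteq> \<omega>" and fin: "pot e x < \<infinity>"
  shows "pot r x < \<infinity>" "avg r x + enn2real (pot r x) = avg e x + enn2real (pot e x)"
proof -
  have r: "0 < r" using e by simp
  note int = integrable_f_test_fun[OF e, of x]
  have split: "AE y in lborel. f y * log_kernel r (y - x) = f y * log_kernel e (y - x) + f y * test_fun e r (y - x)"
    using AE_lborel_singleton[of x]
    by eventually_elim (use log_kernel_split[of _ r e] in \<open>simp add: distrib_left\<close>)
  have "integrable lborel (\<lambda>y. f y * log_kernel e (y - x) + f y * test_fun e r (y - x))"
    using integrable_f_log_kernel[OF e(1) fin] int by simp
  then have "integrable lborel (\<lambda>y. f y * log_kernel r (y - x))"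
    using split by (subst integrable_cong_AE) auto
  then show "pot r x < \<infinity>"
    using r by (simp add: pot_def integrable_iff_bounded f_nonneg log_kernel_nonneg)
  have "enn2real (pot r x) = (LINT y|lborel. f y * log_kernel e (y - x) + f y * test_fun e r (y - x))"
    unfolding pot_eq_integral[OF r] using split by (intro integral_cong_AE) auto
  also have "\<dots> = enn2real (pot e x) + (LINT y|lborel. f y * test_fun e r (y - x))"
    unfolding pot_eq_integral[OF e(1)] using integrable_f_log_kernel[OF e(1) fin] int by simp
  finally show "avg r x + enn2real (pot r x) = avg e x + enn2real (pot e x)"
    using avg_eq_avg_plus[OF e x] by simp
qed

lemma isCont_avg:
  assumes r: "0 < r" and s: "0 < s" and sub: "cball x0 (r + s) \<subseteq> \<omega>"
  shows "isCont (avg r) x0"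
proof -
  define w where "w y = indicator (cball x0 (r + s)) y * u y" for y
  have w: "integrable lborel w" unfolding w_def [abs_def] using sub by (intro u_int) auto
  have [measurable]: "w \<in> borel_measurable borel" using w by auto
  obtain B where B: "0 < B" "\<And>r z. 0 < r \<Longrightarrow> mollifier r z \<le> B / r\<^sup>2" using mollifier_bounds by metis
  define h where "h x = (LINT y|lborel. w y * mollifier r (y - x))" for x
  have "isCont h x0"
    unfolding continuous_at_sequentially
  proof (intro allI impI)
    fix X :: "nat \<Rightarrow> real^2" assume X: "X \<longlonglongrightarrow> x0"
    show "(h \<circ> X) \<longlonglongrightarrow> h x0"
      unfolding h_def o_def
    proof (rule integral_dominated_convergence[where w="\<lambda>y. B / r\<^sup>2 * \<bar>w y\<bar>"])
      show "AE y in lborel. (\<lambda>n. w y * mollifier r (y - X n)) \<longlonglongrightarrow> w y * mollifier r (y - x0)"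
        using continuous_on_mollifier[OF r] X
        by (intro AE_I2 tendsto_mult tendsto_const isCont_tendsto_compose[of _ "mollifier r"] tendsto_diff)
          (auto simp: continuous_on_eq_continuous_at)
      show "AE y in lborel. norm (w y * mollifier r (y - X n)) \<le> B / r\<^sup>2 * \<bar>w y\<bar>" for n
      proof (rule AE_I2)
        fix y
        have "\<bar>w y\<bar> * mollifier r (y - X n) \<le> \<bar>w y\<bar> * (B / r\<^sup>2)" by (intro mult_left_mono B r) simp
        then show "norm (w y * mollifier r (y - X n)) \<le> B / r\<^sup>2 * \<bar>w y\<bar>"
          by (simp add: abs_mult mollifier_nonneg mult.commute)
      qed
    qed (use w in auto)
  qed
  moreover have "eventually (\<lambda>x. h x = avg r x) (nhds x0)"
    unfolding eventually_nhds
  proof (intro exI conjI ballI)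
    show "open (ball x0 s)" "x0 \<in> ball x0 s" using s by auto
    fix x assume x: "x \<in> ball x0 s"
    have "w y * mollifier r (y - x) = u y * mollifier r (y - x)" for y
    proof (cases "y \<in> cball x0 (r + s)")
      case False
      then have "r \<le> norm (y - x)"
        using x dist_triangle[of x0 y x] by (simp add: dist_norm norm_minus_commute)
      then show ?thesis using r by (simp add: mollifier_eq_0)
    qed (simp add: w_def)
    then show "h x = avg r x" unfolding h_def avg_def by (simp only:)
  qed
  ultimately show ?thesis by (subst (asm) isCont_cong)
qed

lemma small_ball_mass:
  assumes M: "0 < M"
  obtains r where "0 < r" "(\<integral>\<^sup>+y. indicator (ball x r) y * ennreal (f y) \<partial>lborel) \<le> ennreal M"
proof -
  have "(\<lambda>n. \<integral>\<^sup>+y. indicator (ball x (1 / real (Suc n))) y * ennreal (f y) \<partial>lborel) \<longlonglongrightarrow> (\<integral>\<^sup>+(y::real^2). 0 \<partial>lborel)"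
  proof (rule nn_integral_dominated_convergence[where w="\<lambda>y. ennreal (f y)"])
    show "AE y in lborel. (\<lambda>n. indicator (ball x (1 / real (Suc n))) y * ennreal (f y)) \<longlonglongrightarrow> 0"
      using AE_lborel_singleton[of x]
    proof eventually_elim
      case (elim y)
      have "(\<lambda>n. 1 / real (Suc n)) \<longlonglongrightarrow> 0" by real_asymp
      then have "eventually (\<lambda>n. 1 / real (Suc n) < dist x y) sequentially"
        using elim by (intro order_tendstoD) auto
      then have "eventually (\<lambda>n. indicator (ball x (1 / real (Suc n))) y * ennreal (f y) = 0) sequentially"
        by eventually_elim simp
      then show ?case by (rule tendsto_eventually)
    qed
    show "AE y in lborel. indicator (ball x (1 / real (Suc n))) y * ennreal (f y) \<le> ennreal (f y)" for n
      by (auto split: split_indicator)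
    have [measurable]: "ball x (1 / real (Suc n)) \<in> sets borel" for n by simp
    show "(\<lambda>y. indicator (ball x (1 / real (Suc n))) y * ennreal (f y)) \<in> borel_measurable lborel" for n
      by measurable
  qed (use f_finite in auto)
  then have "eventually (\<lambda>n. (\<integral>\<^sup>+y. indicator (ball x (1 / real (Suc n))) y * ennreal (f y) \<partial>lborel) < ennreal M) sequentially"
    using M by (intro order_tendstoD) auto
  then obtain n where "(\<integral>\<^sup>+y. indicator (ball x (1 / real (Suc n))) y * ennreal (f y) \<partial>lborel) < ennreal M"
    using eventually_happens'[OF sequentially_bot] by blast
  then show ?thesis using that[of "1 / real (Suc n)"] by simp
qed

end

section \<open>Change of the representative on a null set\<close>

lemma mean_cong:
  assumes u: "weak_solution \<omega> u f" and v: "weak_solution \<omega> v g"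
    and ae: "AE y in lborel. y \<in> \<omega> \<longrightarrow> v y = u y" and "0 < r" "cball x r \<subseteq> \<omega>"
  shows "mean v r x = mean u r x"
  unfolding weak_solution.avg_def[OF u] weak_solution.avg_def[OF v]
proof (rule integral_cong_AE)
  note [measurable] = weak_solution.u_meas[OF u] weak_solution.u_meas[OF v]
  show "AE y in lborel. v y * mollifier r (y - x) = u y * mollifier r (y - x)"
    using ae
  proof eventually_elim
    case (elim y)
    show ?case
    proof (cases "y \<in> cball x r")
      case False
      then show ?thesis using assms by (simp add: mollifier_eq_0 dist_norm norm_minus_commute)
    qed (use elim assms in auto)
  qed
  show "(\<lambda>y. v y * mollifier r (y - x)) \<in> borel_measurable lborel"
    "(\<lambda>y. u y * mollifier r (y - x)) \<in> borel_measurable lborel" by measurable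
qed

lemma weak_solution_cong:
  assumes "weak_solution \<omega> u f" and [measurable]: "v \<in> borel_measurable borel"
    and ae: "AE y in lborel. y \<in> \<omega> \<longrightarrow> v y = u y"
  shows "weak_solution \<omega> v f"
proof -
  interpret weak_solution \<omega> u f by fact
  have [measurable]: "\<omega> \<in> sets borel" using open_\<omega> by simp
  show ?thesis
  proof
    fix K assume K: "compact K" "K \<subseteq> \<omega>"
    have [measurable]: "K \<in> sets borel" using K by (simp add: borel_compact)
    have "AE x in lborel. indicator K x * v x = indicator K x * u x"
      using ae by eventually_elim (use K in \<open>auto split: split_indicator\<close>)
    then show "integrable lborel (\<lambda>x. indicator K x * v x)"
      using u_int[OF K] by (subst integrable_cong_AE[where g="\<lambda>x. indicator K x * u x"]) auto
  next
    fix \<phi> :: "real^2 \<Rightarrow> real" assume \<phi>: "smooth \<phi>" "compactly_supported_in \<omega> \<phi>"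
    have [measurable]: "laplacian \<phi> \<in> borel_measurable borel"
    proof -
      have "partial_deriv i (partial_deriv i \<phi>) \<in> borel_measurable borel" for i
      proof -
        have "foldr partial_deriv [i, i] \<phi> differentiable_on UNIV" using \<phi>(1) by (simp add: smooth_def del: foldr.simps)
        then show ?thesis
          by (auto intro!: borel_measurable_continuous_onI differentiable_imp_continuous_on)
      qed
      then show ?thesis unfolding laplacian_def [abs_def] by measurable
    qed
    have "(LINT x|lborel. indicator \<omega> x * (v x * laplacian \<phi> x)) = (LINT x|lborel. indicator \<omega> x * (u x * laplacian \<phi> x))"
    proof (rule integral_cong_AE)
      show "AE x in lborel. indicator \<omega> x * (v x * laplacian \<phi> x) = indicator \<omega> x * (u x * laplacian \<phi> x)"
        using ae by eventually_elim (auto split: split_indicator)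
    qed measurable
    then show "- (LINT x|lborel. indicator \<omega> x * (v x * laplacian \<phi> x)) = (LINT x|lborel. f x * \<phi> x)"
      using weak[OF \<phi>] by simp
  qed (use open_\<omega> f_nonneg f_finite in auto)
qed

context hartree
begin

lemma sol_cong:
  assumes "sol u f X G" and [measurable]: "v \<in> borel_measurable borel"
    and ae: "AE y in lborel. y \<in> \<omega> \<longrightarrow> v y = u y"
  shows "sol v f X G"
proof -
  have "AE x in lborel. x \<in> \<omega> \<longrightarrow> G x = exp (v x / beta)"
    using ae solD(11)[OF assms(1)] by eventually_elim auto
  then show ?thesis
    using assms weak_solution_cong[OF _ assms(2) ae, of f] by (simp add: sol_def)
qed

text \<open>Here the representation holds at every point and for every admissible radius, not just
  almost everywhere. Point values can therefore be estimated, and since the potential is nonnegative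
  v dominates all its means.\<close>

definition csol :: "(real^2 \<Rightarrow> real) \<Rightarrow> (real^2 \<Rightarrow> real) \<Rightarrow> (real^2 \<Rightarrow> real) \<Rightarrow> (real^2 \<Rightarrow> real) \<Rightarrow> bool" where
  "csol v f X G \<longleftrightarrow> sol v f X G \<and> continuous_on \<omega> v \<and>
     (\<forall>x r. 0 < r \<longrightarrow> cball x r \<subseteq> \<omega> \<longrightarrow> log_pot f r x < \<infinity> \<and> v x = mean v r x + enn2real (log_pot f r x))"

text \<open>For a single integrable f every point has a disc of mass at most 2 pi beta, a convenient
  value below the threshold. The radius R depends on the solution but is fixed before \<delta>, so
  the potential tends to 0 uniformly on one neighbourhood.\<close>

lemma local_pot_small:
  assumes sol: "sol u f X G" and x0: "x0 \<in> \<omega>"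
  obtains R where "0 < R" "cball x0 (2 * R) \<subseteq> \<omega>"
    "\<And>\<delta>. 0 < \<delta> \<Longrightarrow> \<exists>\<rho>. 0 < \<rho> \<and> \<rho> \<le> R / 4 \<and> (\<forall>x\<in>ball x0 (R / 4). log_pot f \<rho> x \<le> ennreal \<delta>)"
proof -
  interpret weak_solution \<omega> u f using solD(1)[OF sol] .
  define M where "M = 2 * pi * beta"
  have M: "0 < M" "M < 4 * pi * beta" using exponents by (simp_all add: M_def)
  obtain r1 where r1: "0 < r1" "(\<integral>\<^sup>+y. indicator (ball x0 r1) y * ennreal (f y) \<partial>lborel) \<le> ennreal M"
    by (rule small_ball_mass[OF M(1)])
  obtain r2 where r2: "0 < r2" "cball x0 r2 \<subseteq> \<omega>" using open_\<omega> x0 open_contains_cball by blast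
  define R where "R = min r1 r2 / 2"
  have R: "0 < R" "2 * R \<le> r1" "2 * R \<le> r2" using r1 r2 by (auto simp: R_def)
  have sub: "cball x0 (2 * R) \<subseteq> \<omega>" using r2 R by (meson subset_cball subset_trans)
  have mass: "(\<integral>\<^sup>+y. indicator (ball x0 (2 * R)) y * ennreal (f y) \<partial>lborel) \<le> ennreal M"
  proof -
    have "(\<integral>\<^sup>+y. indicator (ball x0 (2 * R)) y * ennreal (f y) \<partial>lborel) \<le> (\<integral>\<^sup>+y. indicator (ball x0 r1) y * ennreal (f y) \<partial>lborel)"
      using R by (intro nn_integral_mono) (auto split: split_indicator)
    then show ?thesis using r1 by simp
  qed
  obtain \<sigma> C where \<sigma>: "1 / beta < \<sigma>" "0 \<le> C"
    "\<And>u f X G. sol u f X G \<Longrightarrow> (\<integral>\<^sup>+y. indicator (ball x0 (2 * R)) y * ennreal (f y) \<partial>lborel) \<le> ennreal M \<Longrightarrow>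
      (\<integral>\<^sup>+x. indicator (ball x0 R) x * ennreal (exp (\<sigma> * u x)) \<partial>lborel) \<le> ennreal C"
    by (rule exp_estimate[OF R(1) sub M]) (rule that; blast)
  have sub': "ball x0 R \<subseteq> \<omega>" using sub R by (auto simp: subset_iff)
  show ?thesis
  proof (rule that[OF R(1) sub])
    fix \<delta> :: real assume "0 < \<delta>"
    obtain \<rho> where "0 < \<rho>" "\<rho> \<le> R / 4"
      "\<And>u f X G x. sol u f X G \<Longrightarrow> (\<integral>\<^sup>+x. indicator (ball x0 R) x * ennreal (exp (\<sigma> * u x)) \<partial>lborel) \<le> ennreal C \<Longrightarrow>
        x \<in> ball x0 (R / 4) \<Longrightarrow> log_pot f \<rho> x \<le> ennreal \<delta>"
      by (rule pot_estimate[OF R(1) sub' \<sigma>(1) \<open>0 < \<delta>\<close> \<sigma>(2)]) (rule that; blast)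
    then show "\<exists>\<rho>. 0 < \<rho> \<and> \<rho> \<le> R / 4 \<and> (\<forall>x\<in>ball x0 (R / 4). log_pot f \<rho> x \<le> ennreal \<delta>)"
      using sol \<sigma>(3)[OF sol mass] by blast
  qed
qed

text \<open>Mean plus potential is finite at every point of omega and independent of the radius, so
  it defines v. On a neighbourhood of each point v is a uniform limit of means, which are
  continuous, because the potential of small radius is uniformly small there.\<close>

theorem continuous_representative_exists:
  assumes sol: "sol u f X G"
  obtains v where "csol v f X G" "AE x in lborel. x \<in> \<omega> \<longrightarrow> v x = u x"
proof -
  interpret weak_solution \<omega> u f using solD(1)[OF sol] .
  have small: "\<exists>e. 0 < e \<and> e \<le> r \<and> pot e x < \<infinity>" if "x \<in> \<omega>" "0 < r" for x r
  proof -
    obtain R where R: "0 < R" "cball x (2 * R) \<subseteq> \<omega>"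
      "\<And>\<delta>. 0 < \<delta> \<Longrightarrow> \<exists>\<rho>. 0 < \<rho> \<and> \<rho> \<le> R / 4 \<and> (\<forall>y\<in>ball x (R / 4). log_pot f \<rho> y \<le> ennreal \<delta>)"
      by (rule local_pot_small[OF sol \<open>x \<in> \<omega>\<close>]) (rule that; blast)
    obtain \<rho> where \<rho>: "0 < \<rho>" "\<forall>y\<in>ball x (R / 4). pot \<rho> y \<le> ennreal 1" using R(3)[of 1] by auto
    then have "pot \<rho> x \<le> ennreal 1" using R(1) by (simp del: ennreal_1)
    then have "pot \<rho> x < \<infinity>" by (rule le_less_trans) simp
    moreover have "pot (min \<rho> r) x \<le> pot \<rho> x"
      unfolding pot_def using \<rho> that f_nonneg
      by (intro nn_integral_mono ennreal_leI mult_left_mono log_kernel_mono) auto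
    ultimately show ?thesis using \<rho> that by (intro exI[of _ "min \<rho> r"]) auto
  qed
  have fin: "pot r x < \<infinity>" if "0 < r" "cball x r \<subseteq> \<omega>" for x r
  proof -
    have "x \<in> \<omega>" using that by (auto simp: subset_iff)
    then obtain e where "0 < e" "e \<le> r" "pot e x < \<infinity>" using small \<open>0 < r\<close> by blast
    then show ?thesis using representation_scale(1) that by blast
  qed
  have indep: "avg r x + enn2real (pot r x) = avg s x + enn2real (pot s x)"
    if "0 < r" "cball x r \<subseteq> \<omega>" "0 < s" "cball x s \<subseteq> \<omega>" for x r s
  proof -
    \<comment> \<open>Two radii are compared through the smaller one, from which
      \<open>representation_scale\<close> leads to both.\<close>
    define e where "e = min r s"
    have e: "0 < e" "e \<le> r" "e \<le> s" using that by (auto simp: e_def)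
    have "cball x e \<subseteq> \<omega>" using e that by (meson subset_cball subset_trans)
    then have "pot e x < \<infinity>" using fin e by blast
    then show ?thesis using representation_scale(2) e that by metis
  qed
  define rad where "rad x = (SOME r. 0 < r \<and> cball x r \<subseteq> \<omega>)" for x
  have rad: "0 < rad x" "cball x (rad x) \<subseteq> \<omega>" if "x \<in> \<omega>" for x
  proof -
    have "\<exists>r. 0 < r \<and> cball x r \<subseteq> \<omega>" using open_\<omega> that open_contains_cball by blast
    then have "0 < rad x \<and> cball x (rad x) \<subseteq> \<omega>" unfolding rad_def by (rule someI_ex)
    then show "0 < rad x" "cball x (rad x) \<subseteq> \<omega>" by auto
  qed
  define v where "v x = indicator \<omega> x *\<^sub>R (avg (rad x) x + enn2real (pot (rad x) x))" for x
  have v: "v x = avg r x + enn2real (pot r x)" if "0 < r" "cball x r \<subseteq> \<omega>" for x r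
  proof -
    have "x \<in> \<omega>" using that by (auto simp: subset_iff)
    then show ?thesis using indep[OF that rad] by (simp add: v_def)
  qed
  have cont: "continuous_on \<omega> v"
    unfolding continuous_on_eq_continuous_at[OF open_\<omega>]
  proof
    fix x0 assume x0: "x0 \<in> \<omega>"
    obtain R where R: "0 < R" "cball x0 (2 * R) \<subseteq> \<omega>"
      "\<And>\<delta>. 0 < \<delta> \<Longrightarrow> \<exists>\<rho>. 0 < \<rho> \<and> \<rho> \<le> R / 4 \<and> (\<forall>x\<in>ball x0 (R / 4). log_pot f \<rho> x \<le> ennreal \<delta>)"
      by (rule local_pot_small[OF sol x0]) (rule that; blast)
    show "isCont v x0"
      unfolding continuous_at_eps_delta
    proof (intro allI impI)
      fix e :: real assume e: "0 < e"
      obtain \<rho> where \<rho>: "0 < \<rho>" "\<rho> \<le> R / 4" "\<forall>x\<in>ball x0 (R / 4). pot \<rho> x \<le> ennreal (e / 3)"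
        using R(3)[of "e / 3"] e by auto
      have sub: "cball x \<rho> \<subseteq> \<omega>" if "x \<in> ball x0 (R / 4)" for x
      proof
        fix y assume "y \<in> cball x \<rho>"
        then have "y \<in> cball x0 (2 * R)" using that \<rho> R(1) dist_triangle[of x0 y x] by simp
        then show "y \<in> \<omega>" using R by blast
      qed
      have close: "\<bar>v x - avg \<rho> x\<bar> \<le> e / 3" if "x \<in> ball x0 (R / 4)" for x
      proof -
        have "pot \<rho> x \<le> ennreal (e / 3)" using \<rho>(3) that by blast
        then have "enn2real (pot \<rho> x) \<le> e / 3" using e by (intro enn2real_leI) auto
        then show ?thesis using v[OF \<rho>(1) sub[OF that]] by simp
      qed
      have "cball x0 (\<rho> + R) \<subseteq> cball x0 (2 * R)" using \<rho> R(1) by (intro subset_cball) simp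
      then have "isCont (avg \<rho>) x0" using isCont_avg[OF \<rho>(1) R(1)] R by blast
      then obtain d where d: "0 < d" "\<And>x. dist x x0 < d \<Longrightarrow> dist (avg \<rho> x) (avg \<rho> x0) < e / 3"
        unfolding continuous_at_eps_delta using e by (meson divide_pos_pos zero_less_numeral)
      show "\<exists>d>0. \<forall>x. dist x x0 < d \<longrightarrow> dist (v x) (v x0) < e"
      proof (intro exI[of _ "min d (R / 4)"] conjI allI impI)
        show "0 < min d (R / 4)" using d R by simp
        fix x assume x: "dist x x0 < min d (R / 4)"
        have "\<bar>avg \<rho> x - avg \<rho> x0\<bar> < e / 3" using d(2)[of x] x by (simp add: dist_real_def)
        moreover have "\<bar>v x - avg \<rho> x\<bar> \<le> e / 3" "\<bar>v x0 - avg \<rho> x0\<bar> \<le> e / 3"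
          using x R by (intro close; simp add: dist_commute)+
        ultimately show "dist (v x) (v x0) < e" unfolding dist_real_def by linarith
      qed
    qed
  qed
  have meas: "v \<in> borel_measurable borel"
  proof -
    have "(\<lambda>x. indicator \<omega> x *\<^sub>R v x) \<in> borel_measurable borel"
      using open_\<omega> cont by (intro borel_measurable_continuous_on_indicator) auto
    moreover have "(\<lambda>x. indicator \<omega> x *\<^sub>R v x) = v" by (auto simp: v_def fun_eq_iff indicator_def)
    ultimately show ?thesis by simp
  qed
  have ae: "AE x in lborel. x \<in> \<omega> \<longrightarrow> v x = u x"
  proof -
    have "AE x in lborel. \<forall>n. cball x (1 / real (Suc n)) \<subseteq> \<omega> \<longrightarrow>
        pot (1 / real (Suc n)) x < \<infinity> \<and> u x = avg (1 / real (Suc n)) x + enn2real (pot (1 / real (Suc n)) x)"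
      unfolding AE_all_countable by (intro allI AE_representation) simp
    then show ?thesis
    proof eventually_elim
      case (elim x)
      show ?case
      proof
        assume "x \<in> \<omega>"
        then obtain r where r: "0 < r" "cball x r \<subseteq> \<omega>" using open_\<omega> open_contains_cball by blast
        then obtain n where "1 / real (Suc n) < r" using nat_approx_posE by blast
        then have n: "cball x (1 / real (Suc n)) \<subseteq> \<omega>" using r by (meson less_imp_le subset_cball subset_trans)
        then show "v x = u x" using elim v[OF _ n] by simp
      qed
    qed
  qed
  have "csol v f X G"
    unfolding csol_def
  proof (intro conjI allI impI)
    show sol': "sol v f X G" by (rule sol_cong[OF sol meas ae])
    fix x r assume r: "0 < r" "cball x r \<subseteq> \<omega>"
    show "log_pot f r x < \<infinity>" using fin r by blast
    show "v x = mean v r x + enn2real (log_pot f r x)"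
      using v[OF r] mean_cong[OF solD(1)[OF sol] solD(1)[OF sol'] ae r] by simp
  qed (rule cont)
  then show ?thesis using that ae by blast
qed

section \<open>Pointwise estimates: upper bound, Harnack inequality, minimum principle\<close>

lemma csolD:
  assumes "csol v f X G"
  shows "sol v f X G" "weak_solution \<omega> v f" "continuous_on \<omega> v"
    "0 < r \<Longrightarrow> cball x r \<subseteq> \<omega> \<Longrightarrow> log_pot f r x < \<infinity>"
    "0 < r \<Longrightarrow> cball x r \<subseteq> \<omega> \<Longrightarrow> v x = mean v r x + enn2real (log_pot f r x)"
    "0 < r \<Longrightarrow> cball x r \<subseteq> \<omega> \<Longrightarrow> mean v r x \<le> v x"
  using assms solD(1) by (auto simp: csol_def)

text \<open>In v = mean + potential the mean is bounded for the whole class, and below the critical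
  mass the exponential estimate makes the potential at some small radius at most 1.\<close>

lemma local_upper_bound:
  assumes R: "0 < R" and sub: "cball x0 (2 * R) \<subseteq> \<omega>" and M: "0 < M" "M < 4 * pi * beta"
  obtains C where "\<And>v f X G x. csol v f X G \<Longrightarrow> (\<integral>\<^sup>+y. indicator (ball x0 (2 * R)) y * ennreal (f y) \<partial>lborel) \<le> ennreal M \<Longrightarrow>
      x \<in> ball x0 (R / 4) \<Longrightarrow> v x \<le> C"
proof -
  obtain \<sigma> C where \<sigma>: "1 / beta < \<sigma>" "0 \<le> C"
    "\<And>u f X G. sol u f X G \<Longrightarrow> (\<integral>\<^sup>+y. indicator (ball x0 (2 * R)) y * ennreal (f y) \<partial>lborel) \<le> ennreal M \<Longrightarrow>
      (\<integral>\<^sup>+x. indicator (ball x0 R) x * ennreal (exp (\<sigma> * u x)) \<partial>lborel) \<le> ennreal C"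
    by (rule exp_estimate[OF R(1) sub M]) (rule that; blast)
  have sub': "ball x0 R \<subseteq> \<omega>" using sub R by (auto simp: subset_iff)
  obtain \<rho> where \<rho>: "0 < \<rho>" "\<rho> \<le> R / 4"
      "\<And>u f X G x. sol u f X G \<Longrightarrow> (\<integral>\<^sup>+x. indicator (ball x0 R) x * ennreal (exp (\<sigma> * u x)) \<partial>lborel) \<le> ennreal C \<Longrightarrow>
        x \<in> ball x0 (R / 4) \<Longrightarrow> log_pot f \<rho> x \<le> ennreal 1"
    by (rule pot_estimate[OF R(1) sub' \<sigma>(1) zero_less_one \<sigma>(2)]) (rule that; blast)
  obtain C1 where C1: "\<And>u f X G x. sol u f X G \<Longrightarrow> cball x \<rho> \<subseteq> \<omega> \<Longrightarrow> mean u \<rho> x \<le> C1"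
    by (rule mean_le[OF \<rho>(1)]) (rule that; blast)
  show ?thesis
  proof (rule that[of "C1 + 1"])
    fix v f X G x
    assume csol: "csol v f X G" and mass: "(\<integral>\<^sup>+y. indicator (ball x0 (2 * R)) y * ennreal (f y) \<partial>lborel) \<le> ennreal M"
      and x: "x \<in> ball x0 (R / 4)"
    note sol = csolD(1)[OF csol]
    have "cball x \<rho> \<subseteq> cball x0 (2 * R)"
    proof
      fix y assume "y \<in> cball x \<rho>"
      then show "y \<in> cball x0 (2 * R)" using x \<rho> R(1) dist_triangle[of x0 y x] by simp
    qed
    then have xr: "cball x \<rho> \<subseteq> \<omega>" using sub by blast
    have "enn2real (log_pot f \<rho> x) \<le> 1"
      using \<rho>(3)[OF sol \<sigma>(3)[OF sol mass] x] by (simp add: enn2real_leI)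
    then show "v x \<le> C1 + 1"
      using csolD(5)[OF csol \<rho>(1) xr] C1[OF sol xr] by linarith
  qed
qed

lemma integral_mollifier:
  assumes "0 < r"
  shows "integrable lborel (\<lambda>y. mollifier r (y - x))" "(LINT y|lborel. mollifier r (y - x)) = 1"
  using nn_integral_mollifier_translate(1)[OF assms, of x]
  by (auto intro!: integrableI_nonneg simp: mollifier_nonneg integral_eq_nn_integral)

text \<open>The upper bound C makes C - v nonnegative and the potential at radius \<rho> at most 1.
  Hence C - v y is at most its mean over the small disc at y, which is at most q times its mean over
  the larger disc at x, which is at most q (C - v x + 1).\<close>

lemma harnack:
  assumes R: "0 < R" and sub: "cball x0 R \<subseteq> \<omega>"
  obtains s where "0 < s" "s \<le> R" "\<And>M. \<exists>C'. \<forall>v f X G. csol v f X G \<longrightarrow> (\<forall>x\<in>ball x0 R. v x \<le> C) \<longrightarrow>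
     (\<forall>x\<in>ball x0 s. \<forall>y\<in>ball x0 s. - M \<le> v x \<longrightarrow> - C' \<le> v y)"
proof -
  \<comment> \<open>Since v is bounded above, every exponential moment is bounded; any exponent
    above 1 / beta serves for the potential estimate.\<close>
  define \<sigma> where "\<sigma> = 1 / beta + 1"
  have \<sigma>: "1 / beta < \<sigma>" "0 < \<sigma>" using exponents by (auto simp: \<sigma>_def add_pos_pos)
  have sub': "ball x0 R \<subseteq> \<omega>" using sub by auto
  define mb where "mb = measure lborel (ball x0 R)"
  have mb: "emeasure lborel (ball x0 R) = ennreal mb"
    unfolding mb_def using emeasure_bounded_finite[OF bounded_ball] by (intro emeasure_eq_ennreal_measure) (auto simp: less_top)
  define Cs where "Cs = exp (\<sigma> * C) * mb"
  have Cs: "0 \<le> Cs" by (simp add: Cs_def mb_def)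
  obtain \<rho> where \<rho>: "0 < \<rho>" "\<rho> \<le> R / 4"
      "\<And>u f X G x. sol u f X G \<Longrightarrow> (\<integral>\<^sup>+x. indicator (ball x0 R) x * ennreal (exp (\<sigma> * u x)) \<partial>lborel) \<le> ennreal Cs \<Longrightarrow>
        x \<in> ball x0 (R / 4) \<Longrightarrow> log_pot f \<rho> x \<le> ennreal 1"
    by (rule pot_estimate[OF R(1) sub' \<sigma>(1) zero_less_one Cs]) (rule that; blast)
  obtain B b' :: real where B: "0 < B" "0 < b'" "\<And>r z. 0 < r \<Longrightarrow> mollifier r z \<le> B / r\<^sup>2"
    "\<And>r z. 0 < r \<Longrightarrow> norm z \<le> 3 / 4 * r \<Longrightarrow> b' / r\<^sup>2 \<le> mollifier r z"
    using mollifier_bounds by metis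
  \<comment> \<open>The ratio between B / (\<rho> / 4)^2, the largest value of the small mollifier,
    and b' / \<rho>^2, the smallest value of the large one on the small disc.\<close>
  define q where "q = 16 * B / b'"
  have q: "0 < q" using B by (simp add: q_def)
  have main: "- (q * (C + M + 1) - C) \<le> v y"
    if csol: "csol v f X G" and up: "\<forall>x\<in>ball x0 R. v x \<le> C"
      and x: "x \<in> ball x0 (\<rho> / 4)" and y: "y \<in> ball x0 (\<rho> / 4)" and vx: "- M \<le> v x" for v f X G x y M
  proof -
    note sol = csolD(1)[OF csol]
    interpret weak_solution \<omega> v f using csolD(2)[OF csol] .
    have subx: "cball x \<rho> \<subseteq> ball x0 R"
    proof
      fix z assume "z \<in> cball x \<rho>"
      then show "z \<in> ball x0 R" using x \<rho> R dist_triangle[of x0 z x] by simp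
    qed
    then have x\<omega>: "cball x \<rho> \<subseteq> \<omega>" using sub' by blast
    have "cball y (\<rho> / 4) \<subseteq> ball x0 R"
    proof
      fix z assume "z \<in> cball y (\<rho> / 4)"
      then show "z \<in> ball x0 R" using y \<rho> R dist_triangle[of x0 z y] by simp
    qed
    then have y\<omega>: "cball y (\<rho> / 4) \<subseteq> \<omega>" using sub' by blast
    have "(\<integral>\<^sup>+x. indicator (ball x0 R) x * ennreal (exp (\<sigma> * v x)) \<partial>lborel) \<le> (\<integral>\<^sup>+x. ennreal (exp (\<sigma> * C)) * indicator (ball x0 R) x \<partial>lborel)"
      using up \<sigma> by (intro nn_integral_mono) (auto split: split_indicator intro!: ennreal_leI)
    also have "\<dots> = ennreal Cs" by (subst nn_integral_cmult_indicator) (auto simp: mb Cs_def mb_def simp flip: ennreal_mult)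
    finally have "log_pot f \<rho> x \<le> ennreal 1"
      using x \<rho> R by (intro \<rho>(3)[OF sol]) auto
    then have "enn2real (log_pot f \<rho> x) \<le> 1" by (simp add: enn2real_leI)
    then have mx: "- M - 1 \<le> avg \<rho> x" using csolD(5)[OF csol \<rho>(1) x\<omega>] vx by linarith
    have "(LINT z|lborel. C * mollifier (\<rho> / 4) (z - y) - v z * mollifier (\<rho> / 4) (z - y))
      \<le> (LINT z|lborel. q * (C * mollifier \<rho> (z - x) - v z * mollifier \<rho> (z - x)))"
    proof (rule integral_mono)
      show "integrable lborel (\<lambda>z. C * mollifier (\<rho> / 4) (z - y) - v z * mollifier (\<rho> / 4) (z - y))"
        using \<rho>(1) y\<omega> by (intro Bochner_Integration.integrable_diff integrable_mult_right integral_mollifier integrable_u_mollifier) auto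
      show "integrable lborel (\<lambda>z. q * (C * mollifier \<rho> (z - x) - v z * mollifier \<rho> (z - x)))"
        using \<rho>(1) x\<omega> by (intro Bochner_Integration.integrable_diff integrable_mult_right integral_mollifier integrable_u_mollifier) auto
      fix z
      have "(C - v z) * mollifier (\<rho> / 4) (z - y) \<le> (C - v z) * (q * mollifier \<rho> (z - x))"
      proof (cases "norm (z - y) \<le> \<rho> / 4")
        case True
        \<comment> \<open>The centres x and y are less than \<rho> / 2 apart, so the disc of radius
          \<rho> / 4 at y lies within 3/4 \<rho> of x, where the larger mollifier is bounded
          below.\<close>
        have "norm (z - x) \<le> 3 / 4 * \<rho>"
          using True x y dist_triangle[of z x y] dist_triangle[of y x x0] by (simp add: dist_norm norm_minus_commute)
        then have ge: "b' / \<rho>\<^sup>2 \<le> mollifier \<rho> (z - x)" using \<rho> B by blast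
        have "mollifier (\<rho> / 4) (z - y) \<le> B / (\<rho> / 4)\<^sup>2" using \<rho> B by simp
        also have "\<dots> = q * (b' / \<rho>\<^sup>2)" using B by (simp add: q_def power2_eq_square)
        also have "\<dots> \<le> q * mollifier \<rho> (z - x)" using ge q by (intro mult_left_mono) auto
        finally have le: "mollifier (\<rho> / 4) (z - y) \<le> q * mollifier \<rho> (z - x)" .
        have "z \<in> cball x \<rho>" using \<open>norm (z - x) \<le> 3 / 4 * \<rho>\<close> \<rho> by (simp add: dist_norm norm_minus_commute)
        then have "0 \<le> C - v z" using up subx by auto
        then show ?thesis using le by (rule mult_left_mono[rotated])
      next
        case False
        then have 0: "mollifier (\<rho> / 4) (z - y) = 0" using \<rho> by (simp add: mollifier_eq_0)
        show ?thesis
        proof (cases "z \<in> cball x \<rho>")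
          case True
          then have "0 \<le> C - v z" using up subx by auto
          then show ?thesis using 0 q mollifier_nonneg[of \<rho> "z - x"] by simp
        next
          case False
          then have "mollifier \<rho> (z - x) = 0" using \<rho> by (simp add: mollifier_eq_0 dist_norm norm_minus_commute)
          then show ?thesis using 0 by simp
        qed
      qed
      then show "C * mollifier (\<rho> / 4) (z - y) - v z * mollifier (\<rho> / 4) (z - y) \<le> q * (C * mollifier \<rho> (z - x) - v z * mollifier \<rho> (z - x))"
        by (simp add: algebra_simps)
    qed
    also have "(LINT z|lborel. C * mollifier (\<rho> / 4) (z - y) - v z * mollifier (\<rho> / 4) (z - y)) = C - avg (\<rho> / 4) y"
      unfolding avg_def using \<rho>(1) y\<omega>
      by (subst Bochner_Integration.integral_diff) (auto intro!: integral_mollifier integrable_u_mollifier simp: integral_mollifier)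
    also have "(LINT z|lborel. q * (C * mollifier \<rho> (z - x) - v z * mollifier \<rho> (z - x))) = q * (C - avg \<rho> x)"
      unfolding avg_def using \<rho>(1) x\<omega>
      by (subst integral_mult_right_zero, subst Bochner_Integration.integral_diff)
        (auto intro!: integral_mollifier integrable_u_mollifier simp: integral_mollifier)
    also have "q * (C - avg \<rho> x) \<le> q * (C + M + 1)" using mx q by (intro mult_left_mono) auto
    finally have "C - avg (\<rho> / 4) y \<le> q * (C + M + 1)" .
    moreover have "avg (\<rho> / 4) y \<le> v y" using csolD(6)[OF csol _ y\<omega>] \<rho> by simp
    ultimately show ?thesis by linarith
  qed
  show ?thesis
  proof (rule that[of "\<rho> / 4"])
    show "0 < \<rho> / 4" "\<rho> / 4 \<le> R" using \<rho> R by auto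
    fix M
    show "\<exists>C'. \<forall>v f X G. csol v f X G \<longrightarrow> (\<forall>x\<in>ball x0 R. v x \<le> C) \<longrightarrow>
     (\<forall>x\<in>ball x0 (\<rho> / 4). \<forall>y\<in>ball x0 (\<rho> / 4). - M \<le> v x \<longrightarrow> - C' \<le> v y)"
      using main by blast
  qed
qed

lemma csol_mass:
  obtains C1 where "0 \<le> C1" "\<And>v f X G. csol v f X G \<Longrightarrow> (\<integral>\<^sup>+x. ennreal (f x) \<partial>lborel) \<le> ennreal C1"
proof -
  define C where "C = c0 * ((CX + CG) * (pi / (1 - \<mu> / 2) + CG + pi / (\<mu> / 2 / (1 - b) - 1)) + CG * (pi / (1 - \<mu> / 2) + (CX + CG) + pi / (\<mu> / 2 / (1 - (a0 + b)) - 1)))"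
  show ?thesis
  proof (rule that[of "max 0 C"])
    fix v f X G assume csol: "csol v f X G"
    note sol = csolD(1)[OF csol]
    have "(\<integral>\<^sup>+x. ennreal (f x) \<partial>lborel) \<le> ennreal C"
      unfolding C_def by (rule mass_bound_ae[OF solD(2,3,5)[OF sol] solD(6,7)[OF sol] solD(9,10)[OF sol] solD(12,13)[OF sol]])
    also have "\<dots> \<le> ennreal (max 0 C)" by (intro ennreal_leI) simp
    finally show "(\<integral>\<^sup>+x. ennreal (f x) \<partial>lborel) \<le> ennreal (max 0 C)" .
  qed simp
qed

text \<open>The minimum over the large disc is compared with the mean over a disc which reaches far into
  the annulus.\<close>

lemma minimum_principle:
  assumes csol: "csol v f X G" and R: "0 < R" and sub: "cball a (3 * R) \<subseteq> \<omega>"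
    and annulus: "\<And>y. R \<le> dist a y \<Longrightarrow> dist a y \<le> 3 * R \<Longrightarrow> - C \<le> v y"
    and y: "y \<in> cball a (3 * R)"
  shows "- C \<le> v y"
proof -
  interpret weak_solution \<omega> v f using csolD(2)[OF csol] .
  have "\<exists>x\<in>cball a (3 * R). \<forall>y\<in>cball a (3 * R). v x \<le> v y"
    using R csolD(3)[OF csol] sub by (intro continuous_attains_inf) (auto intro: continuous_on_subset)
  then obtain x where x: "x \<in> cball a (3 * R)" "\<And>y. y \<in> cball a (3 * R) \<Longrightarrow> v x \<le> v y" by blast
  have "- C \<le> v x"
  proof (rule ccontr)
    assume "\<not> - C \<le> v x"
    then have neg: "v x < - C" by simp
    then have xa: "dist a x < R" using annulus[of x] x(1) by force
    have subx: "cball x (2 * R) \<subseteq> cball a (3 * R)"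
    proof
      fix z assume "z \<in> cball x (2 * R)"
      then show "z \<in> cball a (3 * R)" using xa dist_triangle[of a z x] by simp
    qed
    obtain e :: "real^2" where e: "norm e = 1" "x - a = norm (x - a) *\<^sub>R e"
    proof (cases "x = a")
      case True
      obtain e :: "real^2" where "norm e = 1" using vector_choose_size[of 1] by auto
      then show ?thesis using that True by simp
    next
      case False
      then show ?thesis using that[of "sgn (x - a)"] by (simp add: sgn_div_norm norm_minus_commute)
    qed
    \<comment> \<open>p lies beyond x on the ray from a, at distance 5/4 R from x with |x - a| < R.
      The disc of radius R / 4 around p is then inside the annulus and within 3/2 R = 3/4 (2 R) of
      x.\<close>
    define p where "p = x + (5 / 4 * R) *\<^sub>R e"
    have pa: "dist a p = norm (x - a) + 5 / 4 * R"
    proof -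
      have "p - a = (norm (x - a) + 5 / 4 * R) *\<^sub>R e"
        using e(2) by (simp add: p_def algebra_simps)
      then have "norm (p - a) = \<bar>norm (x - a) + 5 / 4 * R\<bar>" using e(1) by simp
      then show ?thesis using R by (simp add: dist_norm norm_minus_commute)
    qed
    have px: "dist x p = 5 / 4 * R" using e(1) R by (simp add: p_def dist_norm)
    obtain B b' :: real where B: "0 < b'" "\<And>r z. 0 < r \<Longrightarrow> norm z \<le> 3 / 4 * r \<Longrightarrow> b' / r\<^sup>2 \<le> mollifier r z"
      using mollifier_bounds by metis
    \<comment> \<open>On the disc around p, v exceeds the minimum by at least - C - v x and the
      mollifier is at least b' / (2 R)^2. Their product is a positive excess of the mean over v x,
      against the fact that v dominates its means.\<close>
    define \<kappa> where "\<kappa> = (- C - v x) * (b' / (2 * R)\<^sup>2)"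
    have \<kappa>: "0 < \<kappa>" using neg B R by (simp add: \<kappa>_def)
    have x\<omega>: "cball x (2 * R) \<subseteq> \<omega>" using subx sub by blast
    have R2: "0 < 2 * R" using R by simp
    have fin: "emeasure lborel (ball p (R / 4)) < \<infinity>" using emeasure_bounded_finite[OF bounded_ball] by simp
    have "v x + \<kappa> * measure lborel (ball p (R / 4))
       = (LINT y|lborel. v x * mollifier (2 * R) (y - x) + \<kappa> * indicator (ball p (R / 4)) y)"
      using integral_mollifier[OF R2, of x] fin by simp
    also have "\<dots> \<le> (LINT y|lborel. v y * mollifier (2 * R) (y - x))"
    proof (rule integral_mono)
      show "integrable lborel (\<lambda>y. v x * mollifier (2 * R) (y - x) + \<kappa> * indicator (ball p (R / 4)) y)"
        using fin by (intro Bochner_Integration.integrable_add integrable_mult_right integral_mollifier R2 integrable_real_indicator) auto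
      show "integrable lborel (\<lambda>y. v y * mollifier (2 * R) (y - x))" by (rule integrable_u_mollifier[OF R2 x\<omega>])
      fix z
      show "v x * mollifier (2 * R) (z - x) + \<kappa> * indicator (ball p (R / 4)) z \<le> v z * mollifier (2 * R) (z - x)"
      proof (cases "z \<in> ball p (R / 4)")
        case True
        have zx: "norm (z - x) \<le> 3 / 4 * (2 * R)"
          using True px dist_triangle[of x z p] by (simp add: dist_norm norm_minus_commute)
        have "R \<le> dist a z" "dist a z \<le> 3 * R"
        proof -
          have "dist p z < R / 4" "norm (x - a) < R" using True xa by (simp_all add: dist_norm norm_minus_commute)
          then show "R \<le> dist a z" "dist a z \<le> 3 * R"
            using pa R dist_triangle[of a p z] dist_triangle[of a z p] norm_ge_zero[of "x - a"] dist_commute[of z p]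
            by linarith+
        qed
        then have "- C \<le> v z" by (rule annulus)
        have "\<kappa> \<le> (- C - v x) * mollifier (2 * R) (z - x)"
          unfolding \<kappa>_def using neg B(2)[OF R2 zx] by (intro mult_left_mono) auto
        also have "\<dots> \<le> (v z - v x) * mollifier (2 * R) (z - x)"
          using \<open>- C \<le> v z\<close> by (intro mult_right_mono mollifier_nonneg) auto
        finally show ?thesis using True by (simp add: algebra_simps)
      next
        case False
        have "v x * mollifier (2 * R) (z - x) \<le> v z * mollifier (2 * R) (z - x)"
        proof (cases "z \<in> cball x (2 * R)")
          case True
          then show ?thesis using x(2) subx by (intro mult_right_mono mollifier_nonneg) auto
        next
          case False
          then have "mollifier (2 * R) (z - x) = 0" using R by (simp add: mollifier_eq_0 dist_norm norm_minus_commute)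
          then show ?thesis by simp
        qed
        then show ?thesis using False by simp
      qed
    qed
    also have "\<dots> \<le> v x" using csolD(6)[OF csol R2 x\<omega>] by (simp add: avg_def)
    finally have "\<kappa> * measure lborel (ball p (R / 4)) \<le> 0" by simp
    moreover have "0 < measure lborel (ball p (R / 4))"
      using R content_ball_pos[of "R / 4" p] by simp
    ultimately show False using \<kappa> by (simp add: mult_le_0_iff)
  qed
  then show ?thesis using x(2)[OF y] by linarith
qed

text \<open>Nearly critical mass M in the disc of radius \<rho>, together with a lower bound on the
  annulus, forces exp (v / beta) to dominate a multiple of |x - a|^(-2) for \<rho> <= |x - a| <=
  \<tau>. The integral over that range grows like ln (\<tau> / \<rho>), and \<rho> is chosen so
  small that it exceeds CG.\<close>

lemma no_bounded_concentration:
  assumes R: "0 < R" and sub: "cball a (3 * R) \<subseteq> \<omega>"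
  obtains M \<rho> where "0 < M" "M < 4 * pi * beta" "0 < \<rho>" "\<rho> < R"
    "\<And>v f X G. csol v f X G \<Longrightarrow> (\<And>y. R \<le> dist a y \<Longrightarrow> dist a y \<le> 3 * R \<Longrightarrow> - C \<le> v y) \<Longrightarrow>
      (\<integral>\<^sup>+y. indicator (ball a \<rho>) y * ennreal (f y) \<partial>lborel) < ennreal M"
proof -
  \<comment> \<open>\<tau> = R / e makes ln (2 R / (e |y - x|)) >= ln (\<tau> / |x - a|) as soon as
    |y - x| <= 2 |x - a|.\<close>
  define \<tau> where "\<tau> = R / exp 1"
  have \<tau>: "0 < \<tau>" "\<tau> < R" using R by (auto simp: \<tau>_def field_simps)
  \<comment> \<open>\<Lambda> is the logarithmic width ln (\<tau>^2 / \<rho>^2) of the range, taken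
    large enough for the resulting integral to exceed CG.\<close>
  define \<Lambda> where "\<Lambda> = 2 * (CG + 1) * exp (C / beta) / (pi * \<tau>\<^sup>2) + 2"
  have \<Lambda>: "2 \<le> \<Lambda>" "CG < exp (- C / beta) / 2 * (pi * (\<tau>\<^sup>2 * \<Lambda>))"
  proof -
    show "2 \<le> \<Lambda>" using CG \<tau> by (simp add: \<Lambda>_def)
    have "CG < exp (- C / beta) / 2 * (pi * (\<tau>\<^sup>2 * (2 * (CG + 1) * exp (C / beta) / (pi * \<tau>\<^sup>2))))"
      using \<tau> by (simp add: exp_minus field_simps)
    also have "\<dots> \<le> exp (- C / beta) / 2 * (pi * (\<tau>\<^sup>2 * \<Lambda>))"
      unfolding \<Lambda>_def by (intro mult_left_mono) auto
    finally show "CG < exp (- C / beta) / 2 * (pi * (\<tau>\<^sup>2 * \<Lambda>))" .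
  qed
  define \<rho> where "\<rho> = \<tau> * exp (- \<Lambda> / 2)"
  have \<rho>: "0 < \<rho>" "\<rho> < \<tau>" using \<tau> \<Lambda> by (auto simp: \<rho>_def)
  have \<rho>2: "\<rho>\<^sup>2 = \<tau>\<^sup>2 * exp (- \<Lambda>)" by (simp add: \<rho>_def power_mult_distrib flip: exp_double)
  \<comment> \<open>The relative defect of M below 4 pi beta. It costs a factor (\<tau>^2 / |x -
    a|^2)^d <= exp (d \<Lambda>) = 2 in the lower bound for exp (v / beta).\<close>
  define d where "d = ln 2 / \<Lambda>"
  have d: "0 < d" "d < 1" using \<Lambda> ln_2_less_1 by (auto simp: d_def field_simps)
  define M where "M = 4 * pi * beta * (1 - d)"
  have pos: "0 < 4 * pi * beta" using exponents(8) by simp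
  have "4 * pi * beta * (1 - d) < 4 * pi * beta * 1" using pos d by (intro mult_strict_left_mono) auto
  then have M: "0 < M" "M < 4 * pi * beta" using pos d by (simp_all add: M_def)
  have "(\<integral>\<^sup>+y. indicator (ball a \<rho>) y * ennreal (f y) \<partial>lborel) < ennreal M"
    if csol: "csol v f X G" and ann: "\<And>y. R \<le> dist a y \<Longrightarrow> dist a y \<le> 3 * R \<Longrightarrow> - C \<le> v y" for v f X G
  proof (rule ccontr)
    assume "\<not> ?thesis"
    then have mass: "ennreal M \<le> (\<integral>\<^sup>+y. indicator (ball a \<rho>) y * ennreal (f y) \<partial>lborel)" by simp
    note sol = csolD(1)[OF csol]
    interpret weak_solution \<omega> v f using csolD(2)[OF csol] .
    note [measurable] = u_meas f_meas solD(3)[OF sol]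
    have [measurable]: "ball a \<rho> \<in> sets borel" by simp
    have low: "- C \<le> v y" if "y \<in> cball a (3 * R)" for y
      using minimum_principle[OF csol R sub ann that] .
    have R2: "0 < 2 * R" using R by simp
    have lower: "ennreal (exp (- C / beta) / 2 * (\<tau>\<^sup>2 / (norm (x - a))\<^sup>2)) \<le> ennreal (exp (v x / beta))"
      if x: "\<rho>\<^sup>2 \<le> (norm (x - a))\<^sup>2" "(norm (x - a))\<^sup>2 \<le> \<tau>\<^sup>2" for x
    proof -
      define D where "D = norm (x - a)"
      have D: "\<rho> \<le> D" "D \<le> \<tau>" "0 < D"
        using x \<rho> \<tau> power2_le_imp_le[of \<rho> D] power2_le_imp_le[of D \<tau>] by (auto simp: D_def)
      have "cball x (2 * R) \<subseteq> cball a (3 * R)"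
      proof
        fix z assume "z \<in> cball x (2 * R)"
        then show "z \<in> cball a (3 * R)" using D \<tau> dist_triangle[of a z x] by (simp add: D_def dist_norm norm_minus_commute)
      qed
      then have x\<omega>: "cball x (2 * R) \<subseteq> \<omega>" and xlow: "\<And>z. z \<in> cball x (2 * R) \<Longrightarrow> - C \<le> v z" using sub low by auto
      have avg_low: "- C \<le> avg (2 * R) x"
      proof -
        have "- C = (LINT z|lborel. - C * mollifier (2 * R) (z - x))"
          using integral_mollifier[OF R2, of x] by simp
        also have "\<dots> \<le> avg (2 * R) x"
          unfolding avg_def
        proof (rule integral_mono)
          show "integrable lborel (\<lambda>z. - C * mollifier (2 * R) (z - x))"
            by (intro integrable_mult_right integral_mollifier R2)
          show "integrable lborel (\<lambda>y. v y * mollifier (2 * R) (y - x))" by (rule integrable_u_mollifier[OF R2 x\<omega>])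
          fix z
          show "- C * mollifier (2 * R) (z - x) \<le> v z * mollifier (2 * R) (z - x)"
          proof (cases "z \<in> cball x (2 * R)")
            case True
            then show ?thesis using xlow by (intro mult_right_mono mollifier_nonneg) auto
          next
            case False
            then have "mollifier (2 * R) (z - x) = 0" using R by (simp add: mollifier_eq_0 dist_norm norm_minus_commute)
            then show ?thesis by simp
          qed
        qed
        finally show ?thesis .
      qed
      define L where "L = ln (\<tau> / D) / (2 * pi)"
      have L: "0 \<le> L" using D \<tau> by (simp add: L_def)
      have "ennreal (M * L) = ennreal M * ennreal L" using M L by (intro ennreal_mult) auto
      also have "\<dots> \<le> (\<integral>\<^sup>+y. indicator (ball a \<rho>) y * ennreal (f y) \<partial>lborel) * ennreal L"
        by (rule mult_right_mono[OF mass]) simp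
      also have "\<dots> = (\<integral>\<^sup>+y. indicator (ball a \<rho>) y * ennreal (f y) * ennreal L \<partial>lborel)"
        by (rule nn_integral_multc[symmetric]) measurable
      also have "\<dots> \<le> pot (2 * R) x"
        unfolding pot_def
      proof (rule nn_integral_mono)
        fix y
        show "indicator (ball a \<rho>) y * ennreal (f y) * ennreal L \<le> ennreal (f y * log_kernel (2 * R) (y - x))"
        proof (cases "y \<in> ball a \<rho>")
          case True
          have ne: "y - x \<noteq> 0" using True D by (auto simp: D_def dist_norm norm_minus_commute)
          \<comment> \<open>Both y and x are within D = |x - a| of a, because |y - a| < \<rho> <=
            D.\<close>
          have "norm (y - x) \<le> 2 * D"
            using True D dist_triangle[of y x a] by (simp add: D_def dist_norm norm_minus_commute)
          then have "\<tau> / D \<le> 2 * R / (exp 1 * norm (y - x))"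
            using ne D R by (simp add: \<tau>_def field_simps)
          then have "ln (\<tau> / D) \<le> ln (2 * R / (exp 1 * norm (y - x)))"
            using \<tau> D by (intro ln_mono) auto
          then have "L \<le> log_kernel (2 * R) (y - x)"
            using log_kernel_ge[OF R2 ne] by (simp add: L_def field_simps)
          then have "f y * L \<le> f y * log_kernel (2 * R) (y - x)" using f_nonneg by (intro mult_left_mono) auto
          then show ?thesis using True L f_nonneg by (simp add: ennreal_leI flip: ennreal_mult)
        qed simp
      qed
      finally have "enn2real (ennreal (M * L)) \<le> enn2real (pot (2 * R) x)"
        by (rule enn2real_mono) (use csolD(4)[OF csol R2 x\<omega>] in simp)
      then have "M * L \<le> enn2real (pot (2 * R) x)" using M L by simp
      then have "- C + M * L \<le> v x"
        using avg_low csolD(5)[OF csol R2 x\<omega>] by linarith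
      then have "exp ((- C + M * L) / beta) \<le> exp (v x / beta)"
        using exponents by (simp add: divide_right_mono)
      moreover have "exp (- C / beta) / 2 * (\<tau>\<^sup>2 / D\<^sup>2) \<le> exp ((- C + M * L) / beta)"
      proof -
        have "M * L / beta = (1 - d) * (2 * ln (\<tau> / D))"
          using exponents(8) by (simp add: M_def L_def)
        also have "\<dots> = 2 * ln (\<tau> / D) - d * (2 * ln (\<tau> / D))" by (simp add: algebra_simps)
        also have "2 * ln (\<tau> / D) = ln (\<tau>\<^sup>2 / D\<^sup>2)"
          using D \<tau> by (simp add: ln_realpow flip: power_divide)
        finally have exponent_eq: "M * L / beta = ln (\<tau>\<^sup>2 / D\<^sup>2) - d * ln (\<tau>\<^sup>2 / D\<^sup>2)" .
        have "\<tau>\<^sup>2 / D\<^sup>2 \<le> exp \<Lambda>"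
          using x(1) \<rho>2 D by (simp add: D_def[symmetric] exp_minus field_simps)
        then have "ln (\<tau>\<^sup>2 / D\<^sup>2) \<le> ln (exp \<Lambda>)" using D \<tau> by (intro ln_mono) auto
        then have "d * ln (\<tau>\<^sup>2 / D\<^sup>2) \<le> d * \<Lambda>" using d by (intro mult_left_mono) auto
        also have "d * \<Lambda> = ln 2" using \<Lambda> by (simp add: d_def)
        finally have "ln (\<tau>\<^sup>2 / D\<^sup>2) - ln 2 \<le> M * L / beta" using exponent_eq by linarith
        then have "exp (ln (\<tau>\<^sup>2 / D\<^sup>2) - ln 2) \<le> exp (M * L / beta)" by simp
        moreover have "exp (ln (\<tau>\<^sup>2 / D\<^sup>2) - ln 2) = \<tau>\<^sup>2 / D\<^sup>2 / 2" using D \<tau> by (simp add: exp_diff)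
        ultimately have "exp (- C / beta) * (\<tau>\<^sup>2 / D\<^sup>2 / 2) \<le> exp (- C / beta) * exp (M * L / beta)"
          by (intro mult_left_mono) auto
        also have "\<dots> = exp ((- C + M * L) / beta)" by (simp add: diff_divide_distrib flip: exp_add)
        finally show ?thesis by simp
      qed
      ultimately have "exp (- C / beta) / 2 * (\<tau>\<^sup>2 / D\<^sup>2) \<le> exp (v x / beta)" by linarith
      then show ?thesis unfolding D_def by (rule ennreal_leI)
    qed
    \<comment> \<open>In s = |x - a|^2 the integral of 1 / |x - a|^2 becomes pi times the integral
      of 1 / s from \<rho>^2 to \<tau>^2, that is pi \<Lambda>.\<close>
    have int: "(\<integral>\<^sup>+x. indicator {\<rho>\<^sup>2..\<tau>\<^sup>2} ((norm (x - a))\<^sup>2) * ennreal (exp (- C / beta) / 2 * (\<tau>\<^sup>2 / (norm (x - a))\<^sup>2)) \<partial>lborel)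
        = ennreal (exp (- C / beta) / 2 * (pi * (\<tau>\<^sup>2 * \<Lambda>)))"
    proof -
      have "(\<integral>\<^sup>+x. indicator {\<rho>\<^sup>2..\<tau>\<^sup>2} ((norm (x - a))\<^sup>2) * ennreal (exp (- C / beta) / 2 * (\<tau>\<^sup>2 / (norm (x - a))\<^sup>2)) \<partial>lborel)
        = (\<integral>\<^sup>+x. indicator {\<rho>\<^sup>2..\<tau>\<^sup>2} ((norm (x::real^2))\<^sup>2) * ennreal (exp (- C / beta) / 2 * (\<tau>\<^sup>2 / (norm x)\<^sup>2)) \<partial>lborel)"
        by (rule nn_integral_translate[where h="\<lambda>z. indicator {\<rho>\<^sup>2..\<tau>\<^sup>2} ((norm z)\<^sup>2) * ennreal (exp (- C / beta) / 2 * (\<tau>\<^sup>2 / (norm z)\<^sup>2))"]) measurable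
      also have "\<dots> = ennreal pi * (\<integral>\<^sup>+s. indicator {0..} s * (indicator {\<rho>\<^sup>2..\<tau>\<^sup>2} s * ennreal (exp (- C / beta) / 2 * (\<tau>\<^sup>2 / s))) \<partial>lborel)"
        by (rule nn_integral_radial) measurable
      also have "(\<integral>\<^sup>+s. indicator {0..} s * (indicator {\<rho>\<^sup>2..\<tau>\<^sup>2} s * ennreal (exp (- C / beta) / 2 * (\<tau>\<^sup>2 / s))) \<partial>lborel)
         = (\<integral>\<^sup>+s. ennreal (exp (- C / beta) / 2 * (\<tau>\<^sup>2 * (1 / s))) * indicator {\<rho>\<^sup>2..\<tau>\<^sup>2} s \<partial>lborel)"
        using \<rho> by (intro nn_integral_cong) (auto split: split_indicator intro: order_trans[OF zero_le_power2])
      also have "\<dots> = ennreal (exp (- C / beta) / 2 * (\<tau>\<^sup>2 * ln (\<tau>\<^sup>2)) - exp (- C / beta) / 2 * (\<tau>\<^sup>2 * ln (\<rho>\<^sup>2)))"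
      proof (rule nn_integral_FTC_Icc)
        fix s assume "s \<in> {\<rho>\<^sup>2..\<tau>\<^sup>2}"
        then have s: "0 < s" using \<rho> by (auto intro: less_le_trans[of 0 "\<rho>\<^sup>2"])
        then show "((\<lambda>s. exp (- C / beta) / 2 * (\<tau>\<^sup>2 * ln s)) has_real_derivative exp (- C / beta) / 2 * (\<tau>\<^sup>2 * (1 / s))) (at s)"
          by (intro DERIV_cmult DERIV_ln_divide)
        show "0 \<le> exp (- C / beta) / 2 * (\<tau>\<^sup>2 * (1 / s))" using s by simp
      qed (use \<rho> in \<open>auto intro!: power_mono\<close>)
      also have "exp (- C / beta) / 2 * (\<tau>\<^sup>2 * ln (\<tau>\<^sup>2)) - exp (- C / beta) / 2 * (\<tau>\<^sup>2 * ln (\<rho>\<^sup>2)) = exp (- C / beta) / 2 * (\<tau>\<^sup>2 * \<Lambda>)"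
      proof -
        have "ln (\<rho>\<^sup>2) = ln (\<tau>\<^sup>2) - \<Lambda>" unfolding \<rho>2 using \<tau> by (simp add: ln_mult)
        then show ?thesis by (simp only:) (simp add: algebra_simps)
      qed
      also have "ennreal pi * ennreal (exp (- C / beta) / 2 * (\<tau>\<^sup>2 * \<Lambda>)) = ennreal (pi * (exp (- C / beta) / 2 * (\<tau>\<^sup>2 * \<Lambda>)))"
        using \<Lambda> by (intro ennreal_mult[symmetric]) auto
      finally show ?thesis by (simp add: mult_ac)
    qed
    have "ennreal (exp (- C / beta) / 2 * (pi * (\<tau>\<^sup>2 * \<Lambda>))) \<le> (\<integral>\<^sup>+x. ennreal (G x) \<partial>lborel)"
      unfolding int[symmetric]
    proof (rule nn_integral_mono_AE, use solD(11)[OF sol] in eventually_elim)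
      case (elim x)
      show ?case
      proof (cases "(norm (x - a))\<^sup>2 \<in> {\<rho>\<^sup>2..\<tau>\<^sup>2}")
        case True
        then have "norm (x - a) \<le> \<tau>" using \<tau> power2_le_imp_le[of "norm (x - a)" \<tau>] by auto
        then have "x \<in> cball a (3 * R)" using \<tau> by (simp add: dist_norm norm_minus_commute)
        then have "G x = exp (v x / beta)" using elim sub by blast
        then show ?thesis using True lower[of x] by simp
      qed simp
    qed
    also have "\<dots> \<le> ennreal CG" by (rule solD(10)[OF sol])
    finally show False using \<Lambda>(2) CG by (simp add: ennreal_le_iff)
  qed
  then show ?thesis using that[of M \<rho>] M \<rho> \<tau> by auto
qed

end

section \<open>Concentration and compactness for sequences\<close>

lemma separating_radius:
  fixes S \<omega> :: "'a::real_normed_vector set"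
  assumes "finite S" "S \<subseteq> \<omega>" "open \<omega>"
  obtains \<rho> where "0 < \<rho>" "\<And>a. a \<in> S \<Longrightarrow> cball a (4 * \<rho>) \<subseteq> \<omega>"
    "\<And>a b. a \<in> S \<Longrightarrow> b \<in> S \<Longrightarrow> a \<noteq> b \<Longrightarrow> 8 * \<rho> < dist a b"
proof -
  have 1: "eventually (\<lambda>\<rho>. cball a (4 * \<rho>) \<subseteq> \<omega>) (at_right 0)" if a: "a \<in> S" for a
  proof -
    obtain e where e: "0 < e" "cball a e \<subseteq> \<omega>" using assms a open_contains_cball by blast
    have "eventually (\<lambda>\<rho>. 0 < \<rho> \<and> \<rho> < e / 4) (at_right 0)"
      using e eventually_at_right_real[of 0 "e / 4"] by simp
    then show ?thesis
    proof eventually_elim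
      case (elim \<rho>)
      then have "cball a (4 * \<rho>) \<subseteq> cball a e" by (intro subset_cball) simp
      then show ?case using e by blast
    qed
  qed
  have 2: "eventually (\<lambda>\<rho>. a \<noteq> b \<longrightarrow> 8 * \<rho> < dist a b) (at_right 0)" for a b :: 'a
  proof (cases "a = b")
    case False
    then have "eventually (\<lambda>\<rho>. 0 < \<rho> \<and> \<rho> < dist a b / 8) (at_right 0)"
      using eventually_at_right_real[of 0 "dist a b / 8"] by simp
    then show ?thesis by eventually_elim simp
  qed simp
  have "eventually (\<lambda>\<rho>. 0 < \<rho> \<and> (\<forall>a\<in>S. cball a (4 * \<rho>) \<subseteq> \<omega>) \<and> (\<forall>a\<in>S. \<forall>b\<in>S. a \<noteq> b \<longrightarrow> 8 * \<rho> < dist a b)) (at_right (0::real))"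
    using assms(1) by (intro eventually_conj eventually_ball_finite eventually_at_right_less ballI 1 2)
  from eventually_happens'[OF trivial_limit_at_right_real this]
  obtain \<rho> where "0 < \<rho>" "\<forall>a\<in>S. cball a (4 * \<rho>) \<subseteq> \<omega>" "\<forall>a\<in>S. \<forall>b\<in>S. a \<noteq> b \<longrightarrow> 8 * \<rho> < dist a b"
    by (elim exE conjE)
  then show ?thesis by (intro that[of \<rho>]) auto
qed

lemma convergent_subsequence_finite:
  fixes m :: "'i \<Rightarrow> nat \<Rightarrow> real"
  assumes "finite S" "\<And>a. a \<in> S \<Longrightarrow> bounded (range (m a))"
  shows "\<exists>s :: nat \<Rightarrow> nat. strict_mono s \<and> (\<forall>a\<in>S. convergent (m a \<circ> s))"
  using assms
proof (induction S rule: finite_induct)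
  case empty
  show ?case by (rule exI[of _ id]) (simp add: strict_mono_id)
next
  case (insert a S)
  then have "\<exists>s :: nat \<Rightarrow> nat. strict_mono s \<and> (\<forall>a\<in>S. convergent (m a \<circ> s))" by blast
  then obtain s :: "nat \<Rightarrow> nat" where s: "strict_mono s" "\<forall>a\<in>S. convergent (m a \<circ> s)" by blast
  have "bounded (range (m a \<circ> s))"
    using insert.prems[of a] by (auto intro: bounded_subset)
  then obtain l t where t: "strict_mono (t :: nat \<Rightarrow> nat)" "((m a \<circ> s) \<circ> t) \<longlonglongrightarrow> l"
    using bounded_imp_convergent_subsequence by blast
  have "convergent (m b \<circ> (s \<circ> t))" if "b \<in> insert a S" for b
  proof (cases "b = a")
    case True
    then show ?thesis using t by (auto simp: convergent_def o_assoc)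
  next
    case False
    then have "convergent (m b \<circ> s)" using s(2) that by simp
    then obtain L where "(m b \<circ> s) \<longlonglongrightarrow> L" by (auto simp: convergent_def)
    from LIMSEQ_subseq_LIMSEQ[OF this t(1)] show ?thesis by (auto simp: convergent_def o_assoc)
  qed
  moreover have "strict_mono (s \<circ> t)" using s(1) t(1) by (rule strict_mono_o)
  ultimately show ?case by blast
qed

section \<open>Blow-up points of a sequence of solutions\<close>

locale hartree_sequence = hartree +
  fixes v f X G :: "nat \<Rightarrow> real^2 \<Rightarrow> real"
  assumes csol: "\<And>k. csol (v k) (f k) (X k) (G k)"
    and omega_connected: "connected \<omega>" and omega_nonempty: "\<omega> \<noteq> {}"
begin

text \<open>The subsequence r is a parameter: a blow-up point of r remains one for every further
  subsequence, but further subsequences may acquire new ones, and these have to be excluded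
  later.\<close>

definition blow_up :: "(nat \<Rightarrow> nat) \<Rightarrow> real^2 \<Rightarrow> bool" where
  "blow_up r a \<longleftrightarrow> (\<exists>x. (\<forall>l. x l \<in> \<omega>) \<and> x \<longlonglongrightarrow> a \<and> filterlim (\<lambda>l. v (r l) (x l)) at_top sequentially)"

abbreviation mass :: "nat \<Rightarrow> (real^2) set \<Rightarrow> ennreal" where
  "mass k A \<equiv> (\<integral>\<^sup>+y. indicator A y * ennreal (f k y) \<partial>lborel)"

lemma measurable_f [measurable]: "f k \<in> borel_measurable borel"
  and f_nonneg: "0 \<le> f k x" and measurable_v [measurable]: "v k \<in> borel_measurable borel"
  using csolD(2)[OF csol, of k] by (auto simp: weak_solution_def)

lemma blow_up_subsequence: "blow_up r a \<Longrightarrow> strict_mono s \<Longrightarrow> blow_up (r \<circ> s) a"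
proof -
  assume "blow_up r a" and s: "strict_mono s"
  then obtain x where x: "\<forall>l. x l \<in> \<omega>" "x \<longlonglongrightarrow> a" "filterlim (\<lambda>l. v (r l) (x l)) at_top sequentially"
    by (auto simp: blow_up_def)
  have "filterlim (\<lambda>l. v (r (s l)) (x (s l))) at_top sequentially"
    by (rule filterlim_compose[OF x(3) filterlim_subseq[OF s]])
  with x LIMSEQ_subseq_LIMSEQ[OF x(2) s] show ?thesis
    unfolding blow_up_def by (intro exI[of _ "x \<circ> s"]) auto
qed

text \<open>If the mass in the disc were at most M, the upper bound would hold on the disc of radius
  \<rho> / 8, where the points x l eventually lie. The conclusion holds for all large l and for
  discs of any size inside omega.\<close>

lemma blow_up_mass:
  assumes "blow_up r a" and \<rho>: "0 < \<rho>" "cball a \<rho> \<subseteq> \<omega>" and M: "0 < M" "M < 4 * pi * beta"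
  shows "\<forall>\<^sub>F l in sequentially. ennreal M < mass (r l) (ball a \<rho>)"
proof -
  define R where "R = \<rho> / 2"
  have R: "0 < R" "2 * R = \<rho>" using \<rho> by (simp_all add: R_def)
  have sub: "cball a (2 * R) \<subseteq> \<omega>" using R \<rho> by simp
  obtain C where C: "\<And>v f X G x. csol v f X G \<Longrightarrow> (\<integral>\<^sup>+y. indicator (ball a (2 * R)) y * ennreal (f y) \<partial>lborel) \<le> ennreal M \<Longrightarrow>
      x \<in> ball a (R / 4) \<Longrightarrow> v x \<le> C"
    by (rule local_upper_bound[OF R(1) sub M]) (rule that; blast)
  obtain x where x: "\<forall>l. x l \<in> \<omega>" "x \<longlonglongrightarrow> a" "filterlim (\<lambda>l. v (r l) (x l)) at_top sequentially"
    using assms(1) by (auto simp: blow_up_def)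
  have "\<forall>\<^sub>F l in sequentially. dist (x l) a < R / 4"
    using x(2) R by (intro tendstoD) auto
  moreover have "\<forall>\<^sub>F l in sequentially. C < v (r l) (x l)"
    using x(3) by (simp add: filterlim_at_top_dense)
  ultimately show ?thesis
  proof eventually_elim
    case (elim l)
    show ?case
    proof (rule ccontr)
      assume "\<not> ennreal M < mass (r l) (ball a \<rho>)"
      then have "mass (r l) (ball a (2 * R)) \<le> ennreal M" by (simp add: R)
      then have "v (r l) (x l) \<le> C" using C[OF csol, of "r l" "x l"] elim by (simp add: dist_commute)
      then show False using elim by simp
    qed
  qed
qed

text \<open>Disjoint discs around the points each carry mass above 2 pi beta at a common index l,
  while the total mass is at most C1. The bound N depends neither on the subsequence nor on
  S.\<close>

lemma finitely_many_blow_up_points: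
  obtains N :: nat where "\<And>r S. finite S \<Longrightarrow> S \<subseteq> \<omega> \<Longrightarrow> (\<And>a. a \<in> S \<Longrightarrow> blow_up r a) \<Longrightarrow> card S < N"
proof -
  define M where "M = 2 * pi * beta"
  have M: "0 < M" "M < 4 * pi * beta" using exponents(8) by (simp_all add: M_def)
  obtain C1 where C1: "0 \<le> C1" "\<And>v f X G. csol v f X G \<Longrightarrow> (\<integral>\<^sup>+x. ennreal (f x) \<partial>lborel) \<le> ennreal C1"
    by (rule csol_mass) (rule that; blast)
  show ?thesis
  proof (rule that[of "nat \<lceil>C1 / M\<rceil> + 1"])
    fix r S assume S: "finite S" "S \<subseteq> \<omega>" and bl: "\<And>a. a \<in> S \<Longrightarrow> blow_up r a"
    obtain \<rho> where \<rho>: "0 < \<rho>" "\<And>a. a \<in> S \<Longrightarrow> cball a (4 * \<rho>) \<subseteq> \<omega>"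
      "\<And>a b. a \<in> S \<Longrightarrow> b \<in> S \<Longrightarrow> a \<noteq> b \<Longrightarrow> 8 * \<rho> < dist a b"
      using separating_radius[OF S open_omega] by metis
    have "cball a \<rho> \<subseteq> \<omega>" if "a \<in> S" for a
      using \<rho>(1) \<rho>(2)[OF that] by (meson order_trans subset_cball mult_le_cancel_right1 one_le_numeral order_less_imp_le not_less)
    then have "\<forall>\<^sub>F l in sequentially. \<forall>a\<in>S. ennreal M < mass (r l) (ball a \<rho>)"
      using S bl \<rho> M by (intro eventually_ball_finite ballI blow_up_mass) auto
    then obtain l where l: "\<And>a. a \<in> S \<Longrightarrow> ennreal M < mass (r l) (ball a \<rho>)"
      using eventually_happens'[OF sequentially_bot] by blast
    have disj: "disjoint_family_on (\<lambda>a. ball a \<rho>) S"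
    proof (clarsimp simp: disjoint_family_on_def)
      fix a b assume ab: "a \<in> S" "b \<in> S" "a \<noteq> b"
      show "ball a \<rho> \<inter> ball b \<rho> = {}"
        using \<rho>(1) \<rho>(3)[OF ab] by (intro disjoint_ballI) simp
    qed
    have "of_nat (card S) * ennreal M = (\<Sum>a\<in>S. ennreal M)" by simp
    also have "\<dots> \<le> (\<Sum>a\<in>S. mass (r l) (ball a \<rho>))" using l by (intro sum_mono) (simp add: less_imp_le)
    also have "\<dots> = (\<integral>\<^sup>+y. (\<Sum>a\<in>S. indicator (ball a \<rho>) y * ennreal (f (r l) y)) \<partial>lborel)"
    proof (rule nn_integral_sum[symmetric])
      fix a :: "real^2"
      have [measurable]: "ball a \<rho> \<in> sets borel" by simp
      show "(\<lambda>y. indicator (ball a \<rho>) y * ennreal (f (r l) y)) \<in> borel_measurable lborel" by measurable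
    qed
    also have "\<dots> = (\<integral>\<^sup>+y. indicator (\<Union>a\<in>S. ball a \<rho>) y * ennreal (f (r l) y) \<partial>lborel)"
      by (simp add: indicator_UN_disjoint[OF S(1) disj] sum_distrib_right)
    also have "\<dots> \<le> (\<integral>\<^sup>+y. ennreal (f (r l) y) \<partial>lborel)"
      by (intro nn_integral_mono) (auto split: split_indicator)
    also have "\<dots> \<le> ennreal C1" by (rule C1(2)[OF csol])
    finally have "ennreal (real (card S) * M) \<le> ennreal C1"
      using M by (simp add: ennreal_mult ennreal_of_nat_eq_real_of_nat)
    then have "real (card S) * M \<le> C1" using C1 by (simp add: ennreal_le_iff)
    then have "real (card S) \<le> C1 / M" using M by (simp add: field_simps)
    then show "card S < nat \<lceil>C1 / M\<rceil> + 1" by linarith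
  qed
qed

text \<open>The cardinality is bounded uniformly over all pairs (r, S), so a pair with a largest S
  exists; a new blow-up point along a further subsequence would enlarge it.\<close>

lemma maximal_blow_up_set:
  "\<exists>(r :: nat \<Rightarrow> nat) S. strict_mono r \<and> finite S \<and> S \<subseteq> \<omega> \<and> (\<forall>a\<in>S. blow_up r a) \<and>
    (\<forall>s :: nat \<Rightarrow> nat. \<forall>a\<in>\<omega> - S. strict_mono s \<longrightarrow> \<not> blow_up (r \<circ> s) a)"
proof -
  obtain N where N: "\<And>r S. finite S \<Longrightarrow> S \<subseteq> \<omega> \<Longrightarrow> (\<And>a. a \<in> S \<Longrightarrow> blow_up r a) \<Longrightarrow> card S < N"
    by (rule finitely_many_blow_up_points) (rule that; blast)
  define P where "P = (\<lambda>(r :: nat \<Rightarrow> nat, S). strict_mono r \<and> finite S \<and> S \<subseteq> \<omega> \<and> (\<forall>a\<in>S. blow_up r a))"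
  have "P (id, {})" by (simp add: P_def strict_mono_id)
  moreover have "\<forall>y. P y \<longrightarrow> (card \<circ> snd) y < N" using N by (auto simp: P_def)
  ultimately obtain p where p: "P p" "\<forall>y. P y \<longrightarrow> (card \<circ> snd) y \<le> (card \<circ> snd) p"
    using Lattices_Big.ex_has_greatest_nat[of P "(id, {})" "card \<circ> snd" N] by blast
  obtain r S where rS: "p = (r, S)" by (cases p)
  then have *: "strict_mono r" "finite S" "S \<subseteq> \<omega>" "\<And>a. a \<in> S \<Longrightarrow> blow_up r a"
    using p(1) by (auto simp: P_def)
  have "\<not> blow_up (r \<circ> s) a" if s: "strict_mono s" and a: "a \<in> \<omega> - S" for s :: "nat \<Rightarrow> nat" and a
  proof
    assume bl: "blow_up (r \<circ> s) a"
    have "P (r \<circ> s, insert a S)"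
      using * s a bl blow_up_subsequence[OF *(4) s] by (auto simp: P_def strict_mono_o)
    then have "card (insert a S) \<le> card S" using p(2) rS by force
    then show False using a *(2) by simp
  qed
  then have "\<forall>s :: nat \<Rightarrow> nat. \<forall>a\<in>\<omega> - S. strict_mono s \<longrightarrow> \<not> blow_up (r \<circ> s) a" by simp
  moreover have "\<forall>a\<in>S. blow_up r a" using *(4) by simp
  ultimately show ?thesis using *(1,2,3) by (intro exI[of _ r] exI[of _ S] conjI)
qed

text \<open>Otherwise points of K with larger and larger values can be chosen at increasing indices,
  and compactness of K makes a subsequence of them converge to a blow-up point in K.\<close>

lemma upper_bound_on_compact:
  assumes no_blow: "\<And>(s :: nat \<Rightarrow> nat) a. strict_mono s \<Longrightarrow> a \<in> K \<Longrightarrow> \<not> blow_up s a"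
    and K: "compact K" "K \<subseteq> \<omega>"
  obtains C where "\<And>l x. x \<in> K \<Longrightarrow> v l x \<le> C"
proof (rule ccontr)
  assume contr: "\<not> thesis"
  have ex: "\<exists>l>L. \<exists>x\<in>K. n < v l x" for n :: real and L :: nat
  proof -
    have "\<exists>B. \<forall>x\<in>K. v l x \<le> B" for l
    proof -
      have "bounded (v l ` K)"
        using K csolD(3)[OF csol, of l] by (intro compact_imp_bounded compact_continuous_image) (auto intro: continuous_on_subset)
      then obtain B where "\<forall>y\<in>v l ` K. norm y \<le> B" by (auto simp: bounded_iff)
      then show ?thesis by (intro exI[of _ B]) auto
    qed
    then obtain B where B: "\<And>l x. x \<in> K \<Longrightarrow> v l x \<le> B l" by metis
    \<comment> \<open>D exceeds n and all values of the first L + 1 functions on K, so a value above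
      D must occur at an index beyond L.\<close>
    define D where "D = Max (insert n (B ` {..L}))"
    have "\<not> (\<forall>l x. x \<in> K \<longrightarrow> v l x \<le> D)" using contr that by blast
    then obtain l x where lx: "x \<in> K" "\<not> v l x \<le> D" by blast
    have "n \<le> D" unfolding D_def by (intro Max_ge) auto
    moreover have "\<not> l \<le> L"
    proof
      assume "l \<le> L"
      then have "B l \<le> D" unfolding D_def by (intro Max_ge) auto
      then show False using lx B[of x l] by linarith
    qed
    ultimately show ?thesis using lx by (intro exI[of _ l]) (auto simp: not_le intro!: bexI[of _ x])
  qed
  have "\<exists>s :: nat \<Rightarrow> nat. \<forall>n. (\<exists>x\<in>K. real n < v (s n) x) \<and> s n < s (Suc n)"
    by (rule dependent_nat_choice) (use ex in blast)+
  then obtain s where s: "\<And>n. \<exists>x\<in>K. real n < v (s n) x" "\<And>n. s n < s (Suc n)" by blast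
  then obtain x where x: "\<And>n. x n \<in> K" "\<And>n. real n < v (s n) (x n)" by metis
  have sm: "strict_mono s" using s(2) by (simp add: strict_mono_Suc_iff)
  obtain a t where t: "a \<in> K" "strict_mono (t :: nat \<Rightarrow> nat)" "(x \<circ> t) \<longlonglongrightarrow> a"
    using K(1) x(1) unfolding compact_def by metis
  have "blow_up (s \<circ> t) a"
    unfolding blow_up_def
  proof (intro exI conjI allI)
    show "(x \<circ> t) l \<in> \<omega>" for l using x(1) K(2) by auto
    show "filterlim (\<lambda>l. v ((s \<circ> t) l) ((x \<circ> t) l)) at_top sequentially"
    proof (rule filterlim_at_top_mono[OF filterlim_real_sequentially])
      show "\<forall>\<^sub>F n in sequentially. real n \<le> v ((s \<circ> t) n) ((x \<circ> t) n)"
      proof (rule always_eventually, rule allI)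
        fix n
        have "real n \<le> real (t n)" using t(2) by (simp add: seq_suble)
        then show "real n \<le> v ((s \<circ> t) n) ((x \<circ> t) n)" using x(2)[of "t n"] by simp
      qed
    qed
  qed (rule t)
  then show False using no_blow[of "s \<circ> t" a] sm t by (simp add: strict_mono_o)
qed

text \<open>The Harnack inequality transports lower bounds inside small discs. Since the plane minus
  a finite set does not disconnect the domain, chains of such discs reach every point of \<omega> -
  S, and a finite cover makes the constant uniform on K.\<close>

lemma lower_bound_propagates:
  assumes S: "finite S" and no_blow: "\<And>(s :: nat \<Rightarrow> nat) a. strict_mono s \<Longrightarrow> a \<in> \<omega> - S \<Longrightarrow> \<not> blow_up s a"
    and x0: "x0 \<in> \<omega> - S" and K: "compact K" "K \<subseteq> \<omega> - S"
  shows "\<exists>C'. \<forall>l. \<forall>y\<in>K. - M \<le> v l x0 \<longrightarrow> - C' \<le> v l y" (is ?A)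
    and "\<exists>C'. \<forall>l. \<forall>y\<in>K. - M \<le> v l y \<longrightarrow> - C' \<le> v l x0" (is ?B)
proof -
  let ?U = "\<omega> - S"
  \<comment> \<open>T is reflexive and transitive, and any two points of a small disc are related;
    C' depends on M and the two points but not on l. Induction over the connected set then relates
    all points.\<close>
  define T where "T x y \<longleftrightarrow> (\<forall>M. \<exists>C'. \<forall>l. - M \<le> v l x \<longrightarrow> - C' \<le> v l y)" for x y
  have T_trans: "T x z" if "T x y" "T y z" for x y z
    using that unfolding T_def by meson
  have U: "open ?U" using open_omega S by (simp add: finite_imp_closed open_Diff)
  have conn: "connected ?U"
    using open_omega omega_connected S by (intro connected_open_delete_finite) auto
  have loc: "\<exists>s>0. ball x s \<subseteq> ?U \<and> (\<forall>M. \<exists>C'. \<forall>l. \<forall>y\<in>ball x s. \<forall>z\<in>ball x s. - M \<le> v l y \<longrightarrow> - C' \<le> v l z)"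
    if x: "x \<in> ?U" for x
  proof -
    obtain R where R: "0 < R" "cball x R \<subseteq> ?U" using U x open_contains_cball by blast
    obtain C where C: "\<And>l y. y \<in> cball x R \<Longrightarrow> v l y \<le> C"
      using upper_bound_on_compact[of "cball x R"] no_blow R by (metis Diff_subset compact_cball subset_iff)
    have sub: "cball x R \<subseteq> \<omega>" using R by blast
    obtain s where s: "0 < s" "s \<le> R" "\<And>M. \<exists>C'. \<forall>v f X G. csol v f X G \<longrightarrow> (\<forall>y\<in>ball x R. v y \<le> C) \<longrightarrow>
     (\<forall>y\<in>ball x s. \<forall>z\<in>ball x s. - M \<le> v y \<longrightarrow> - C' \<le> v z)"
      by (rule harnack[OF R(1) sub, of C]) (rule that; blast)
    have "\<exists>C'. \<forall>l. \<forall>y\<in>ball x s. \<forall>z\<in>ball x s. - M \<le> v l y \<longrightarrow> - C' \<le> v l z" for M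
    proof -
      obtain C' where "\<forall>v f X G. csol v f X G \<longrightarrow> (\<forall>y\<in>ball x R. v y \<le> C) \<longrightarrow>
     (\<forall>y\<in>ball x s. \<forall>z\<in>ball x s. - M \<le> v y \<longrightarrow> - C' \<le> v z)" using s(3) by blast
      then have "\<forall>y\<in>ball x s. \<forall>z\<in>ball x s. - M \<le> v l y \<longrightarrow> - C' \<le> v l z" for l
      proof -
        have "\<forall>y\<in>ball x R. v l y \<le> C" using C by simp
        then show ?thesis using csol[of l] \<open>\<forall>v f X G. csol v f X G \<longrightarrow> _\<close> by blast
      qed
      then show ?thesis by blast
    qed
    moreover have "ball x s \<subseteq> ?U" using s R by (auto simp: subset_iff)
    ultimately show ?thesis using s by blast
  qed
  have T_loc: "\<exists>N. openin (top_of_set ?U) N \<and> x \<in> N \<and> (\<forall>y\<in>N. \<forall>z\<in>N. T y z)" if x: "x \<in> ?U" for x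
  proof -
    obtain s where s: "s > 0" "ball x s \<subseteq> ?U" "\<forall>M. \<exists>C'. \<forall>l. \<forall>y\<in>ball x s. \<forall>z\<in>ball x s. - M \<le> v l y \<longrightarrow> - C' \<le> v l z"
      using loc[OF x] by blast
    show ?thesis
    proof (intro exI[of _ "ball x s"] conjI ballI)
      show "openin (top_of_set ?U) (ball x s)" using U s by (simp add: openin_open_eq)
      show "x \<in> ball x s" using s by simp
      show "T y z" if "y \<in> ball x s" "z \<in> ball x s" for y z
        using s(3) that unfolding T_def by meson
    qed
  qed
  have T_refl: "T x x" for x by (auto simp: T_def)
  have T_all: "T x y" if "x \<in> ?U" "y \<in> ?U" for x y
  proof (rule connected_induction_simple[OF conn that, where P="T x"])
    show "T x x" by (rule T_refl)
    fix a assume "a \<in> ?U"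
    then show "\<exists>N. openin (top_of_set ?U) N \<and> a \<in> N \<and> (\<forall>y\<in>N. \<forall>z\<in>N. T x y \<longrightarrow> T x z)"
      using T_loc T_trans by meson
  qed
  have "\<forall>x\<in>?U. \<exists>s>0. ball x s \<subseteq> ?U \<and> (\<forall>M. \<exists>C'. \<forall>l. \<forall>y\<in>ball x s. \<forall>z\<in>ball x s. - M \<le> v l y \<longrightarrow> - C' \<le> v l z)"
    using loc by blast
  then obtain s where s: "\<And>x. x \<in> ?U \<Longrightarrow> 0 < s x" "\<And>x M. x \<in> ?U \<Longrightarrow>
     \<exists>C'. \<forall>l. \<forall>y\<in>ball x (s x). \<forall>z\<in>ball x (s x). - M \<le> v l y \<longrightarrow> - C' \<le> v l z"
    by metis
  have cover: "K \<subseteq> (\<Union>x\<in>K. ball x (s x))" using s(1) K by force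
  obtain D where D: "D \<subseteq> K" "finite D" "K \<subseteq> (\<Union>x\<in>D. ball x (s x))"
    by (rule compactE_image[OF K(1) _ cover]) auto
  show ?A
  proof -
    have "\<exists>C'. \<forall>l. \<forall>y\<in>ball d (s d). - M \<le> v l x0 \<longrightarrow> - C' \<le> v l y" if "d \<in> D" for d
    proof -
      have d: "d \<in> ?U" using that D K by blast
      obtain C1 where C1: "\<forall>l. - M \<le> v l x0 \<longrightarrow> - C1 \<le> v l d" using T_all[OF x0 d] unfolding T_def by blast
      obtain C2 where C2: "\<forall>l. \<forall>y\<in>ball d (s d). \<forall>z\<in>ball d (s d). - C1 \<le> v l y \<longrightarrow> - C2 \<le> v l z" using s(2)[OF d] by blast
      have "d \<in> ball d (s d)" using s(1)[OF d] by simp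
      then show ?thesis using C1 C2 by blast
    qed
    then obtain C' where C': "\<And>d l y. d \<in> D \<Longrightarrow> y \<in> ball d (s d) \<Longrightarrow> - M \<le> v l x0 \<Longrightarrow> - C' d \<le> v l y" by metis
    show ?thesis
    proof (intro exI allI ballI impI)
      fix l y assume y: "y \<in> K" "- M \<le> v l x0"
      then obtain d where d: "d \<in> D" "y \<in> ball d (s d)" using D by blast
      have "C' d \<le> Max (insert 0 (C' ` D))" using d D by (intro Max_ge) auto
      then show "- Max (insert 0 (C' ` D)) \<le> v l y" using C'[OF d y(2)] by linarith
    qed
  qed
  show ?B
  proof -
    have "\<exists>C'. \<forall>l. \<forall>y\<in>ball d (s d). - M \<le> v l y \<longrightarrow> - C' \<le> v l x0" if "d \<in> D" for d
    proof -
      have d: "d \<in> ?U" using that D K by blast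
      obtain C2 where C2: "\<forall>l. \<forall>y\<in>ball d (s d). \<forall>z\<in>ball d (s d). - M \<le> v l y \<longrightarrow> - C2 \<le> v l z" using s(2)[OF d] by blast
      obtain C1 where C1: "\<forall>l. - C2 \<le> v l d \<longrightarrow> - C1 \<le> v l x0" using T_all[OF d x0] unfolding T_def by blast
      have "d \<in> ball d (s d)" using s(1)[OF d] by simp
      then show ?thesis using C1 C2 by blast
    qed
    then obtain C' where C': "\<And>d l y. d \<in> D \<Longrightarrow> y \<in> ball d (s d) \<Longrightarrow> - M \<le> v l y \<Longrightarrow> - C' d \<le> v l x0" by metis
    show ?thesis
    proof (intro exI allI ballI impI)
      fix l y assume y: "y \<in> K" "- M \<le> v l y"
      then obtain d where d: "d \<in> D" "y \<in> ball d (s d)" using D by blast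
      have "C' d \<le> Max (insert 0 (C' ` D))" using d D by (intro Max_ge) auto
      then show "- Max (insert 0 (C' ` D)) \<le> v l x0" using C'[OF d y(2)] by linarith
    qed
  qed
qed

lemma subsequence_of_frequently:
  assumes "\<exists>\<^sub>F l in sequentially. P l"
  shows "\<exists>s :: nat \<Rightarrow> nat. strict_mono s \<and> (\<forall>l. P (s l))"
proof -
  have "\<exists>s :: nat \<Rightarrow> nat. \<forall>n. P (s n) \<and> s n < s (Suc n)"
  proof (rule dependent_nat_choice)
    show "\<exists>x. P x" using assms frequently_ex by blast
    show "\<exists>y. P y \<and> x < y" for x
      using assms unfolding frequently_sequentially by (metis Suc_le_eq)
  qed
  then show ?thesis by (auto simp: strict_mono_Suc_iff)
qed

text \<open>A single reference point decides: if the values at x0 tend to minus infinity, so do all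
  values on compact sets; otherwise a subsequence is bounded below at x0, hence on every compact
  subset of \<omega> - S. Upper bounds hold since there is no blow-up off S.\<close>

lemma dichotomy:
  assumes S: "finite S" and no_blow: "\<And>(s :: nat \<Rightarrow> nat) a. strict_mono s \<Longrightarrow> a \<in> \<omega> - S \<Longrightarrow> \<not> blow_up s a"
  shows "tendsto_minus_infinity_loc_unif (\<omega> - S) v \<or>
    (\<exists>s :: nat \<Rightarrow> nat. strict_mono s \<and> (\<forall>K. compact K \<and> K \<subseteq> \<omega> - S \<longrightarrow> (\<exists>C. \<forall>l. \<forall>x\<in>K. \<bar>v (s l) x\<bar> \<le> C)))"
proof -
  have "\<not> finite \<omega>"
    using open_omega omega_nonempty finite_imp_not_open by blast
  then obtain x0 where x0: "x0 \<in> \<omega> - S" using S by (metis Diff_eq_empty_iff ex_in_conv finite_subset)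
  show ?thesis
  proof (cases "\<forall>M. \<forall>\<^sub>F l in sequentially. v l x0 < - M")
    case True
    have "tendsto_minus_infinity_loc_unif (\<omega> - S) v"
      unfolding tendsto_minus_infinity_loc_unif_def
    proof (intro allI impI)
      fix K M assume "compact K \<and> K \<subseteq> \<omega> - S"
      then obtain C' where C': "\<forall>l. \<forall>y\<in>K. - (- M) \<le> v l y \<longrightarrow> - C' \<le> v l x0"
        using lower_bound_propagates(2)[OF S no_blow x0, of K "- M"] by blast
      show "\<forall>\<^sub>F l in sequentially. \<forall>x\<in>K. v l x \<le> M"
        using True[rule_format, of C']
      proof eventually_elim
        case (elim l)
        show ?case
        proof
          fix x assume "x \<in> K"
          then show "v l x \<le> M" using C' elim by (metis linorder_not_le minus_minus order_less_imp_le)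
        qed
      qed
    qed
    then show ?thesis by blast
  next
    case False
    then obtain M where "\<exists>\<^sub>F l in sequentially. - M \<le> v l x0"
      by (auto simp: not_eventually not_less)
    from subsequence_of_frequently[OF this]
    obtain s :: "nat \<Rightarrow> nat" where s: "strict_mono s" "\<And>l. - M \<le> v (s l) x0" by auto
    have "\<exists>C. \<forall>l. \<forall>x\<in>K. \<bar>v (s l) x\<bar> \<le> C" if K: "compact K" "K \<subseteq> \<omega> - S" for K
    proof -
      obtain C1 where C1: "\<And>l x. x \<in> K \<Longrightarrow> v l x \<le> C1"
        using upper_bound_on_compact[of K] no_blow K by (metis Diff_subset subset_iff)
      obtain C2 where C2: "\<forall>l. \<forall>y\<in>K. - M \<le> v l x0 \<longrightarrow> - C2 \<le> v l y"
        using lower_bound_propagates(1)[OF S no_blow x0 K, of M] by blast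
      have "\<bar>v (s l) x\<bar> \<le> \<bar>C1\<bar> + \<bar>C2\<bar>" if "x \<in> K" for l x
      proof -
        have "v (s l) x \<le> C1" "- C2 \<le> v (s l) x" using C1[OF that] C2 s(2) that by auto
        then show ?thesis by linarith
      qed
      then show ?thesis by blast
    qed
    then show ?thesis using s by blast
  qed
qed

text \<open>Boundedness on a compact annulus around a keeps the mass of a smaller disc below some M
  < 4 pi beta, whereas blow-up at a makes it eventually larger than this same M.\<close>

lemma blow_up_not_bounded:
  assumes S: "finite S" "S \<subseteq> \<omega>" and a: "a \<in> S" "blow_up id a" and s: "strict_mono (s :: nat \<Rightarrow> nat)"
    and bd: "\<And>K. compact K \<Longrightarrow> K \<subseteq> \<omega> - S \<Longrightarrow> \<exists>C. \<forall>l. \<forall>x\<in>K. \<bar>v (s l) x\<bar> \<le> C"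
  shows False
proof -
  obtain R where R: "0 < R" "\<And>a. a \<in> S \<Longrightarrow> cball a (4 * R) \<subseteq> \<omega>"
      "\<And>a b. a \<in> S \<Longrightarrow> b \<in> S \<Longrightarrow> a \<noteq> b \<Longrightarrow> 8 * R < dist a b"
    using separating_radius[OF S open_omega] by metis
  have sub: "cball a (3 * R) \<subseteq> \<omega>"
  proof -
    have "cball a (3 * R) \<subseteq> cball a (4 * R)" using R(1) by (intro subset_cball) simp
    then show ?thesis using R(2)[OF a(1)] by blast
  qed
  \<comment> \<open>Distinct points of S are more than 8 R apart, so the annulus from R to 3 R
    around a avoids S.\<close>
  define A where "A = cball a (3 * R) - ball a R"
  have A: "compact A" by (simp add: A_def compact_diff)
  have "A \<subseteq> \<omega> - S"
  proof
    fix x assume x: "x \<in> A"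
    have "x \<notin> S"
    proof
      assume "x \<in> S"
      then show False using R(1) R(3)[OF a(1), of x] x by (cases "x = a") (auto simp: A_def)
    qed
    then show "x \<in> \<omega> - S" using x sub by (auto simp: A_def)
  qed
  then obtain C where C: "\<forall>l. \<forall>x\<in>A. \<bar>v (s l) x\<bar> \<le> C" using bd[OF A] by blast
  obtain M \<rho> where M: "0 < M" "M < 4 * pi * beta" "0 < \<rho>" "\<rho> < R"
    "\<And>v f X G. csol v f X G \<Longrightarrow> (\<And>y. R \<le> dist a y \<Longrightarrow> dist a y \<le> 3 * R \<Longrightarrow> - C \<le> v y) \<Longrightarrow>
      (\<integral>\<^sup>+y. indicator (ball a \<rho>) y * ennreal (f y) \<partial>lborel) < ennreal M"
    by (rule no_bounded_concentration[OF R(1) sub, of C]) (rule that; blast)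
  have "cball a \<rho> \<subseteq> cball a (3 * R)" using M R(1) by (intro subset_cball) simp
  then have "\<forall>\<^sub>F l in sequentially. ennreal M < mass (s l) (ball a \<rho>)"
    using blow_up_mass[OF blow_up_subsequence[OF a(2) s] M(3) _ M(1,2)] sub by simp
  then obtain l where "ennreal M < mass (s l) (ball a \<rho>)"
    using eventually_happens'[OF sequentially_bot] by blast
  moreover have "mass (s l) (ball a \<rho>) < ennreal M"
  proof (rule M(5)[OF csol])
    fix y assume "R \<le> dist a y" "dist a y \<le> 3 * R"
    then have "\<bar>v (s l) y\<bar> \<le> C" using C by (auto simp: A_def)
    then show "- C \<le> v (s l) y" by linarith
  qed
  ultimately show False by simp
qed

lemma mass_tendsto_0:
  assumes U: "open U" "U \<subseteq> \<omega>" and lim: "tendsto_minus_infinity_loc_unif U v"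
    and K: "compact K" "K \<subseteq> U"
  shows "(\<lambda>l. mass l K) \<longlonglongrightarrow> 0"
proof -
  have loc: "\<exists>R>0. (\<lambda>l. mass l (ball x R)) \<longlonglongrightarrow> 0" if x: "x \<in> U" for x
  proof -
    obtain R where R: "0 < R" "cball x R \<subseteq> U" using U x open_contains_cball by blast
    have sub: "ball x R \<subseteq> \<omega>" using R U by (auto simp: subset_iff)
    obtain C where C: "0 \<le> C" "\<And>u f X G M. sol u f X G \<Longrightarrow> 0 \<le> M \<Longrightarrow> (\<And>y. y \<in> ball x R \<Longrightarrow> u y \<le> - M) \<Longrightarrow>
     (\<integral>\<^sup>+y. indicator (ball x (R / 2)) y * ennreal (f y) \<partial>lborel) \<le> ennreal (C * exp (- lam * M))"
      by (rule small_mass[OF R(1) sub]) (rule that; blast)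
    have "(\<lambda>l. mass l (ball x (R / 2))) \<longlonglongrightarrow> 0"
    proof (rule order_tendstoI)
      fix e :: ennreal assume "0 < e"
      have "((\<lambda>M. C * exp (- lam * M)) \<longlongrightarrow> C * 0) at_top"
        using exponents(1) by (intro tendsto_mult tendsto_const filterlim_compose[OF exp_at_bot] filterlim_tendsto_neg_mult_at_bot[OF tendsto_const] filterlim_ident) auto
      then have "((\<lambda>M. ennreal (C * exp (- lam * M))) \<longlongrightarrow> ennreal 0) at_top"
        by (intro tendsto_ennrealI) simp
      then have "eventually (\<lambda>M. ennreal (C * exp (- lam * M)) < e) at_top"
        using \<open>0 < e\<close> by (intro order_tendstoD) auto
      then have "eventually (\<lambda>M. ennreal (C * exp (- lam * M)) < e \<and> 0 \<le> M) at_top"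
        using eventually_ge_at_top[of 0] by eventually_elim simp
      then obtain M where M: "ennreal (C * exp (- lam * M)) < e" "0 \<le> M"
        using eventually_happens'[OF trivial_limit_at_top_linorder] by blast
      have "\<forall>\<^sub>F l in sequentially. \<forall>y\<in>cball x R. v l y \<le> - M"
        using lim[unfolded tendsto_minus_infinity_loc_unif_def, rule_format, of "cball x R" "- M"] R by simp
      then show "\<forall>\<^sub>F l in sequentially. mass l (ball x (R / 2)) < e"
      proof eventually_elim
        case (elim l)
        have "mass l (ball x (R / 2)) \<le> ennreal (C * exp (- lam * M))"
          using elim M(2) by (intro C(2)[OF csolD(1)[OF csol]]) auto
        then show ?case using M(1) by (rule le_less_trans)
      qed
    qed simp
    then show ?thesis using R by (intro exI[of _ "R / 2"]) simp
  qed
  then have "\<forall>x\<in>U. \<exists>R. R > 0 \<and> (\<lambda>l. mass l (ball x R)) \<longlonglongrightarrow> 0" by simp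
  from bchoice[OF this] obtain R where "\<forall>x\<in>U. 0 < R x \<and> (\<lambda>l. mass l (ball x (R x))) \<longlonglongrightarrow> 0" ..
  then have R: "\<And>x. x \<in> U \<Longrightarrow> 0 < R x" "\<And>x. x \<in> U \<Longrightarrow> (\<lambda>l. mass l (ball x (R x))) \<longlonglongrightarrow> 0"
    by simp_all
  have cover: "K \<subseteq> (\<Union>x\<in>K. ball x (R x))" using R(1) K by force
  obtain D where D: "D \<subseteq> K" "finite D" "K \<subseteq> (\<Union>x\<in>D. ball x (R x))"
    by (rule compactE_image[OF K(1) _ cover]) auto
  have "(\<lambda>l. \<Sum>x\<in>D. mass l (ball x (R x))) \<longlonglongrightarrow> (\<Sum>x\<in>D. 0)"
    using D K by (intro tendsto_sum R) auto
  then have lim0: "(\<lambda>l. \<Sum>x\<in>D. mass l (ball x (R x))) \<longlonglongrightarrow> 0" by simp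
  have le: "mass l K \<le> (\<Sum>x\<in>D. mass l (ball x (R x)))" for l
  proof -
    have "mass l K \<le> (\<integral>\<^sup>+y. (\<Sum>x\<in>D. indicator (ball x (R x)) y * ennreal (f l y)) \<partial>lborel)"
    proof (rule nn_integral_mono)
      fix y
      show "indicator K y * ennreal (f l y) \<le> (\<Sum>x\<in>D. indicator (ball x (R x)) y * ennreal (f l y))"
      proof (cases "y \<in> K")
        case True
        then obtain x where x: "x \<in> D" "y \<in> ball x (R x)" using D by blast
        then have "ennreal (f l y) \<le> indicator (ball x (R x)) y * ennreal (f l y)" by simp
        also have "\<dots> \<le> (\<Sum>x\<in>D. indicator (ball x (R x)) y * ennreal (f l y))"
          using x D by (intro member_le_sum) auto
        finally show ?thesis using True by simp
      qed simp
    qed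
    also have "\<dots> = (\<Sum>x\<in>D. mass l (ball x (R x)))"
    proof (rule nn_integral_sum)
      fix x
      have [measurable]: "ball x (R x) \<in> sets borel" by simp
      show "(\<lambda>y. indicator (ball x (R x)) y * ennreal (f l y)) \<in> borel_measurable lborel" by measurable
    qed
    finally show ?thesis .
  qed
  show ?thesis
    by (rule tendsto_sandwich[OF _ _ tendsto_const lim0]) (use le in auto)
qed

text \<open>The weights are limits, along a subsequence, of the masses in fixed disjoint discs
  around the points of S. The radius of these discs does not affect the limit, because the mass away
  from S vanishes.\<close>

lemma concentration:
  assumes S: "finite S" "S \<subseteq> \<omega>" and bl: "\<And>a. a \<in> S \<Longrightarrow> blow_up id a"
    and lim: "tendsto_minus_infinity_loc_unif (\<omega> - S) v"
  shows "\<exists>(s :: nat \<Rightarrow> nat) \<alpha>. strict_mono s \<and> (\<forall>a\<in>S. 4 * pi * beta \<le> \<alpha> a) \<and>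
    (\<forall>\<psi>. continuous_on UNIV \<psi> \<and> compactly_supported_in \<omega> \<psi> \<longrightarrow>
      (\<lambda>l. LINT x|lborel. f (s l) x * \<psi> x) \<longlonglongrightarrow> (\<Sum>a\<in>S. \<alpha> a * \<psi> a))"
proof -
  have U: "open (\<omega> - S)" using open_omega S by (simp add: finite_imp_closed open_Diff)
  obtain \<rho> where \<rho>: "0 < \<rho>" "\<And>a. a \<in> S \<Longrightarrow> cball a (4 * \<rho>) \<subseteq> \<omega>"
      "\<And>a b. a \<in> S \<Longrightarrow> b \<in> S \<Longrightarrow> a \<noteq> b \<Longrightarrow> 8 * \<rho> < dist a b"
    using separating_radius[OF S open_omega] by metis
  have sub: "cball a \<rho> \<subseteq> \<omega>" if "a \<in> S" for a
  proof -
    have "cball a \<rho> \<subseteq> cball a (4 * \<rho>)" using \<rho>(1) by (intro subset_cball) simp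
    then show ?thesis using \<rho>(2)[OF that] by blast
  qed
  have uniq: "a = b" if "a \<in> S" "b \<in> S" "x \<in> cball a \<rho>" "x \<in> cball b \<rho>" for a b x
    using \<rho>(1) \<rho>(3)[OF that(1,2)] that(3,4) dist_triangle[of a b x] by (cases "a = b") (auto simp: dist_commute)
  obtain C1 where C1: "0 \<le> C1" "\<And>v f X G. csol v f X G \<Longrightarrow> (\<integral>\<^sup>+x. ennreal (f x) \<partial>lborel) \<le> ennreal C1"
    by (rule csol_mass) (rule that; blast)
  have intf: "integrable lborel (f l)" for l
    using C1(2)[OF csol, of l] by (intro integrableI_nonneg) (auto simp: f_nonneg intro: le_less_trans)
  have intf_le: "(LINT x|lborel. f l x) \<le> C1" for l
    using C1(2)[OF csol, of l] C1(1) by (simp add: integral_eq_nn_integral f_nonneg enn2real_leI)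
  have intA: "integrable lborel (\<lambda>x. indicator A x * f l x)" if "A \<in> sets borel" for A l
    using integrable_mult_indicator[OF _ intf, of A] that by simp
  have massA: "(LINT x|lborel. indicator A x * f l x) = enn2real (mass l A)" if A: "A \<in> sets borel" for A l
  proof -
    have [measurable]: "A \<in> sets borel" by fact
    have "(LINT x|lborel. indicator A x * f l x) = enn2real (\<integral>\<^sup>+x. ennreal (indicator A x * f l x) \<partial>lborel)"
      by (rule integral_eq_nn_integral) (auto simp: f_nonneg)
    also have "(\<lambda>x. ennreal (indicator A x * f l x)) = (\<lambda>x. indicator A x * ennreal (f l x))"
      by (auto simp: fun_eq_iff split: split_indicator)
    finally show ?thesis .
  qed
  have mass_le: "mass l A \<le> ennreal C1" for l A
  proof -
    have "mass l A \<le> (\<integral>\<^sup>+x. ennreal (f l x) \<partial>lborel)" by (intro nn_integral_mono) (auto split: split_indicator)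
    then show ?thesis using C1(2)[OF csol, of l] by simp
  qed
  define m where "m a l = (LINT x|lborel. indicator (ball a \<rho>) x * f l x)" for a l
  have m: "0 \<le> m a l" "m a l \<le> C1" for a l
    using mass_le[of "ball a \<rho>" l] C1(1) by (auto simp: m_def massA enn2real_leI)
  have "\<exists>s :: nat \<Rightarrow> nat. strict_mono s \<and> (\<forall>a\<in>S. convergent (m a \<circ> s))"
    using S(1) m by (intro convergent_subsequence_finite) (auto simp: bounded_iff intro!: exI[of _ C1])
  then obtain s :: "nat \<Rightarrow> nat" where s: "strict_mono s" "\<forall>a\<in>S. convergent (m a \<circ> s)" by blast
  define \<alpha> where "\<alpha> a = Topological_Spaces.lim (m a \<circ> s)" for a
  have \<alpha>: "(\<lambda>l. m a (s l)) \<longlonglongrightarrow> \<alpha> a" if "a \<in> S" for a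
    using s(2) that convergent_LIMSEQ_iff[of "m a \<circ> s"] by (simp add: \<alpha>_def o_def)
  \<comment> \<open>The mass eventually exceeds every M below 4 pi beta; letting M increase to 4 pi
    beta gives the nonstrict bound for the limit.\<close>
  have \<alpha>_ge: "4 * pi * beta \<le> \<alpha> a" if a: "a \<in> S" for a
  proof (rule dense_le)
    fix M assume M: "M < 4 * pi * beta"
    show "M \<le> \<alpha> a"
    proof (cases "0 < M")
      case True
      have "\<forall>\<^sub>F l in sequentially. ennreal M < mass (id l) (ball a \<rho>)"
        using blow_up_mass[OF bl[OF a] \<rho>(1) sub[OF a] True M] .
      then have "\<forall>\<^sub>F l in sequentially. ennreal M < mass (id (s l)) (ball a \<rho>)"
        using s(1) by (rule eventually_subseq[rotated])
      then have "\<forall>\<^sub>F l in sequentially. M \<le> m a (s l)"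
      proof eventually_elim
        case (elim l)
        have "enn2real (ennreal M) \<le> enn2real (mass (s l) (ball a \<rho>))"
          using elim mass_le[of "ball a \<rho>" "s l"] by (intro enn2real_mono) (auto intro: le_less_trans)
        then show ?case using True by (simp add: m_def massA)
      qed
      then show ?thesis by (rule tendsto_lowerbound[OF \<alpha>[OF a]]) simp
    next
      case False
      have "0 \<le> \<alpha> a" by (rule LIMSEQ_le_const[OF \<alpha>[OF a]]) (use m(1) in auto)
      then show ?thesis using False by simp
    qed
  qed
  have "(\<lambda>l. LINT x|lborel. f (s l) x * \<psi> x) \<longlonglongrightarrow> (\<Sum>a\<in>S. \<alpha> a * \<psi> a)"
    if \<psi>: "continuous_on UNIV \<psi>" "compactly_supported_in \<omega> \<psi>" for \<psi> :: "real^2 \<Rightarrow> real"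
  proof -
    define Z where "Z = closure {x. \<psi> x \<noteq> 0}"
    have Z: "compact Z" "Z \<subseteq> \<omega>" using \<psi>(2) by (auto simp: compactly_supported_in_def Z_def)
    have Z0: "\<psi> x = 0" if "x \<notin> Z" for x using that closure_subset[of "{x. \<psi> x \<noteq> 0}"] by (auto simp: Z_def)
    have [measurable]: "\<psi> \<in> borel_measurable borel" using \<psi>(1) by (rule borel_measurable_continuous_onI)
    have [measurable]: "ball a r \<in> sets borel" for a :: "real^2" and r by simp
    obtain P where P: "0 \<le> P" "\<And>x. \<bar>\<psi> x\<bar> \<le> P"
    proof -
      have "bounded (\<psi> ` Z)"
        using Z \<psi>(1) by (intro compact_imp_bounded compact_continuous_image) (auto intro: continuous_on_subset)
      then obtain B where "\<forall>y\<in>\<psi> ` Z. norm y \<le> B" by (auto simp: bounded_iff)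
      then have "\<bar>\<psi> x\<bar> \<le> \<bar>B\<bar>" for x using Z0[of x] by (cases "x \<in> Z") force+
      then show ?thesis using that[of "\<bar>B\<bar>"] by simp
    qed
    \<comment> \<open>Subtracting from \<psi> the locally constant part \<psi> a on each disc leaves
      a bounded remainder that is small near S, so its integral against f should vanish in the
      limit.\<close>
    define g where "g x = \<psi> x - (\<Sum>a\<in>S. \<psi> a * indicator (ball a \<rho>) x)" for x
    have [measurable]: "g \<in> borel_measurable borel" unfolding g_def [abs_def] by measurable
    define B where "B = P + (\<Sum>a\<in>S. \<bar>\<psi> a\<bar>)"
    have g_bd: "\<bar>g x\<bar> \<le> B" for x
    proof -
      have "\<bar>\<Sum>a\<in>S. \<psi> a * indicator (ball a \<rho>) x\<bar> \<le> (\<Sum>a\<in>S. \<bar>\<psi> a * indicator (ball a \<rho>) x\<bar>)" by (rule sum_abs)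
      also have "\<dots> \<le> (\<Sum>a\<in>S. \<bar>\<psi> a\<bar>)" by (intro sum_mono) (auto split: split_indicator)
      finally show ?thesis using P(2)[of x] unfolding g_def B_def by linarith
    qed
    have B0: "0 \<le> B" using P(1) by (auto simp: B_def intro!: add_nonneg_nonneg sum_nonneg)
    have int_fg: "integrable lborel (\<lambda>x. f l x * g x)" for l
    proof (rule Bochner_Integration.integrable_bound)
      show "integrable lborel (\<lambda>x. B * f l x)" using intf by simp
      show "AE x in lborel. norm (f l x * g x) \<le> norm (B * f l x)"
        using g_bd B0 by (auto simp: abs_mult f_nonneg mult.commute[of B] intro!: mult_left_mono)
    qed measurable
    have split: "(LINT x|lborel. f l x * \<psi> x) = (\<Sum>a\<in>S. m a l * \<psi> a) + (LINT x|lborel. f l x * g x)" for l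
    proof -
      have "(LINT x|lborel. f l x * \<psi> x) = (LINT x|lborel. (\<Sum>a\<in>S. \<psi> a * (indicator (ball a \<rho>) x * f l x)) + f l x * g x)"
        by (intro Bochner_Integration.integral_cong refl) (simp add: g_def right_diff_distrib sum_distrib_left mult_ac)
      also have "\<dots> = (LINT x|lborel. (\<Sum>a\<in>S. \<psi> a * (indicator (ball a \<rho>) x * f l x))) + (LINT x|lborel. f l x * g x)"
        by (intro Bochner_Integration.integral_add Bochner_Integration.integrable_sum integrable_mult_right intA int_fg) simp
      also have "(LINT x|lborel. (\<Sum>a\<in>S. \<psi> a * (indicator (ball a \<rho>) x * f l x))) = (\<Sum>a\<in>S. LINT x|lborel. \<psi> a * (indicator (ball a \<rho>) x * f l x))"
        by (intro Bochner_Integration.integral_sum integrable_mult_right intA) simp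
      also have "\<dots> = (\<Sum>a\<in>S. m a l * \<psi> a)" by (simp add: m_def mult.commute)
      finally show ?thesis .
    qed
    have rem: "(\<lambda>l. LINT x|lborel. f l x * g x) \<longlonglongrightarrow> 0"
    proof (rule tendstoI)
      fix e :: real assume e: "0 < e"
      \<comment> \<open>Near S the remainder is at most e', which contributes at most e' C1 < e / 2.
        The compact set K below is what is left of the support, and it stays away from S, so its
        mass tends to 0.\<close>
      define e' where "e' = e / (2 * (C1 + 1))"
      have e': "0 < e'" "e' * C1 < e / 2" using e C1(1) by (auto simp: e'_def field_simps)
      have ev: "eventually (\<lambda>\<sigma>. \<forall>x\<in>ball a \<sigma>. \<bar>\<psi> x - \<psi> a\<bar> < e') (at_right 0)" for a
      proof -
        have "isCont \<psi> a" using \<psi>(1) by (simp add: continuous_on_eq_continuous_at)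
        then obtain d where d: "0 < d" "\<And>x. dist x a < d \<Longrightarrow> dist (\<psi> x) (\<psi> a) < e'"
          unfolding continuous_at_eps_delta using e' by blast
        have "eventually (\<lambda>\<sigma>. 0 < \<sigma> \<and> \<sigma> < d) (at_right 0)" using d eventually_at_right_real[of 0 d] by simp
        then show ?thesis by eventually_elim (use d(2) in \<open>auto simp: dist_real_def dist_commute\<close>)
      qed
      have "eventually (\<lambda>\<sigma>. 0 < \<sigma> \<and> \<sigma> < \<rho>) (at_right 0)" using \<rho> eventually_at_right_real[of 0 \<rho>] by simp
      moreover have "eventually (\<lambda>\<sigma>. \<forall>a\<in>S. \<forall>x\<in>ball a \<sigma>. \<bar>\<psi> x - \<psi> a\<bar> < e') (at_right 0)"
        using S(1) ev by (intro eventually_ball_finite) auto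
      ultimately have "eventually (\<lambda>\<sigma>. (0 < \<sigma> \<and> \<sigma> < \<rho>) \<and> (\<forall>a\<in>S. \<forall>x\<in>ball a \<sigma>. \<bar>\<psi> x - \<psi> a\<bar> < e')) (at_right 0)"
        by (rule eventually_conj)
      from eventually_happens'[OF trivial_limit_at_right_real this]
      obtain \<sigma> where \<sigma>: "0 < \<sigma>" "\<sigma> < \<rho>" "\<forall>a\<in>S. \<forall>x\<in>ball a \<sigma>. \<bar>\<psi> x - \<psi> a\<bar> < e'" by (elim exE conjE)
      define K where "K = (Z \<union> (\<Union>a\<in>S. cball a \<rho>)) - (\<Union>a\<in>S. ball a \<sigma>)"
      have K: "compact K" unfolding K_def using S(1) Z by (intro compact_diff compact_Un compact_UN) auto
      have "K \<subseteq> \<omega>" using Z(2) sub unfolding K_def by blast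
      moreover have "a \<notin> K" if "a \<in> S" for a
      proof -
        have "a \<in> ball a \<sigma>" using \<sigma>(1) by simp
        then show ?thesis using that unfolding K_def by blast
      qed
      ultimately have "K \<subseteq> \<omega> - S" by blast
      from mass_tendsto_0[OF U _ lim K this] have "(\<lambda>l. enn2real (mass l K)) \<longlonglongrightarrow> enn2real 0"
        by (intro tendsto_enn2real) auto
      then have "(\<lambda>l. B * enn2real (mass l K)) \<longlonglongrightarrow> B * 0" by (intro tendsto_mult tendsto_const) simp
      then have "\<forall>\<^sub>F l in sequentially. B * enn2real (mass l K) < e / 2" using e by (intro order_tendstoD) auto
      then show "\<forall>\<^sub>F l in sequentially. dist (LINT x|lborel. f l x * g x) 0 < e"
      proof eventually_elim
        case (elim l)
        have Kb: "K \<in> sets borel" using K by (simp add: borel_compact)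
        have "\<bar>LINT x|lborel. f l x * g x\<bar> \<le> (LINT x|lborel. \<bar>f l x * g x\<bar>)" by (rule integral_abs_bound)
        also have "\<dots> \<le> (LINT x|lborel. e' * f l x + B * (indicator K x * f l x))"
        proof (rule integral_mono)
          show "integrable lborel (\<lambda>x. \<bar>f l x * g x\<bar>)" using int_fg by simp
          show "integrable lborel (\<lambda>x. e' * f l x + B * (indicator K x * f l x))" using intf intA[OF Kb] by simp
          fix x
          have "\<bar>g x\<bar> \<le> e' + B * indicator K x"
          proof (cases "\<exists>a\<in>S. x \<in> ball a \<sigma>")
            case True
            then obtain a where a: "a \<in> S" "x \<in> ball a \<sigma>" by blast
            have "indicator (ball b \<rho>) x = (if b = a then 1 else 0 :: real)" if "b \<in> S" for b
            proof (cases "b = a")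
              case True
              then show ?thesis using a \<sigma> by simp
            next
              case False
              then have "x \<notin> ball b \<rho>" using uniq[OF that a(1), of x] a \<sigma> by auto
              then show ?thesis using False by simp
            qed
            then have "(\<Sum>b\<in>S. \<psi> b * indicator (ball b \<rho>) x) = (\<Sum>b\<in>S. if b = a then \<psi> b else 0)"
              by (intro sum.cong) auto
            also have "\<dots> = \<psi> a" using a S(1) by simp
            finally have "g x = \<psi> x - \<psi> a" by (simp add: g_def)
            then have "\<bar>g x\<bar> \<le> e'" using \<sigma>(3) a by force
            then show ?thesis using B0 by (simp add: add_increasing2)
          next
            case False
            show ?thesis
            proof (cases "x \<in> K")
              case True
              then show ?thesis using g_bd[of x] e' by simp
            next
              case x: False
              have "x \<notin> Z" "\<forall>a\<in>S. x \<notin> ball a \<rho>" using x False by (auto simp: K_def)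
              then have "g x = 0" using Z0 by (simp add: g_def)
              then show ?thesis using e' x by simp
            qed
          qed
          then have "f l x * \<bar>g x\<bar> \<le> f l x * (e' + B * indicator K x)" by (intro mult_left_mono f_nonneg)
          then show "\<bar>f l x * g x\<bar> \<le> e' * f l x + B * (indicator K x * f l x)"
            by (simp add: abs_mult f_nonneg algebra_simps)
        qed
        also have "\<dots> = e' * (LINT x|lborel. f l x) + B * enn2real (mass l K)"
          using intf intA[OF Kb] by (simp add: massA[OF Kb])
        also have "\<dots> \<le> e' * C1 + B * enn2real (mass l K)"
          using intf_le e' by (intro add_right_mono mult_left_mono) auto
        finally show ?case using elim e' by (simp add: dist_real_def)
      qed
    qed
    have "(\<lambda>l. (\<Sum>a\<in>S. m a (s l) * \<psi> a) + (LINT x|lborel. f (s l) x * g x)) \<longlonglongrightarrow> (\<Sum>a\<in>S. \<alpha> a * \<psi> a) + 0"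
      using LIMSEQ_subseq_LIMSEQ[OF rem s(1)]
      by (intro tendsto_add tendsto_sum tendsto_mult tendsto_const \<alpha>) (auto simp: o_def)
    then show ?thesis by (simp add: split)
  qed
  then show ?thesis using s(1) \<alpha>_ge by blast
qed

lemma tendsto_minus_infinity_subsequence:
  assumes "tendsto_minus_infinity_loc_unif U (w :: nat \<Rightarrow> real^2 \<Rightarrow> real)" "strict_mono s"
  shows "tendsto_minus_infinity_loc_unif U (\<lambda>l. w (s l))"
  unfolding tendsto_minus_infinity_loc_unif_def
proof (intro allI impI)
  fix K M assume "compact K \<and> K \<subseteq> U"
  then have "\<forall>\<^sub>F l in sequentially. \<forall>x\<in>K. w l x \<le> M"
    using assms(1) by (simp add: tendsto_minus_infinity_loc_unif_def)
  then show "\<forall>\<^sub>F l in sequentially. \<forall>x\<in>K. w (s l) x \<le> M"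
    by (rule eventually_subseq[OF assms(2)])
qed

text \<open>For a subsequence with maximal S no further subsequence blows up outside S, so the
  dichotomy applies. Bounded along a subsequence forces S to be empty; divergence to minus infinity
  gives the second or the third alternative according to whether S is empty.\<close>

theorem alternatives:
  "\<exists>r :: nat \<Rightarrow> nat. strict_mono r \<and>
     ((\<forall>K. compact K \<and> K \<subseteq> \<omega> \<longrightarrow> (\<exists>C. \<forall>l. \<forall>x\<in>K. \<bar>v (r l) x\<bar> \<le> C))
      \<or> tendsto_minus_infinity_loc_unif \<omega> (\<lambda>l. v (r l))
      \<or> (\<exists>S \<alpha>. finite S \<and> S \<noteq> {} \<and> S \<subseteq> \<omega> \<and> (\<forall>a\<in>S. blow_up r a)
           \<and> tendsto_minus_infinity_loc_unif (\<omega> - S) (\<lambda>l. v (r l))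
           \<and> (\<forall>\<psi>. continuous_on UNIV \<psi> \<and> compactly_supported_in \<omega> \<psi> \<longrightarrow>
               (\<lambda>l. LINT x|lborel. f (r l) x * \<psi> x) \<longlonglongrightarrow> (\<Sum>a\<in>S. \<alpha> a * \<psi> a))
           \<and> (\<forall>a\<in>S. 4 * pi * beta \<le> \<alpha> a)))"
proof -
  obtain r :: "nat \<Rightarrow> nat" and S where r: "strict_mono r" and S: "finite S" "S \<subseteq> \<omega>"
    and bl: "\<forall>a\<in>S. blow_up r a" and max: "\<forall>s :: nat \<Rightarrow> nat. \<forall>a\<in>\<omega> - S. strict_mono s \<longrightarrow> \<not> blow_up (r \<circ> s) a"
    using maximal_blow_up_set by (elim exE conjE)
  interpret sub: hartree_sequence \<omega> \<mu> a0 c0 CX CG "\<lambda>k. v (r k)" "\<lambda>k. f (r k)" "\<lambda>k. X (r k)" "\<lambda>k. G (r k)"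
    using csol omega_connected omega_nonempty by unfold_locales
  have blow: "sub.blow_up s a \<longleftrightarrow> blow_up (r \<circ> s) a" for s a
    by (simp add: sub.blow_up_def blow_up_def)
  have no_blow: "\<not> sub.blow_up s a" if "strict_mono s" "a \<in> \<omega> - S" for s :: "nat \<Rightarrow> nat" and a
    using max that blow by blast
  have bl_id: "sub.blow_up id a" if "a \<in> S" for a using bl that by (simp add: blow)
  consider (inf) "tendsto_minus_infinity_loc_unif (\<omega> - S) (\<lambda>k. v (r k))"
    | (bdd) s :: "nat \<Rightarrow> nat" where "strict_mono s" "\<forall>K. compact K \<and> K \<subseteq> \<omega> - S \<longrightarrow> (\<exists>C. \<forall>l. \<forall>x\<in>K. \<bar>v (r (s l)) x\<bar> \<le> C)"
    using sub.dichotomy[OF S(1) no_blow] by blast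
  then show ?thesis
  proof cases
    case inf
    show ?thesis
    proof (cases "S = {}")
      case True
      then show ?thesis using inf r by auto
    next
      case False
      obtain s :: "nat \<Rightarrow> nat" and \<alpha> where s: "strict_mono s" "\<forall>a\<in>S. 4 * pi * beta \<le> \<alpha> a"
        "\<forall>\<psi>. continuous_on UNIV \<psi> \<and> compactly_supported_in \<omega> \<psi> \<longrightarrow>
          (\<lambda>l. LINT x|lborel. f (r (s l)) x * \<psi> x) \<longlonglongrightarrow> (\<Sum>a\<in>S. \<alpha> a * \<psi> a)"
        using sub.concentration[OF S bl_id inf] by blast
      have "\<forall>a\<in>S. blow_up (r \<circ> s) a" using bl blow_up_subsequence s(1) by blast
      moreover have "tendsto_minus_infinity_loc_unif (\<omega> - S) (\<lambda>l. v ((r \<circ> s) l))"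
        using tendsto_minus_infinity_subsequence[OF inf s(1)] by simp
      moreover have "\<forall>\<psi>. continuous_on UNIV \<psi> \<and> compactly_supported_in \<omega> \<psi> \<longrightarrow>
          (\<lambda>l. LINT x|lborel. f ((r \<circ> s) l) x * \<psi> x) \<longlonglongrightarrow> (\<Sum>a\<in>S. \<alpha> a * \<psi> a)"
        using s(3) by (simp only: o_apply)
      ultimately show ?thesis
        using s(2) S False strict_mono_o[OF r s(1)] by blast
    qed
  next
    case bdd
    have "S = {}"
    proof (rule ccontr)
      assume "S \<noteq> {}"
      then obtain a where "a \<in> S" by blast
      then show False using sub.blow_up_not_bounded[OF S _ bl_id bdd(1)] bdd(2) by blast
    qed
    then show ?thesis
      using bdd(2) strict_mono_o[OF r bdd(1)] by (intro exI[of _ "r \<circ> s"] conjI disjI1) simp_all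
  qed
qed

end

section \<open>Passage to Borel representatives\<close>

lemma AE_lebesgue_on_iff:
  assumes "\<omega> \<in> sets borel"
  shows "(AE x in lebesgue_on \<omega>. P x) \<longleftrightarrow> (AE x in lborel. x \<in> \<omega> \<longrightarrow> P x)"
  using assms by (subst AE_restrict_space_iff) (auto simp: AE_completion_iff)

lemma nn_integral_lebesgue_on:
  assumes "\<omega> \<in> sets borel"
  shows "(\<integral>\<^sup>+x. h x \<partial>lebesgue_on \<omega>) = (\<integral>\<^sup>+x. h x * indicator \<omega> x \<partial>lborel)"
  using assms by (subst nn_integral_restrict_space) (auto simp: nn_integral_completion)

lemma borel_representative:
  fixes h :: "'a::euclidean_space \<Rightarrow> real"
  assumes \<omega>: "\<omega> \<in> sets borel" and h: "h \<in> borel_measurable (lebesgue_on \<omega>)"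
  shows "\<exists>g. g \<in> borel_measurable borel \<and> (AE x in lborel. x \<in> \<omega> \<longrightarrow> g x = h x) \<and> (\<forall>x. x \<notin> \<omega> \<longrightarrow> g x = 0)"
proof -
  have "(\<lambda>x. indicator \<omega> x *\<^sub>R h x) \<in> borel_measurable lebesgue"
    using h \<omega> by (subst (asm) borel_measurable_restrict_space_iff) auto
  then obtain g where g: "g \<in> borel_measurable borel" "AE x in lborel. indicator \<omega> x *\<^sub>R h x = g x"
    using completion_ex_borel_measurable_real[of "\<lambda>x. indicator \<omega> x *\<^sub>R h x" lborel] by auto
  note [measurable] = g(1) \<omega>
  show ?thesis
  proof (intro exI[of _ "\<lambda>x. indicator \<omega> x * g x"] conjI)
    show "AE x in lborel. x \<in> \<omega> \<longrightarrow> indicator \<omega> x * g x = h x"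
      using g(2) by eventually_elim auto
  qed auto
qed

lemma integral_lebesgue_on_cong:
  fixes g h :: "'a::euclidean_space \<Rightarrow> real"
  assumes \<omega>: "\<omega> \<in> sets borel" and h: "h \<in> borel_measurable (lebesgue_on \<omega>)"
    and g: "g \<in> borel_measurable borel" and ae: "AE x in lborel. x \<in> \<omega> \<longrightarrow> h x = g x"
  shows "(LINT x|lebesgue_on \<omega>. h x) = (LINT x|lborel. indicator \<omega> x * g x)"
    and "integrable (lebesgue_on \<omega>) h \<longleftrightarrow> integrable lborel (\<lambda>x. indicator \<omega> x * g x)"
proof -
  note [measurable] = \<omega> g
  have gm: "(\<lambda>x. indicator \<omega> x * g x) \<in> borel_measurable lborel" by measurable
  then have gm': "(\<lambda>x. indicator \<omega> x * g x) \<in> borel_measurable lebesgue" by (rule measurable_completion)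
  have hm: "(\<lambda>x. indicator \<omega> x *\<^sub>R h x) \<in> borel_measurable lebesgue"
    using h \<omega> by (subst (asm) borel_measurable_restrict_space_iff) auto
  have ae': "AE x in lebesgue. indicator \<omega> x *\<^sub>R h x = indicator \<omega> x * g x"
    unfolding AE_completion_iff using ae by eventually_elim (auto split: split_indicator)
  have "(LINT x|lebesgue_on \<omega>. h x) = (LINT x|lebesgue. indicator \<omega> x *\<^sub>R h x)"
    using \<omega> by (intro integral_restrict_space) auto
  also have "\<dots> = (LINT x|lebesgue. indicator \<omega> x * g x)"
    by (rule integral_cong_AE[OF hm gm' ae'])
  also have "\<dots> = (LINT x|lborel. indicator \<omega> x * g x)"
    by (rule integral_completion[OF gm])
  finally show "(LINT x|lebesgue_on \<omega>. h x) = (LINT x|lborel. indicator \<omega> x * g x)" .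
  have "integrable (lebesgue_on \<omega>) h \<longleftrightarrow> integrable lebesgue (\<lambda>x. indicator \<omega> x *\<^sub>R h x)"
    using \<omega> by (intro integrable_restrict_space) auto
  also have "\<dots> \<longleftrightarrow> integrable lebesgue (\<lambda>x. indicator \<omega> x * g x)"
    by (rule integrable_cong_AE[OF hm gm' ae'])
  also have "\<dots> \<longleftrightarrow> integrable lborel (\<lambda>x. indicator \<omega> x * g x)"
    by (rule integrable_completion[OF gm])
  finally show "integrable (lebesgue_on \<omega>) h \<longleftrightarrow> integrable lborel (\<lambda>x. indicator \<omega> x * g x)" .
qed

lemma borel_measurable_lebesgue_on:
  fixes g :: "'a::euclidean_space \<Rightarrow> real"
  assumes "g \<in> borel_measurable borel"
  shows "g \<in> borel_measurable (lebesgue_on \<omega>)"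
  using assms by (intro measurable_restrict_space1 measurable_completion) simp

text \<open>At t = 0 both sides are 0, since 0 powr x = 0 and division by 0 gives 0; the two forms
  of the kernel therefore also agree on the diagonal.\<close>

lemma riesz_kernel_eq:
  fixes t :: real
  assumes "0 \<le> t"
  shows "t\<^sup>2 powr (- (\<mu> / 2)) = 1 / t powr \<mu>"
proof (cases "t = 0")
  case False
  then have "t\<^sup>2 = t powr 2" using assms by simp
  then have "t\<^sup>2 powr (- (\<mu> / 2)) = t powr (- \<mu>)" by (simp only:) (simp add: powr_powr)
  then show ?thesis by (simp add: powr_minus_divide)
qed simp

lemma smooth_borel_measurable:
  fixes \<phi> :: "real^'n::finite \<Rightarrow> real"
  assumes "smooth \<phi>"
  shows "\<phi> \<in> borel_measurable borel" "laplacian \<phi> \<in> borel_measurable borel"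
proof -
  have *: "foldr partial_deriv dirs \<phi> \<in> borel_measurable borel" for dirs
    using assms by (intro borel_measurable_continuous_onI differentiable_imp_continuous_on) (simp add: smooth_def)
  from *[of "[]"] show "\<phi> \<in> borel_measurable borel" by simp
  have [measurable]: "partial_deriv i (partial_deriv i \<phi>) \<in> borel_measurable borel" for i
    using *[of "[i, i]"] by simp
  show "laplacian \<phi> \<in> borel_measurable borel" unfolding laplacian_def [abs_def] by measurable
qed

section \<open>From the distributional equation to the solution class\<close>

context hartree
begin

text \<open>The Lebesgue measurable data are replaced by Borel functions that agree with them almost
  everywhere. The Riesz potential keeps its value at every point under this replacement, being an
  integral in y.\<close>

lemma distributional_solution_imp_sol:
  assumes Om: "open \<Omega>" "\<omega> \<subseteq> \<Omega>"
    and u: "u \<in> borel_measurable (lebesgue_on \<Omega>)" and V: "V \<in> borel_measurable (lebesgue_on \<omega>)"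
    and V_nonneg: "\<And>x. x \<in> \<omega> \<Longrightarrow> 0 \<le> V x"
    and dist: "distributional_solution \<omega> u (hartree_rhs \<mu> lam \<Omega> V u)"
    and X [measurable]: "X \<in> borel_measurable borel" and X_nonneg: "\<And>x. 0 \<le> X x"
    and X_int: "(\<integral>\<^sup>+x. ennreal (X x) \<partial>lborel) \<le> ennreal CX"
    and VX: "AE x in lborel. x \<in> \<omega> \<longrightarrow> V x \<le> c0 * X x powr a0"
    and u_int: "(\<integral>\<^sup>+x. ennreal (exp (u x / beta)) \<partial>lebesgue_on \<Omega>) \<le> ennreal CG"
  shows "\<exists>u0 f G. sol u0 f X G \<and> (AE x in lborel. x \<in> \<omega> \<longrightarrow> u0 x = u x) \<and>
    (AE x in lborel. x \<in> \<omega> \<longrightarrow> hartree_rhs \<mu> lam \<Omega> V u x = f x) \<and>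
    hartree_rhs \<mu> lam \<Omega> V u \<in> borel_measurable (lebesgue_on \<omega>)"
proof -
  have \<omega>b [measurable]: "\<omega> \<in> sets borel" using open_omega by simp
  have Ob [measurable]: "\<Omega> \<in> sets borel" using Om by simp
  have L1: "L1_loc \<omega> u" using dist by (simp add: distributional_solution_def)
  have u\<omega>: "u \<in> borel_measurable (lebesgue_on \<omega>)" using L1 by (simp add: L1_loc_def)
  obtain u0 where u0 [measurable]: "u0 \<in> borel_measurable borel" and u0_ae: "AE x in lborel. x \<in> \<omega> \<longrightarrow> u0 x = u x"
    using borel_representative[OF \<omega>b u\<omega>] by (elim exE conjE) blast
  obtain V0 where V0 [measurable]: "V0 \<in> borel_measurable borel" and V0_ae: "AE x in lborel. x \<in> \<omega> \<longrightarrow> V0 x = V x"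
    using borel_representative[OF \<omega>b V] by (elim exE conjE) blast
  have um: "(\<lambda>x. exp (u x / beta)) \<in> borel_measurable (lebesgue_on \<Omega>)" using u by simp
  obtain g where g [measurable]: "g \<in> borel_measurable borel" and g_ae: "AE x in lborel. x \<in> \<Omega> \<longrightarrow> g x = exp (u x / beta)"
    and g0: "\<And>x. x \<notin> \<Omega> \<Longrightarrow> g x = 0"
    using borel_representative[OF Ob um] by (elim exE conjE) blast
  \<comment> \<open>The absolute value makes G nonnegative at every point, also on the null set
    where g differs from the exponential.\<close>
  define G where "G x = \<bar>g x\<bar>" for x
  have [measurable]: "G \<in> borel_measurable borel" unfolding G_def [abs_def] by measurable
  have G_ae: "AE x in lborel. G x = indicator \<Omega> x * exp (u x / beta)"
    using g_ae by eventually_elim (auto simp: G_def g0 split: split_indicator)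
  have Gb_ae: "AE x in lborel. G x powr b = indicator \<Omega> x * exp (lam * u x)"
    using G_ae
  proof eventually_elim
    case (elim x)
    then show ?case using G_powr_b[of "G x" "u x"] by (cases "x \<in> \<Omega>") auto
  qed
  have G_int: "(\<integral>\<^sup>+x. ennreal (G x) \<partial>lborel) \<le> ennreal CG"
  proof -
    have "(\<integral>\<^sup>+x. ennreal (G x) \<partial>lborel) = (\<integral>\<^sup>+x. ennreal (exp (u x / beta)) * indicator \<Omega> x \<partial>lborel)"
      using G_ae by (intro nn_integral_cong_AE) (auto elim!: eventually_mono split: split_indicator)
    then show ?thesis using u_int by (simp add: nn_integral_lebesgue_on[OF Ob])
  qed
  define R where "R x = (LINT y|lborel. G y powr b * rk (x - y))" for x
  have [measurable]: "R \<in> borel_measurable borel" unfolding R_def [abs_def] by measurable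
  have R0: "0 \<le> R x" for x unfolding R_def by simp
  \<comment> \<open>Only an inequality holds: where the integral diverges, the real-valued R is 0
    while the nonnegative integral is infinite.\<close>
  have R_le: "ennreal (R x) \<le> (\<integral>\<^sup>+y. ennreal (G y powr b * rk (x - y)) \<partial>lborel)" for x
    unfolding R_def by (subst integral_eq_nn_integral) (auto simp: ennreal_enn2real_if)
  have riesz: "riesz_potential \<mu> (\<lambda>y. indicator \<Omega> y * exp (lam * u y)) x = R x" for x
  proof -
    have "(\<lambda>x. exp (lam * u x)) \<in> borel_measurable (lebesgue_on \<Omega>)" using u by simp
    then have hm: "(\<lambda>y. indicator \<Omega> y * exp (lam * u y)) \<in> borel_measurable lebesgue"
      using Ob by (subst (asm) borel_measurable_restrict_space_iff) auto
    have nm: "(\<lambda>y. norm (x - y) powr \<mu>) \<in> borel_measurable lebesgue"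
      by (rule measurable_completion) measurable
    have gm: "(\<lambda>y. G y powr b * rk (x - y)) \<in> borel_measurable lborel" by measurable
    have "riesz_potential \<mu> (\<lambda>y. indicator \<Omega> y * exp (lam * u y)) x
       = (LINT y|lebesgue. indicator \<Omega> y * exp (lam * u y) / norm (x - y) powr \<mu>)"
      by (simp add: riesz_potential_def)
    also have "\<dots> = (LINT y|lebesgue. G y powr b * rk (x - y))"
    proof (rule integral_cong_AE)
      show "(\<lambda>y. indicator \<Omega> y * exp (lam * u y) / norm (x - y) powr \<mu>) \<in> borel_measurable lebesgue"
        using hm nm by (rule borel_measurable_divide)
      show "(\<lambda>y. G y powr b * rk (x - y)) \<in> borel_measurable lebesgue"
        using gm by (rule measurable_completion)
      show "AE y in lebesgue. indicator \<Omega> y * exp (lam * u y) / norm (x - y) powr \<mu> = G y powr b * rk (x - y)"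
        unfolding AE_completion_iff using Gb_ae by eventually_elim (simp add: riesz_kernel_eq)
    qed
    also have "\<dots> = R x" unfolding R_def by (rule integral_completion[OF gm])
    finally show ?thesis .
  qed
  define f where "f x = indicator \<omega> x * (\<bar>V0 x\<bar> * R x * exp (lam * u0 x))" for x
  have [measurable]: "f \<in> borel_measurable borel" unfolding f_def [abs_def] by measurable
  have f0: "0 \<le> f x" for x using R0 by (simp add: f_def)
  have rhs: "AE x in lborel. x \<in> \<omega> \<longrightarrow> hartree_rhs \<mu> lam \<Omega> V u x = f x"
    using u0_ae V0_ae by eventually_elim (use V_nonneg in \<open>auto simp: hartree_rhs_def riesz f_def\<close>)
  have rhs_meas: "hartree_rhs \<mu> lam \<Omega> V u \<in> borel_measurable (lebesgue_on \<omega>)"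
    unfolding hartree_rhs_def riesz
    by (intro borel_measurable_times V borel_measurable_lebesgue_on borel_measurable_exp borel_measurable_const u\<omega>
        measurable_compose[OF _ borel_measurable_exp]) (use u\<omega> in measurable)
  have G_u0: "AE x in lborel. x \<in> \<omega> \<longrightarrow> G x = exp (u0 x / beta)"
    using G_ae u0_ae by eventually_elim (use Om in auto)
  have bound: "AE x in lborel. x \<in> \<omega> \<longrightarrow> ennreal (f x)
        \<le> ennreal (c0 * X x powr a0 * G x powr b) * (\<integral>\<^sup>+y. ennreal (G y powr b * rk (x - y)) \<partial>lborel)"
    using VX V0_ae G_u0
  proof eventually_elim
    case (elim x)
    show ?case
    proof
      assume x: "x \<in> \<omega>"
      have "\<bar>V0 x\<bar> \<le> c0 * X x powr a0" using elim x V_nonneg[OF x] by simp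
      moreover have "exp (lam * u0 x) = G x powr b" using elim x G_powr_b[of "G x" "u0 x"] by simp
      ultimately have "f x \<le> (c0 * X x powr a0 * G x powr b) * R x"
        using x mult_right_mono[of "\<bar>V0 x\<bar>" "c0 * X x powr a0" "G x powr b * R x"] R0[of x]
        by (simp add: f_def mult_ac)
      then have "ennreal (f x) \<le> ennreal (c0 * X x powr a0 * G x powr b * R x)" by (rule ennreal_leI)
      also have "\<dots> = ennreal (c0 * X x powr a0 * G x powr b) * ennreal (R x)"
        using c0 R0 by (intro ennreal_mult) auto
      also have "\<dots> \<le> ennreal (c0 * X x powr a0 * G x powr b) * (\<integral>\<^sup>+y. ennreal (G y powr b * rk (x - y)) \<partial>lborel)"
        by (intro mult_left_mono R_le) simp
      finally show "ennreal (f x) \<le> ennreal (c0 * X x powr a0 * G x powr b) * (\<integral>\<^sup>+y. ennreal (G y powr b * rk (x - y)) \<partial>lborel)" .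
    qed
  qed
  have "(\<integral>\<^sup>+x. ennreal (f x) \<partial>lborel) < \<infinity>"
    by (rule le_less_trans[OF mass_bound_ae[OF X _ _ X_nonneg _ X_int G_int _ bound]]) (auto simp: G_def f_def)
  moreover have "integrable lborel (\<lambda>x. indicator K x * u0 x)" if K: "compact K" "K \<subseteq> \<omega>" for K
  proof -
    have Kb: "K \<in> sets borel" using K by (simp add: borel_compact)
    have int: "integrable (lebesgue_on K) u" using L1 K by (simp add: L1_loc_def)
    have "AE x in lborel. x \<in> K \<longrightarrow> u x = u0 x" using u0_ae by eventually_elim (use K in auto)
    then show ?thesis
      using integral_lebesgue_on_cong(2)[OF Kb _ u0] int by auto
  qed
  moreover have "- (LINT x|lborel. indicator \<omega> x * (u0 x * laplacian \<phi> x)) = (LINT x|lborel. f x * \<phi> x)"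
    if \<phi>: "smooth \<phi>" "compactly_supported_in \<omega> \<phi>" for \<phi>
  proof -
    note [measurable] = smooth_borel_measurable[OF \<phi>(1)]
    have "- (LINT x|lebesgue_on \<omega>. u x * laplacian \<phi> x) = (LINT x|lebesgue_on \<omega>. hartree_rhs \<mu> lam \<Omega> V u x * \<phi> x)"
      using dist \<phi> by (simp add: distributional_solution_def)
    also have "(LINT x|lebesgue_on \<omega>. u x * laplacian \<phi> x) = (LINT x|lborel. indicator \<omega> x * (u0 x * laplacian \<phi> x))"
    proof (rule integral_lebesgue_on_cong[OF \<omega>b])
      show "(\<lambda>x. u x * laplacian \<phi> x) \<in> borel_measurable (lebesgue_on \<omega>)"
        by (intro borel_measurable_times u\<omega> borel_measurable_lebesgue_on) measurable
      show "AE x in lborel. x \<in> \<omega> \<longrightarrow> u x * laplacian \<phi> x = u0 x * laplacian \<phi> x"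
        using u0_ae by eventually_elim auto
    qed measurable
    also have "(LINT x|lebesgue_on \<omega>. hartree_rhs \<mu> lam \<Omega> V u x * \<phi> x) = (LINT x|lborel. indicator \<omega> x * (f x * \<phi> x))"
    proof (rule integral_lebesgue_on_cong[OF \<omega>b])
      show "(\<lambda>x. hartree_rhs \<mu> lam \<Omega> V u x * \<phi> x) \<in> borel_measurable (lebesgue_on \<omega>)"
        by (intro borel_measurable_times rhs_meas borel_measurable_lebesgue_on) measurable
      show "AE x in lborel. x \<in> \<omega> \<longrightarrow> hartree_rhs \<mu> lam \<Omega> V u x * \<phi> x = f x * \<phi> x"
        using rhs by eventually_elim auto
    qed measurable
    also have "(\<lambda>x. indicator \<omega> x * (f x * \<phi> x)) = (\<lambda>x. f x * \<phi> x)"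
      by (auto simp: f_def fun_eq_iff split: split_indicator)
    finally show ?thesis .
  qed
  ultimately have "weak_solution \<omega> u0 f"
    using open_omega f0 by unfold_locales auto
  then have "sol u0 f X G"
    unfolding sol_def using X_nonneg X_int G_int G_u0 bound by (auto simp: G_def f_def)
  then show ?thesis using u0_ae rhs rhs_meas by blast
qed

end

text \<open>Pushing a point measure on S forward to the Borel sets gives a construction that is a
  measure from the outset, so \<open>measure_of\<close> really has the stated values and integrals
  become finite sums.\<close>

lemma dirac_sum_eq_distr:
  fixes S :: "'a::euclidean_space set"
  assumes "finite S"
  shows "dirac_sum S \<alpha> = distr (point_measure S (\<lambda>a. ennreal (\<alpha> a))) borel (\<lambda>x. x)"
proof -
  let ?D = "distr (point_measure S (\<lambda>a. ennreal (\<alpha> a))) borel (\<lambda>x. x)"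
  have "?D = measure_of (space ?D) (sets ?D) (emeasure ?D)" by (rule measure_of_of_measure[symmetric])
  also have "\<dots> = measure_of UNIV (sets borel) (emeasure ?D)" by simp
  also have "\<dots> = dirac_sum S \<alpha>"
    unfolding dirac_sum_def
  proof (rule measure_of_eq)
    fix A :: "'a set" assume "A \<in> sigma_sets UNIV (sets borel)"
    then have A: "A \<in> sets borel" using sets.sigma_sets_eq[of "borel :: 'a measure"] by simp
    have "emeasure ?D A = emeasure (point_measure S (\<lambda>a. ennreal (\<alpha> a))) (A \<inter> S)"
      using A by (subst emeasure_distr) (auto simp: space_point_measure measurable_def sets_point_measure)
    also have "\<dots> = (\<Sum>a\<in>A \<inter> S. ennreal (\<alpha> a))"
      using assms by (intro emeasure_point_measure_finite) auto
    also have "\<dots> = (\<Sum>a\<in>S. ennreal (\<alpha> a) * emeasure (return borel a) A)"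
      using assms A by (intro sum.mono_neutral_cong_left) (auto simp: indicator_def)
    finally show "emeasure ?D A = (\<Sum>a\<in>S. ennreal (\<alpha> a) * emeasure (return borel a) A)" .
  qed simp
  finally show ?thesis by simp
qed

lemma integral_dirac_sum:
  fixes S D :: "'a::euclidean_space set"
  assumes S: "finite S" "S \<subseteq> D" and D: "D \<in> sets borel" and \<psi>: "\<psi> \<in> borel_measurable borel"
    and \<alpha>: "\<And>a. a \<in> S \<Longrightarrow> 0 \<le> \<alpha> a"
  shows "(LINT x:D|dirac_sum S \<alpha>. \<psi> x) = (\<Sum>a\<in>S. \<alpha> a * \<psi> a)"
proof -
  note [measurable] = D \<psi>
  have "(LINT x:D|dirac_sum S \<alpha>. \<psi> x) = (LINT x|point_measure S (\<lambda>a. ennreal (\<alpha> a)). indicator D x *\<^sub>R \<psi> x)"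
    unfolding set_lebesgue_integral_def dirac_sum_eq_distr[OF S(1)]
  proof (rule integral_distr)
    show "(\<lambda>x. x) \<in> point_measure S (\<lambda>a. ennreal (\<alpha> a)) \<rightarrow>\<^sub>M borel"
      by (auto simp: measurable_def space_point_measure sets_point_measure)
  qed measurable
  also have "\<dots> = (\<Sum>a\<in>S. \<alpha> a *\<^sub>R (indicator D a *\<^sub>R \<psi> a))"
    using S \<alpha> by (intro lebesgue_integral_point_measure_finite) auto
  also have "\<dots> = (\<Sum>a\<in>S. \<alpha> a * \<psi> a)"
    using S by (intro sum.cong) auto
  finally show ?thesis .
qed

section \<open>Exponents and norms\<close>

lemma Lp_norm_finite_exponentD:
  assumes q: "q \<noteq> \<infinity>" "0 < enn2real q" and c: "0 \<le> c" "Lp_norm q M g \<le> ennreal c"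
  shows "(\<integral>\<^sup>+x. ennreal (\<bar>g x\<bar> powr enn2real q) \<partial>M) \<le> ennreal (c powr enn2real q)"
proof -
  define I where "I = (\<integral>\<^sup>+x. ennreal (\<bar>g x\<bar> powr enn2real q) \<partial>M)"
  have fin: "I \<noteq> \<infinity>"
    using c q(1) by (auto simp: Lp_norm_def I_def Let_def top_unique split: if_splits)
  then have "ennreal (enn2real I powr (1 / enn2real q)) \<le> ennreal c"
    using c q(1) by (auto simp: Lp_norm_def I_def Let_def)
  then have le: "enn2real I powr (1 / enn2real q) \<le> c" using c by (simp add: ennreal_le_iff)
  have "enn2real I = (enn2real I powr (1 / enn2real q)) powr enn2real q"
    using q by (simp add: powr_powr)
  also have "\<dots> \<le> c powr enn2real q" using le q by (intro powr_mono2) auto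
  finally have "enn2real I \<le> c powr enn2real q" .
  then have "ennreal (enn2real I) \<le> ennreal (c powr enn2real q)" by (rule ennreal_leI)
  moreover have "ennreal (enn2real I) = I" using fin by (simp add: less_top)
  ultimately have "I \<le> ennreal (c powr enn2real q)" by (simp only:)
  then show ?thesis by (simp only: I_def)
qed

lemma exponent_relations:
  fixes \<mu> lam :: real and p q :: ennreal
  assumes \<mu>: "0 < \<mu>" "\<mu> < 2" and lam: "lam = (4 - \<mu>) / 4" and p: "ennreal (2 / \<mu>) < p"
    and q: "1 / q + 1 / (2 * p) = ennreal lam"
  defines "a0 \<equiv> if p = \<infinity> then 0 else 1 / enn2real p"
  shows "0 \<le> a0" "a0 < \<mu> / 2" "q = ennreal (1 / (lam - a0 / 2))" "0 < lam - a0 / 2"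
    "enn2real (1 / (2 * ennreal lam * p)) = a0 / (2 * lam)" "p \<noteq> \<infinity> \<Longrightarrow> 0 < enn2real p"
proof -
  have lam0: "0 < lam" using \<mu> by (simp add: lam)
  have p': "p = ennreal (enn2real p)" "2 / \<mu> < enn2real p" if "p \<noteq> \<infinity>"
  proof -
    show 1: "p = ennreal (enn2real p)" using that by (simp add: less_top)
    have "ennreal (2 / \<mu>) < ennreal (enn2real p)" using p 1 by simp
    then show "2 / \<mu> < enn2real p" using \<mu> by (simp add: ennreal_less_iff)
  qed
  show pos: "0 < enn2real p" if "p \<noteq> \<infinity>" using p'(2)[OF that] \<mu> by (smt (verit) divide_pos_pos)
  show a0: "0 \<le> a0" by (simp add: a0_def)
  show a0': "a0 < \<mu> / 2"
  proof (cases "p = \<infinity>")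
    case False
    then show ?thesis using p'(2) pos \<mu> by (simp add: a0_def field_simps)
  qed (use \<mu> in \<open>simp add: a0_def\<close>)
  show b: "0 < lam - a0 / 2" using a0' \<mu> by (simp add: lam field_simps)
  have p2: "1 / (2 * p) = ennreal (a0 / 2)"
  proof (cases "p = \<infinity>")
    case False
    have "2 * p = ennreal (2 * enn2real p)" using p'(1)[OF False] pos[OF False]
      by (metis ennreal_mult ennreal_numeral enn2real_nonneg zero_le_numeral)
    then have "1 / (2 * p) = ennreal 1 / ennreal (2 * enn2real p)" by simp
    also have "\<dots> = ennreal (1 / (2 * enn2real p))" using pos[OF False] by (intro divide_ennreal) auto
    finally show ?thesis using False by (simp add: a0_def)
  qed (simp add: a0_def ennreal_mult_top)
  show "q = ennreal (1 / (lam - a0 / 2))"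
  proof -
    have q0: "q \<noteq> 0"
    proof
      assume "q = 0"
      then show False using q by simp
    qed
    have qinf: "q \<noteq> \<infinity>"
    proof
      assume "q = \<infinity>"
      then have "ennreal (a0 / 2) = ennreal lam" using q p2 by simp
      then have "a0 / 2 = lam" using a0 lam0 by (simp add: ennreal_inj)
      then show False using b lam0 by simp
    qed
    define Q where "Q = enn2real q"
    have Q: "q = ennreal Q" "0 < Q" using q0 qinf by (auto simp: Q_def less_top enn2real_positive_iff zero_less_iff_neq_zero)
    have "1 / q = ennreal 1 / ennreal Q" using Q by simp
    also have "\<dots> = ennreal (1 / Q)" using Q by (intro divide_ennreal) auto
    finally have "ennreal (1 / Q) + ennreal (a0 / 2) = ennreal lam" using q p2 by simp
    then have "ennreal (1 / Q + a0 / 2) = ennreal lam" using Q a0 by (simp add: ennreal_plus)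
    then have "1 / Q + a0 / 2 = lam" using Q a0 lam0 by (subst (asm) ennreal_inj) auto
    then have "1 / Q = lam - a0 / 2" by simp
    then have "Q = 1 / (lam - a0 / 2)" using Q(2) by (metis divide_divide_eq_right div_by_1 mult_1)
    then show ?thesis using Q by simp
  qed
  show "enn2real (1 / (2 * ennreal lam * p)) = a0 / (2 * lam)"
  proof (cases "p = \<infinity>")
    case True
    have "2 * ennreal lam * p = \<infinity>" using True lam0 by (simp add: ennreal_mult_top)
    then show ?thesis using True by (simp add: a0_def)
  next
    case False
    have "2 * ennreal lam * p = ennreal (2 * lam * enn2real p)"
      using p'(1)[OF False] lam0
      by (metis ennreal_mult ennreal_numeral enn2real_nonneg zero_le_numeral less_imp_le mult_nonneg_nonneg)
    then have "1 / (2 * ennreal lam * p) = ennreal 1 / ennreal (2 * lam * enn2real p)" by simp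
    also have "\<dots> = ennreal (1 / (2 * lam * enn2real p))" using pos[OF False] lam0 by (intro divide_ennreal) auto
    finally show ?thesis using False lam0 by (simp add: a0_def)
  qed
qed

text \<open>What remains is to fit the hypotheses to the solution class and to translate the
  alternatives back. The value of \<open>H.beta\<close> is what turns the lower bound on the weights
  into the stated one.\<close>

theorem theorem1p1:
  fixes \<omega> :: "(real^2) set" and \<Omega> :: "nat \<Rightarrow> (real^2) set"
    and \<mu> lam c\<^sub>0 :: real and p q :: ennreal
    and u V :: "nat \<Rightarrow> real^2 \<Rightarrow> real"
  assumes "bounded_domain \<omega>"
    and "0 < \<mu>" and "\<mu> < 2"
    and "lam = (4 - \<mu>) / 4"
    and "ennreal (2 / \<mu>) < p"
    and "1 / q + 1 / (2 * p) = ennreal lam"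
    and "\<And>k. bounded_domain (\<Omega> k)"
    and "\<omega> \<subseteq> \<Omega> 0" and "\<And>k. \<Omega> k \<subseteq> \<Omega> (Suc k)"
    and "\<And>k. u k \<in> borel_measurable (lebesgue_on (\<Omega> k))"
    and "\<And>k. V k \<in> borel_measurable (lebesgue_on \<omega>)"
    and "\<And>k x. x \<in> \<omega> \<Longrightarrow> 0 \<le> V k x"
    and "\<And>k. distributional_solution \<omega> (u k) (hartree_rhs \<mu> lam (\<Omega> k) (V k) (u k))"
    and "0 < c\<^sub>0"
    and "\<And>k. Lp_norm p (lebesgue_on \<omega>) (V k)
              + Lp_norm q (lebesgue_on (\<Omega> k)) (\<lambda>x. exp (lam * u k x)) \<le> ennreal c\<^sub>0"
  shows "\<exists>v. (\<forall>k. continuous_representative \<omega> (u k) (v k)) \<and>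
    (\<exists>r :: nat \<Rightarrow> nat. strict_mono r \<and>
      (bounded_in_Linf_loc \<omega> (\<lambda>l. v (r l))
       \<or> tendsto_minus_infinity_loc_unif \<omega> (\<lambda>l. v (r l))
       \<or> (\<exists>S \<alpha>. finite S \<and> S \<noteq> {} \<and> S \<subseteq> \<omega>
            \<and> (\<forall>a\<in>S. \<exists>x. (\<forall>l. x l \<in> \<omega>) \<and> x \<longlonglongrightarrow> a
                   \<and> filterlim (\<lambda>l. v (r l) (x l)) at_top sequentially)
            \<and> tendsto_minus_infinity_loc_unif (\<omega> - S) (\<lambda>l. v (r l))
            \<and> weak_star_converges \<omega>
                (\<lambda>l. hartree_rhs \<mu> lam (\<Omega> (r l)) (V (r l)) (u (r l))) (dirac_sum S \<alpha>)
            \<and> (\<forall>a\<in>S. \<alpha> a \<ge> 4 * pi * (1 - enn2real (1 / (2 * ennreal lam * p)))))))"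
proof -
  define a0 where "a0 = (if p = \<infinity> then 0 else 1 / enn2real p)"
  define bb where "bb = lam - a0 / 2"
  note exps = exponent_relations[OF assms(2-6), folded a0_def, folded bb_def]
  \<comment> \<open>For p = \<infinity> the bound on V is the constant c1 and X is the indicator of
    omega; for finite p the bound sits in X = |V|^p and c1 = 1. \<open>CX\<close> bounds the
    integral of X in each case.\<close>
  define c1 where "c1 = (if p = \<infinity> then c\<^sub>0 else 1)"
  define CX where "CX = (if p = \<infinity> then measure lborel \<omega> else c\<^sub>0 powr enn2real p)"
  define CG where "CG = c\<^sub>0 powr (1 / bb)"
  have \<omega>: "open \<omega>" "connected \<omega>" "\<omega> \<noteq> {}" "bounded \<omega>" using assms(1) by (auto simp: bounded_domain_def)
  have \<omega>b [measurable]: "\<omega> \<in> sets borel" using \<omega> by simp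
  interpret H: hartree \<omega> \<mu> a0 c1 CX CG
    by unfold_locales (use \<omega> assms exps in \<open>auto simp: c1_def CX_def CG_def\<close>)
  have lam: "H.lam = lam" using assms(4) by (simp add: H.lam_def field_simps)
  have Hb: "H.b = bb" by (simp add: H.b_def lam bb_def)
  have lam0: "0 < lam" using H.exponents(1) lam by simp
  have Om: "open (\<Omega> k)" "\<omega> \<subseteq> \<Omega> k" for k
  proof -
    show "open (\<Omega> k)" using assms(7) by (simp add: bounded_domain_def)
    show "\<omega> \<subseteq> \<Omega> k" using assms(8,9) by (induction k) blast+
  qed
  have ex_sol: "\<exists>u0 f X G. H.sol u0 f X G \<and> (AE x in lborel. x \<in> \<omega> \<longrightarrow> u0 x = u k x) \<and>
    (AE x in lborel. x \<in> \<omega> \<longrightarrow> hartree_rhs \<mu> lam (\<Omega> k) (V k) (u k) x = f x) \<and>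
    hartree_rhs \<mu> lam (\<Omega> k) (V k) (u k) \<in> borel_measurable (lebesgue_on \<omega>)" for k
  proof -
    have VN: "Lp_norm p (lebesgue_on \<omega>) (V k) \<le> ennreal c\<^sub>0"
      and uN: "Lp_norm q (lebesgue_on (\<Omega> k)) (\<lambda>x. exp (lam * u k x)) \<le> ennreal c\<^sub>0"
      using assms(15)[of k] by (meson add_increasing add_increasing2 order_refl order_trans zero_le le_add_same_cancel1 le_add_same_cancel2)+
    have "enn2real q = 1 / bb" using exps(3,4) by simp
    then have "(\<integral>\<^sup>+x. ennreal (\<bar>exp (lam * u k x)\<bar> powr (1 / bb)) \<partial>lebesgue_on (\<Omega> k)) \<le> ennreal CG"
      using Lp_norm_finite_exponentD[of q c\<^sub>0, OF _ _ _ uN] exps(3,4) assms(14) by (simp add: CG_def)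
    moreover have "\<bar>exp (lam * u k x)\<bar> powr (1 / bb) = exp (u k x / H.beta)" for x
      using exps(4) lam0 by (simp add: H.beta_def lam Hb powr_def)
    ultimately have uI: "(\<integral>\<^sup>+x. ennreal (exp (u k x / H.beta)) \<partial>lebesgue_on (\<Omega> k)) \<le> ennreal CG" by simp
    have "\<exists>X. X \<in> borel_measurable borel \<and> (\<forall>x. 0 \<le> X x) \<and> (\<integral>\<^sup>+x. ennreal (X x) \<partial>lborel) \<le> ennreal CX \<and>
       (AE x in lborel. x \<in> \<omega> \<longrightarrow> V k x \<le> c1 * X x powr a0)"
    proof (cases "p = \<infinity>")
      case True
      have "AE x in lebesgue_on \<omega>. ennreal \<bar>V k x\<bar> \<le> esssup (lebesgue_on \<omega>) (\<lambda>x. ennreal \<bar>V k x\<bar>)"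
        by (rule esssup_AE)
      then have "AE x in lebesgue_on \<omega>. ennreal \<bar>V k x\<bar> \<le> ennreal c\<^sub>0"
        using VN True by (auto simp: Lp_norm_def elim: eventually_mono order_trans)
      \<comment> \<open>With a0 = 0 the power is 1 powr 0 = 1 on omega.\<close>
      then have "AE x in lborel. x \<in> \<omega> \<longrightarrow> V k x \<le> c1 * indicator \<omega> x powr a0"
        unfolding AE_lebesgue_on_iff[OF \<omega>b] using assms(14)
        by (auto elim!: eventually_mono simp: c1_def True ennreal_le_iff)
      moreover have "(\<integral>\<^sup>+x. ennreal (indicator \<omega> x) \<partial>lborel) \<le> ennreal CX"
        using emeasure_bounded_finite[OF \<omega>(4)] True
        by (simp add: CX_def ennreal_indicator emeasure_eq_ennreal_measure less_top)
      ultimately show ?thesis by (intro exI[of _ "indicator \<omega>"]) auto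
    next
      case False
      define P where "P = enn2real p"
      have P: "0 < P" using exps(6)[OF False] by (simp add: P_def)
      obtain g where g [measurable]: "g \<in> borel_measurable borel" and g_ae: "AE x in lborel. x \<in> \<omega> \<longrightarrow> g x = V k x"
        and g0: "\<And>x. x \<notin> \<omega> \<Longrightarrow> g x = 0"
        using borel_representative[OF \<omega>b assms(11)[of k]] by (elim exE conjE) blast
      have "(\<integral>\<^sup>+x. ennreal (\<bar>g x\<bar> powr P) \<partial>lborel) = (\<integral>\<^sup>+x. ennreal (\<bar>V k x\<bar> powr P) * indicator \<omega> x \<partial>lborel)"
        using g_ae g0 by (intro nn_integral_cong_AE) (auto elim!: eventually_mono split: split_indicator)
      also have "\<dots> = (\<integral>\<^sup>+x. ennreal (\<bar>V k x\<bar> powr P) \<partial>lebesgue_on \<omega>)" by (simp add: nn_integral_lebesgue_on)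
      also have "\<dots> \<le> ennreal CX"
        using Lp_norm_finite_exponentD[of p c\<^sub>0, OF False _ _ VN] P assms(14) False by (simp add: CX_def P_def)
      finally have "(\<integral>\<^sup>+x. ennreal (\<bar>g x\<bar> powr P) \<partial>lborel) \<le> ennreal CX" .
      moreover have "AE x in lborel. x \<in> \<omega> \<longrightarrow> V k x \<le> c1 * (\<bar>g x\<bar> powr P) powr a0"
        using g_ae by eventually_elim (use P False in \<open>auto simp: c1_def a0_def P_def[symmetric] powr_powr\<close>)
      ultimately show ?thesis by (intro exI[of _ "\<lambda>x. \<bar>g x\<bar> powr P"]) auto
    qed
    then obtain X where X: "X \<in> borel_measurable borel" "\<And>x. 0 \<le> X x" "(\<integral>\<^sup>+x. ennreal (X x) \<partial>lborel) \<le> ennreal CX"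
       "AE x in lborel. x \<in> \<omega> \<longrightarrow> V k x \<le> c1 * X x powr a0" by blast
    show ?thesis
      using H.distributional_solution_imp_sol[OF Om assms(10,11,12) assms(13)[of k, folded lam] X uI] unfolding lam by blast
  qed
  have ex_csol: "\<exists>v f X G. H.csol v f X G \<and> (AE x in lborel. x \<in> \<omega> \<longrightarrow> v x = u k x) \<and>
    (AE x in lborel. x \<in> \<omega> \<longrightarrow> hartree_rhs \<mu> lam (\<Omega> k) (V k) (u k) x = f x) \<and>
    hartree_rhs \<mu> lam (\<Omega> k) (V k) (u k) \<in> borel_measurable (lebesgue_on \<omega>)" for k
  proof -
    obtain u0 f X G where sol: "H.sol u0 f X G" "AE x in lborel. x \<in> \<omega> \<longrightarrow> u0 x = u k x"
      and rest: "AE x in lborel. x \<in> \<omega> \<longrightarrow> hartree_rhs \<mu> lam (\<Omega> k) (V k) (u k) x = f x"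
      "hartree_rhs \<mu> lam (\<Omega> k) (V k) (u k) \<in> borel_measurable (lebesgue_on \<omega>)"
      using ex_sol[of k] by blast
    obtain v where v: "H.csol v f X G" "AE x in lborel. x \<in> \<omega> \<longrightarrow> v x = u0 x"
      using H.continuous_representative_exists[OF sol(1)] by blast
    have "AE x in lborel. x \<in> \<omega> \<longrightarrow> v x = u k x"
      using v(2) sol(2) by eventually_elim auto
    then show ?thesis using v(1) rest by blast
  qed
  then have "\<forall>k. \<exists>v f X G. H.csol v f X G \<and> (AE x in lborel. x \<in> \<omega> \<longrightarrow> v x = u k x) \<and>
    (AE x in lborel. x \<in> \<omega> \<longrightarrow> hartree_rhs \<mu> lam (\<Omega> k) (V k) (u k) x = f x) \<and>
    hartree_rhs \<mu> lam (\<Omega> k) (V k) (u k) \<in> borel_measurable (lebesgue_on \<omega>)" by (rule allI)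
  \<comment> \<open>All four witnesses are chosen for every k at once, since the sequence locale
    needs them as functions of k.\<close>
  then have "\<exists>v f X G. \<forall>k. H.csol (v k) (f k) (X k) (G k) \<and> (AE x in lborel. x \<in> \<omega> \<longrightarrow> v k x = u k x) \<and>
    (AE x in lborel. x \<in> \<omega> \<longrightarrow> hartree_rhs \<mu> lam (\<Omega> k) (V k) (u k) x = f k x) \<and>
    hartree_rhs \<mu> lam (\<Omega> k) (V k) (u k) \<in> borel_measurable (lebesgue_on \<omega>)"
    by (simp only: choice_iff)
  then obtain v f X G where csol: "\<And>k. H.csol (v k) (f k) (X k) (G k)"
    and v_ae: "\<And>k. AE x in lborel. x \<in> \<omega> \<longrightarrow> v k x = u k x"
    and rhs_ae: "\<And>k. AE x in lborel. x \<in> \<omega> \<longrightarrow> hartree_rhs \<mu> lam (\<Omega> k) (V k) (u k) x = f k x"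
    and rhs_meas: "\<And>k. hartree_rhs \<mu> lam (\<Omega> k) (V k) (u k) \<in> borel_measurable (lebesgue_on \<omega>)"
    by (elim exE) blast
  interpret seq: hartree_sequence \<omega> \<mu> a0 c1 CX CG v f X G
    using csol \<omega> by unfold_locales auto
  have rep: "continuous_representative \<omega> (u k) (v k)" for k
    unfolding continuous_representative_def AE_lebesgue_on_iff[OF \<omega>b]
    using H.csolD(3)[OF csol] v_ae by auto
  have bdd: "bounded_in_Linf_loc \<omega> (\<lambda>l. v (r l))"
    if bd: "\<forall>K. compact K \<and> K \<subseteq> \<omega> \<longrightarrow> (\<exists>C. \<forall>l. \<forall>x\<in>K. \<bar>v (r l) x\<bar> \<le> C)" for r
    unfolding bounded_in_Linf_loc_def
  proof (intro allI impI)
    fix K assume K: "compact K \<and> K \<subseteq> \<omega>"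
    then obtain C where C: "\<forall>l. \<forall>x\<in>K. \<bar>v (r l) x\<bar> \<le> C" using bd by blast
    have "Lp_norm \<infinity> (lebesgue_on K) (v (r l)) \<le> ennreal C" for l
    proof -
      have "(\<lambda>x. ennreal \<bar>v (r l) x\<bar>) \<in> borel_measurable (lebesgue_on K)"
        using borel_measurable_lebesgue_on[OF seq.measurable_v, of "r l" K] by measurable
      then have "esssup (lebesgue_on K) (\<lambda>x. ennreal \<bar>v (r l) x\<bar>) \<le> ennreal C"
        using C by (intro esssup_I AE_I2 ennreal_leI) auto
      then show ?thesis by (simp add: Lp_norm_def)
    qed
    then show "\<exists>C. \<forall>l. Lp_norm \<infinity> (lebesgue_on K) (v (r l)) \<le> ennreal C" by blast
  qed
  have beta: "H.beta = 1 - enn2real (1 / (2 * ennreal lam * p))"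
    using lam0 by (simp add: exps(5) H.beta_def Hb lam bb_def diff_divide_distrib)
  have f_0: "f k x = 0" if "x \<notin> \<omega>" for k x
    using H.solD(12)[OF H.csolD(1)[OF csol]] that by blast
  have weak: "weak_star_converges \<omega> (\<lambda>l. hartree_rhs \<mu> lam (\<Omega> (r l)) (V (r l)) (u (r l))) (dirac_sum S \<alpha>)"
    if S: "finite S" "S \<subseteq> \<omega>" and \<alpha>: "\<forall>a\<in>S. 4 * pi * H.beta \<le> \<alpha> a"
      and lim: "\<forall>\<psi>. continuous_on UNIV \<psi> \<and> compactly_supported_in \<omega> \<psi> \<longrightarrow>
               (\<lambda>l. LINT x|lborel. f (r l) x * \<psi> x) \<longlonglongrightarrow> (\<Sum>a\<in>S. \<alpha> a * \<psi> a)" for r :: "nat \<Rightarrow> nat" and S \<alpha>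
    unfolding weak_star_converges_def
  proof (intro allI impI)
    fix \<psi> :: "real^2 \<Rightarrow> real" assume \<psi>: "continuous_on UNIV \<psi> \<and> compactly_supported_in \<omega> \<psi>"
    then have \<psi>m [measurable]: "\<psi> \<in> borel_measurable borel" by (intro borel_measurable_continuous_onI) simp
    have \<alpha>0: "0 \<le> \<alpha> a" if "a \<in> S" for a
    proof -
      have "0 \<le> 4 * pi * H.beta" using H.exponents(8) by simp
      also have "\<dots> \<le> \<alpha> a" using \<alpha> that by blast
      finally show ?thesis .
    qed
    have "(LINT x|lebesgue_on \<omega>. hartree_rhs \<mu> lam (\<Omega> k) (V k) (u k) x * \<psi> x) = (LINT x|lborel. f k x * \<psi> x)" for k
    proof -
      have "(LINT x|lebesgue_on \<omega>. hartree_rhs \<mu> lam (\<Omega> k) (V k) (u k) x * \<psi> x) = (LINT x|lborel. indicator \<omega> x * (f k x * \<psi> x))"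
      proof (rule integral_lebesgue_on_cong[OF \<omega>b])
        show "(\<lambda>x. hartree_rhs \<mu> lam (\<Omega> k) (V k) (u k) x * \<psi> x) \<in> borel_measurable (lebesgue_on \<omega>)"
          by (intro borel_measurable_times rhs_meas borel_measurable_lebesgue_on \<psi>m)
        show "AE x in lborel. x \<in> \<omega> \<longrightarrow> hartree_rhs \<mu> lam (\<Omega> k) (V k) (u k) x * \<psi> x = f k x * \<psi> x"
          using rhs_ae[of k] by eventually_elim auto
      qed measurable
      also have "(\<lambda>x. indicator \<omega> x * (f k x * \<psi> x)) = (\<lambda>x. f k x * \<psi> x)"
        by (auto simp: f_0 fun_eq_iff indicator_def)
      finally show ?thesis .
    qed
    then show "(\<lambda>l. LINT x|lebesgue_on \<omega>. hartree_rhs \<mu> lam (\<Omega> (r l)) (V (r l)) (u (r l)) x * \<psi> x)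
        \<longlonglongrightarrow> (LINT x:\<omega>|dirac_sum S \<alpha>. \<psi> x)"
      using lim \<psi> integral_dirac_sum[OF S \<omega>b \<psi>m \<alpha>0] by simp
  qed
  obtain r :: "nat \<Rightarrow> nat" where r: "strict_mono r" and
    alt: "(\<forall>K. compact K \<and> K \<subseteq> \<omega> \<longrightarrow> (\<exists>C. \<forall>l. \<forall>x\<in>K. \<bar>v (r l) x\<bar> \<le> C))
      \<or> tendsto_minus_infinity_loc_unif \<omega> (\<lambda>l. v (r l))
      \<or> (\<exists>S \<alpha>. finite S \<and> S \<noteq> {} \<and> S \<subseteq> \<omega> \<and> (\<forall>a\<in>S. seq.blow_up r a)
           \<and> tendsto_minus_infinity_loc_unif (\<omega> - S) (\<lambda>l. v (r l))
           \<and> (\<forall>\<psi>. continuous_on UNIV \<psi> \<and> compactly_supported_in \<omega> \<psi> \<longrightarrow>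
               (\<lambda>l. LINT x|lborel. f (r l) x * \<psi> x) \<longlonglongrightarrow> (\<Sum>a\<in>S. \<alpha> a * \<psi> a))
           \<and> (\<forall>a\<in>S. 4 * pi * H.beta \<le> \<alpha> a))"
    using seq.alternatives by blast
  show ?thesis
  proof (intro exI[of _ v] conjI allI rep exI[of _ r] r)
    from alt show "bounded_in_Linf_loc \<omega> (\<lambda>l. v (r l))
       \<or> tendsto_minus_infinity_loc_unif \<omega> (\<lambda>l. v (r l))
       \<or> (\<exists>S \<alpha>. finite S \<and> S \<noteq> {} \<and> S \<subseteq> \<omega>
            \<and> (\<forall>a\<in>S. \<exists>x. (\<forall>l. x l \<in> \<omega>) \<and> x \<longlonglongrightarrow> a
                   \<and> filterlim (\<lambda>l. v (r l) (x l)) at_top sequentially)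
            \<and> tendsto_minus_infinity_loc_unif (\<omega> - S) (\<lambda>l. v (r l))
            \<and> weak_star_converges \<omega>
                (\<lambda>l. hartree_rhs \<mu> lam (\<Omega> (r l)) (V (r l)) (u (r l))) (dirac_sum S \<alpha>)
            \<and> (\<forall>a\<in>S. \<alpha> a \<ge> 4 * pi * (1 - enn2real (1 / (2 * ennreal lam * p)))))"
    proof (elim disjE)
      assume "\<forall>K. compact K \<and> K \<subseteq> \<omega> \<longrightarrow> (\<exists>C. \<forall>l. \<forall>x\<in>K. \<bar>v (r l) x\<bar> \<le> C)"
      then show ?thesis by (intro disjI1 bdd)
    next
      assume "\<exists>S \<alpha>. finite S \<and> S \<noteq> {} \<and> S \<subseteq> \<omega> \<and> (\<forall>a\<in>S. seq.blow_up r a)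
           \<and> tendsto_minus_infinity_loc_unif (\<omega> - S) (\<lambda>l. v (r l))
           \<and> (\<forall>\<psi>. continuous_on UNIV \<psi> \<and> compactly_supported_in \<omega> \<psi> \<longrightarrow>
               (\<lambda>l. LINT x|lborel. f (r l) x * \<psi> x) \<longlonglongrightarrow> (\<Sum>a\<in>S. \<alpha> a * \<psi> a))
           \<and> (\<forall>a\<in>S. 4 * pi * H.beta \<le> \<alpha> a)"
      then show ?thesis
      proof (elim exE conjE)
        fix S \<alpha>
        assume S: "finite S" "S \<noteq> {}" "S \<subseteq> \<omega>" and bl: "\<forall>a\<in>S. seq.blow_up r a"
          and inf: "tendsto_minus_infinity_loc_unif (\<omega> - S) (\<lambda>l. v (r l))"
          and lim: "\<forall>\<psi>. continuous_on UNIV \<psi> \<and> compactly_supported_in \<omega> \<psi> \<longrightarrow>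
               (\<lambda>l. LINT x|lborel. f (r l) x * \<psi> x) \<longlonglongrightarrow> (\<Sum>a\<in>S. \<alpha> a * \<psi> a)"
          and \<alpha>: "\<forall>a\<in>S. 4 * pi * H.beta \<le> \<alpha> a"
        show ?thesis
          using S bl[unfolded seq.blow_up_def] inf weak[OF S(1,3) \<alpha> lim] \<alpha>[unfolded beta]
          by (intro disjI2 exI[of _ S] exI[of _ \<alpha>] conjI)
      qed
    qed (rule disjI2, rule disjI1)
  qed
qed

end
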